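(* Let $W$ be the Weyl group of type $\mathbb{A}_n$ and let $c$ be a bipartite Coxeter element of $W$. The $f$-polynomial and the $h$-polynomial of the simplicial sphere underlying the biCambrian fan $\mathrm{\mathbf{biCamb}}(W,c)$ are given by $$f(x)=\sum_{j=0}^{n}\binom{n+j}{j,j,n-j}x^{n-j},\qquad h(x)=\sum_{j=0}^{n}\binom{n}{j}^2x^{n-j},$$ where $\binom{n+j}{j,j,n-j}:=\frac{(n+j)!}{j!\,j!\,(n-j)!}$.
   Context: $W$ is the symmetric group of rank $n+1$ (i.e. $S_{n+1}$) with simple reflections $s_1,\dots,s_n$, regarded as a lattice under the right weak order $\le$. A congruence on $W$ is an equivalence relation $\equiv$ such that $x_1\equiv y_1$ and $x_2\equiv y_2$ imply $x_1\wedge x_2\equiv y_1\wedge y_2$ and $x_1\vee x_2\equiv y_1\vee y_2$. Congruences are ordered by $\Theta\le\Theta'$ if $x\equiv_\Theta y$ implies $x\equiv_{\Theta'}y$; they form a lattice. Let $Q$ be a quiver of type $\mathbb{A}_n$ (an orientation of the Dynkin diagram with vertices $1,\dots,n$). The associated Coxeter element is $c=s_{i_1}s_{i_2}\cdots s_{i_n}$, a product of all simple reflections each once, such that $s_i$ appears before $s_j$ whenever there is an arrow $j\to i$ in $Q$. It is called bipartite if every vertex of $Q$ is a sink or a source. The Hasse quiver of $W$ has an arrow $x\to y$ when $x$ covers $y$; a congruence $\Theta$ contracts $x\to y$ if $x\equiv_\Theta y$. The $c$-Cambrian congruence $\Theta_c$ is the minimum congruence on $W$ contracting all arrows $s_js_i\to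 s_j$ with $j\to i$ an arrow of $Q$. ($\Theta_{c^{-1}}$ is defined in the same way using the opposite quiver of $Q$.) Put $\Theta_{biC}:=\Theta_c\wedge\Theta_{c^{-1}}$, the greatest lower bound of the two congruences. Let $W$ act on $\mathbb{R}^n$ by its usual reflection representation (with trivial fixed subspace). The reflecting hyperplanes cut $\mathbb{R}^n$ into cones which are the maximal cones $wD$ ($w\in W$, $D$ a fixed fundamental chamber) of the Coxeter fan. The biCambrian fan $\mathrm{\mathbf{biCamb}}(W,c)$ is the coarsening of the Coxeter fan whose maximal cones are the unions $\bigcup_{w\in C}wD$, where $C$ runs over the $\Theta_{biC}$-classes; equivalently it is the coarsest common refinement of the two Cambrian fans obtained in the same way from $\Theta_c$ and $\Theta_{c^{-1}}$. The simplicial sphere underlying $\mathrm{\mathbf{biCamb}}(W,c)$ is the intersection of this fan with a unit sphere centered at the origin; it is known to be a simplicial complex, of dimension $n-1$, its $j$-dimensional faces corresponding to the $(j+1)$-dimensional cones of the fan. For a simplicial complex $\Delta$ of dimension $n-1$ let $f_{-1}=1$ and let $f_j$ be the number of $j$-dimensional faces. The $f$-polynomial is $F_\Delta(x)=\sum_{j=0}^n f_{j-1}x^{n-j}$ and the $h$-polynomial is $F_\Delta(x-1)$. *)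

theory Defs
  imports
    "HOL-Analysis.Analysis"
    "HOL-Algebra.Sym_Groups"
    "HOL-Computational_Algebra.Polynomial"
begin

section \<open>The symmetric group as a Coxeter group\<close>

abbreviation W :: "nat \<Rightarrow> (nat \<Rightarrow> nat) monoid" where
  "W n \<equiv> sym_group (n + 1)"

definition simple_refl :: "nat \<Rightarrow> nat \<Rightarrow> nat" where
  "simple_refl i = Transposition.transpose i (i + 1)"

definition word_prod :: "nat \<Rightarrow> nat list \<Rightarrow> nat \<Rightarrow> nat" where
  "word_prod n is = foldr (\<lambda>i w. simple_refl i \<otimes>\<^bsub>W n\<^esub> w) is \<one>\<^bsub>W n\<^esub>"

definition cox_length :: "nat \<Rightarrow> (nat \<Rightarrow> nat) \<Rightarrow> nat" where
  "cox_length n w = (LEAST k. \<exists>is. set is \<subseteq> {1..n} \<and> length is = k \<and> word_prod n is = w)"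

text \<open>The right weak order, whose covers are \<open>x < x s\<^sub>i\<close> for \<open>x s\<^sub>i\<close> longer than \<open>x\<close>.\<close>

definition weak_order :: "nat \<Rightarrow> (nat \<Rightarrow> nat) gorder" where
  "weak_order n =
    \<lparr> carrier = carrier (W n), eq = (=),
      le = (\<lambda>x y. cox_length n x + cox_length n (inv\<^bsub>W n\<^esub> x \<otimes>\<^bsub>W n\<^esub> y) = cox_length n y) \<rparr>"


section \<open>Lattice congruences\<close>

definition lattice_congruence :: "('a, 'b) gorder_scheme \<Rightarrow> ('a \<times> 'a) set \<Rightarrow> bool" where
  "lattice_congruence L \<Theta> \<longleftrightarrow>
    equiv (carrier L) \<Theta> \<and>
    (\<forall>x1 y1 x2 y2. (x1, y1) \<in> \<Theta> \<longrightarrow> (x2, y2) \<in> \<Theta> \<longrightarrow>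
      (x1 \<sqinter>\<^bsub>L\<^esub> x2, y1 \<sqinter>\<^bsub>L\<^esub> y2) \<in> \<Theta> \<and> (x1 \<squnion>\<^bsub>L\<^esub> x2, y1 \<squnion>\<^bsub>L\<^esub> y2) \<in> \<Theta>)"

definition congruence_lattice :: "('a, 'b) gorder_scheme \<Rightarrow> ('a \<times> 'a) set gorder" where
  "congruence_lattice L = \<lparr> carrier = {\<Theta>. lattice_congruence L \<Theta>}, eq = (=), le = (\<subseteq>) \<rparr>"


section \<open>Quivers of type A and Coxeter elements\<close>

text \<open>A pair \<open>(j, i)\<close> in \<open>Q\<close> is an arrow \<open>j \<rightarrow> i\<close>.\<close>

definition type_A_quiver :: "nat \<Rightarrow> (nat \<times> nat) set \<Rightarrow> bool" where
  "type_A_quiver n Q \<longleftrightarrow>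
    Q \<subseteq> {(j, i). j \<in> {1..n} \<and> i \<in> {1..n} \<and> (j = i + 1 \<or> i = j + 1)} \<and>
    (\<forall>i. 1 \<le> i \<and> i + 1 \<le> n \<longrightarrow> ((i, i + 1) \<in> Q) \<noteq> ((i + 1, i) \<in> Q))"

definition bipartite_quiver :: "nat \<Rightarrow> (nat \<times> nat) set \<Rightarrow> bool" where
  "bipartite_quiver n Q \<longleftrightarrow> (\<forall>v \<in> {1..n}. v \<notin> Domain Q \<or> v \<notin> Range Q)"

definition appears_before :: "'a list \<Rightarrow> 'a \<Rightarrow> 'a \<Rightarrow> bool" where
  "appears_before is i j \<longleftrightarrow> (\<exists>us vs. is = us @ vs \<and> i \<in> set us \<and> j \<in> set vs)"

definition coxeter_element_of :: "nat \<Rightarrow> (nat \<times> nat) set \<Rightarrow> (nat \<Rightarrow> nat) \<Rightarrow> bool" where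
  "coxeter_element_of n Q c \<longleftrightarrow>
    (\<exists>is. distinct is \<and> set is = {1..n} \<and>
      (\<forall>j i. (j, i) \<in> Q \<longrightarrow> appears_before is i j) \<and> c = word_prod n is)"

definition bipartite_coxeter_element :: "nat \<Rightarrow> (nat \<Rightarrow> nat) \<Rightarrow> bool" where
  "bipartite_coxeter_element n c \<longleftrightarrow>
    (\<exists>Q. type_A_quiver n Q \<and> bipartite_quiver n Q \<and> coxeter_element_of n Q c)"

text \<open>A Coxeter element determines its quiver; see \<open>quiver_of_eq\<close> below.\<close>

definition quiver_of :: "nat \<Rightarrow> (nat \<Rightarrow> nat) \<Rightarrow> (nat \<times> nat) set" where
  "quiver_of n c = (THE Q. type_A_quiver n Q \<and> coxeter_element_of n Q c)"

lemma word_prod_Nil: "word_prod n [] = id"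
  by (simp add: word_prod_def sym_group_one)

lemma word_prod_Cons: "word_prod n (i # is) = simple_refl i \<circ> word_prod n is"
  by (simp add: word_prod_def sym_group_mult)

lemma word_prod_append: "word_prod n (us @ vs) = word_prod n us \<circ> word_prod n vs"
  by (induction us) (simp_all add: word_prod_Nil word_prod_Cons comp_assoc)

lemma word_prod_le_iff: "k \<notin> set is \<Longrightarrow> word_prod n is v \<le> k \<longleftrightarrow> v \<le> k"
  by (induction "is")
    (auto simp: word_prod_Nil word_prod_Cons simple_refl_def Transposition.transpose_def)

lemma word_prod_fix: "k \<notin> set is \<Longrightarrow> k + 1 \<notin> set is \<Longrightarrow> word_prod n is (k + 1) = k + 1"
  using word_prod_le_iff[of k "is" n "k + 1"] word_prod_le_iff[of "k + 1" "is" n "k + 1"] by auto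

lemma appears_before_splitE:
  assumes "appears_before is i j" "distinct is"
  obtains us vs where "is = us @ j # vs" "j \<notin> set us" "i \<notin> set vs" "j \<notin> set vs"
proof -
  obtain as bs where ab: "is = as @ bs" "i \<in> set as" "j \<in> set bs"
    using assms(1) unfolding appears_before_def by blast
  obtain bs1 bs2 where "bs = bs1 @ j # bs2"
    using ab(3) by (meson split_list)
  then show ?thesis
    using that[of "as @ bs1" bs2] ab assms(2) by auto
qed

lemma coxeter_element_up:
  assumes "appears_before is i (i + 1)" "distinct is"
  shows "word_prod n is (i + 1) > i + 1"
proof -
  obtain us vs where s: "is = us @ (i + 1) # vs" "i + 1 \<notin> set us" "i \<notin> set vs" "i + 1 \<notin> set vs"
    using appears_before_splitE[OF assms] by blast
  have "word_prod n is (i + 1) = word_prod n us (i + 2)"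
    using s word_prod_fix[of i vs n]
    by (simp add: word_prod_append word_prod_Cons simple_refl_def)
  then show ?thesis
    using word_prod_le_iff[OF s(2), of n "i + 2"] by simp
qed

lemma coxeter_element_down:
  assumes "appears_before is (i + 1) i" "distinct is"
  shows "word_prod n is (i + 1) \<le> i"
proof -
  obtain us vs where s: "is = us @ i # vs" "i \<notin> set us" "i + 1 \<notin> set vs" "i \<notin> set vs"
    using appears_before_splitE[OF assms] by blast
  have "word_prod n is (i + 1) = word_prod n us i"
    using s word_prod_fix[of i vs n]
    by (simp add: word_prod_append word_prod_Cons simple_refl_def)
  then show ?thesis
    using word_prod_le_iff[OF s(2), of n i] by simp
qed

lemma quiver_arrows_eq:
  assumes Q: "type_A_quiver n Q" and c: "coxeter_element_of n Q c"
  shows "Q = {(i + 1, i) |i. 1 \<le> i \<and> i + 1 \<le> n \<and> c (i + 1) > i + 1} \<union>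
             {(i, i + 1) |i. 1 \<le> i \<and> i + 1 \<le> n \<and> c (i + 1) \<le> i}" (is "Q = ?R")
proof -
  have up: "c (i + 1) > i + 1" if "(i + 1, i) \<in> Q" for i
    using c that coxeter_element_up unfolding coxeter_element_of_def by blast
  have down: "c (i + 1) \<le> i" if "(i, i + 1) \<in> Q" for i
    using c that coxeter_element_down unfolding coxeter_element_of_def by blast
  have sub: "(j = i + 1 \<or> i = j + 1) \<and> 1 \<le> j \<and> j \<le> n \<and> 1 \<le> i \<and> i \<le> n" if "(j, i) \<in> Q" for i j
    using Q that unfolding type_A_quiver_def by auto
  have ex: "(i, i + 1) \<in> Q \<or> (i + 1, i) \<in> Q" if "1 \<le> i" "i + 1 \<le> n" for i
    using Q that unfolding type_A_quiver_def by blast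
  show ?thesis
  proof (intro equalityI subsetI)
    fix p assume "p \<in> Q"
    then show "p \<in> ?R"
      using sub up down by (cases p) fastforce
  next
    fix p assume "p \<in> ?R"
    then obtain i where i: "1 \<le> i" "i + 1 \<le> n"
      and p: "(p = (i + 1, i) \<and> c (i + 1) > i + 1) \<or> (p = (i, i + 1) \<and> c (i + 1) \<le> i)"
      by blast
    show "p \<in> Q"
      using ex[OF i] up[of i] down[of i] p by force
  qed
qed

lemma quiver_of_eq:
  assumes "type_A_quiver n Q" "coxeter_element_of n Q c"
  shows "quiver_of n c = Q"
  unfolding quiver_of_def
  using assms quiver_arrows_eq by (intro the_equality) blast+


section \<open>Cambrian and biCambrian congruences\<close>

definition cambrian_congruence :: "nat \<Rightarrow> (nat \<times> nat) set \<Rightarrow> ((nat \<Rightarrow> nat) \<times> (nat \<Rightarrow> nat)) set" where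
  "cambrian_congruence n Q =
    (THE \<Theta>. least (congruence_lattice (weak_order n)) \<Theta>
      {\<Theta>'. lattice_congruence (weak_order n) \<Theta>' \<and>
        (\<forall>j i. (j, i) \<in> Q \<longrightarrow> (simple_refl j \<otimes>\<^bsub>W n\<^esub> simple_refl i, simple_refl j) \<in> \<Theta>')})"

definition bicambrian_congruence :: "nat \<Rightarrow> (nat \<Rightarrow> nat) \<Rightarrow> ((nat \<Rightarrow> nat) \<times> (nat \<Rightarrow> nat)) set" where
  "bicambrian_congruence n c =
    cambrian_congruence n (quiver_of n c)
      \<sqinter>\<^bsub>congruence_lattice (weak_order n)\<^esub> cambrian_congruence n ((quiver_of n c)\<inverse>)"


section \<open>The biCambrian fan\<close>

text \<open>
  The reflection representation is realised on the sum-zero hyperplane of the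
  \<open>(n + 1)\<close>-dimensional Euclidean space with standard basis \<open>e 1, \<dots>, e (n + 1)\<close>, where \<open>w\<close> sends
  \<open>e i\<close> to \<open>e (w i)\<close>; the simple reflection \<open>i\<close> acts as the reflection in \<open>e i - e (i + 1)\<close>.
\<close>

definition refl_space :: "nat \<Rightarrow> (nat \<Rightarrow> 'a::euclidean_space) \<Rightarrow> 'a set" where
  "refl_space n e = {x. (\<Sum>i = 1..n+1. x \<bullet> e i) = 0}"

definition perm_action :: "nat \<Rightarrow> (nat \<Rightarrow> 'a::euclidean_space) \<Rightarrow> (nat \<Rightarrow> nat) \<Rightarrow> 'a \<Rightarrow> 'a" where
  "perm_action n e w x = (\<Sum>i = 1..n+1. (x \<bullet> e i) *\<^sub>R e (w i))"

definition fund_chamber :: "nat \<Rightarrow> (nat \<Rightarrow> 'a::euclidean_space) \<Rightarrow> 'a set" where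
  "fund_chamber n e = {x \<in> refl_space n e. \<forall>i \<in> {1..n}. x \<bullet> (e i - e (i + 1)) \<ge> 0}"

definition bicambrian_maximal_cones ::
    "nat \<Rightarrow> (nat \<Rightarrow> nat) \<Rightarrow> (nat \<Rightarrow> 'a::euclidean_space) \<Rightarrow> 'a set set" where
  "bicambrian_maximal_cones n c e =
    {\<Union>w\<in>C. perm_action n e w ` fund_chamber n e |C.
      C \<in> carrier (W n) // bicambrian_congruence n c}"

definition bicambrian_fan ::
    "nat \<Rightarrow> (nat \<Rightarrow> nat) \<Rightarrow> (nat \<Rightarrow> 'a::euclidean_space) \<Rightarrow> 'a set set" where
  "bicambrian_fan n c e =
    {F. F \<noteq> {} \<and> (\<exists>K \<in> bicambrian_maximal_cones n c e. F face_of K)}"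

text \<open>The cone \<open>{0}\<close> contributes the empty face.\<close>

definition bicambrian_sphere ::
    "nat \<Rightarrow> (nat \<Rightarrow> nat) \<Rightarrow> (nat \<Rightarrow> 'a::euclidean_space) \<Rightarrow> 'a set set" where
  "bicambrian_sphere n c e = (\<lambda>F. F \<inter> sphere 0 1) ` bicambrian_fan n c e"


section \<open>Face polynomials of spherical complexes\<close>

text \<open>
  A face of dimension \<open>j\<close> of a complex in the unit sphere spans a linear subspace of
  dimension \<open>j + 1\<close>, namely the span of the corresponding cone.
\<close>

definition spherical_dim :: "'a::euclidean_space set \<Rightarrow> int" where
  "spherical_dim S = int (dim S) - 1"

definition f_number :: "'a::euclidean_space set set \<Rightarrow> int \<Rightarrow> nat" where
  "f_number \<Delta> j = (if j = -1 then 1 else card {S \<in> \<Delta>. spherical_dim S = j})"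

text \<open>In both polynomials, \<open>n - 1\<close> is the dimension of the complex.\<close>

definition f_polynomial :: "nat \<Rightarrow> 'a::euclidean_space set set \<Rightarrow> real poly" where
  "f_polynomial n \<Delta> = (\<Sum>j = 0..n. Polynomial.monom (real (f_number \<Delta> (int j - 1))) (n - j))"

definition h_polynomial :: "nat \<Rightarrow> 'a::euclidean_space set set \<Rightarrow> real poly" where
  "h_polynomial n \<Delta> = pcompose (f_polynomial n \<Delta>) [:-1, 1:]"

end

theory Submission
  imports Defs
begin

text \<open>
  Permutations are treated as orders of heights: \<open>n + 1\<close> points with heights \<open>x\<close>, where an earlier
  letter of \<open>w\<close> is higher. Modulo a Cambrian congruence, \<open>w\<close> is determined by the arcs below it,
  that is by the join-irreducibles \<open>j \<le> w\<close> that the congruence does not contract, and equally by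
  the uncontracted meet-irreducibles above it; so the classes respect both meets and joins. For
  bipartite \<open>c\<close> the two families of arcs are the two alternating (zigzag) ones.

  At a level \<open>t\<close>, call a point high or low as \<open>x m > t\<close> or \<open>x m < t\<close>, and cut \<open>1, \<dots>, n + 1\<close> into
  the maximal runs \<open>[i, j]\<close> on which high and low alternate. The set of all runs occurring at some
  level determines, and is determined by, the biCambrian class. Integrating the indicator
  functions of the runs over \<open>t\<close> writes \<open>x\<close>, modulo constants, as a positive combination of
  zigzag vectors, one for each run; this combination is unique, so that the run sets are the faces
  of a simplicial fan. After the change of coordinates \<open>y k = (-1) ^ k (x k - x (k + 1))\<close>,
  \<open>u k = y k - y (k - 1)\<close> the rays become the roots \<open>e i - e j\<close>, and the fan is one over a unimodular
  triangulation of the boundary of the root polytope.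

  To count faces, write a pair \<open>(\<alpha>, \<beta>)\<close> of compositions of \<open>k\<close> with \<open>n + 1\<close> parts as the common part
  \<open>min \<alpha> \<beta>\<close> plus the root lattice point \<open>\<alpha> - \<beta>\<close>, and expand the latter over the face containing it. This
  gives \<open>\<Sum>\<^sub>F binom (n + k) (n + |F|) = (binom (n + k) n)\<^sup>2\<close> for all \<open>k\<close>, which determines the face
  numbers.
\<close>

section \<open>Inversion sets and the weak order\<close>

text \<open>Cones are handled through numbers attached to runs: the measures of level sets. They are
  nonnegative, linear on each cone and recover the point, so faces and dimensions can be read off
  from them. The one obstacle is that two runs occurring at the same point might order two positions
  in opposite ways; that this is impossible makes positive combinations over a run set unique. Roots
  appear because the jumps of a zigzag vector are alternately 1 and -1: the sign
  \<open>(-1) ^ k\<close> makes them constant on the interval of the run, and taking differences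
  leaves only its two ends. Unimodularity enters as a property of weights: a positive weight is a
  difference of two values of \<open>x\<close>, hence an integer at an integral point. Within a face
  no position is both a positive and a negative end, so roots do not cancel and the common part of
  two compositions is really their minimum. The counting identities are triangular in
  \<open>k\<close> with diagonal coefficient 1; it therefore suffices that the expected numbers
  satisfy them, which is an instance of Vandermonde.\<close>

definition inversions :: "nat \<Rightarrow> (nat \<Rightarrow> nat) \<Rightarrow> (nat \<times> nat) set" where
  "inversions n w = {(a, c). 1 \<le> a \<and> a < c \<and> c \<le> n + 1 \<and> inv' w c < inv' w a}"

definition value_pairs :: "nat \<Rightarrow> (nat \<times> nat) set" where
  "value_pairs n = {(a, c). 1 \<le> a \<and> a < c \<and> c \<le> n + 1}"

text \<open>Besides transitivity of \<open>I\<close> this asks for transitivity of its complement in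
  \<open>value_pairs n\<close>; together they characterise inversion sets.\<close>

definition biclosed :: "nat \<Rightarrow> (nat \<times> nat) set \<Rightarrow> bool" where
  "biclosed n I \<longleftrightarrow> I \<subseteq> value_pairs n \<and> trans I \<and>
    (\<forall>a b c. (a, c) \<in> I \<longrightarrow> a < b \<longrightarrow> b < c \<longrightarrow> (a, b) \<in> I \<or> (b, c) \<in> I)"

lemma finite_value_pairs: "finite (value_pairs n)"
  by (rule finite_subset[of _ "{1..n+1} \<times> {1..n+1}"]) (auto simp: value_pairs_def)

lemma inversions_subset: "inversions n w \<subseteq> value_pairs n"
  by (auto simp: inversions_def value_pairs_def)

lemma finite_inversions: "finite (inversions n w)"
  using inversions_subset finite_value_pairs finite_subset by blast

lemma biclosed_inversions: "biclosed n (inversions n w)"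
  unfolding biclosed_def trans_def using inversions_subset
  by (fastforce simp: inversions_def)

lemma biclosed_complement:
  assumes "biclosed n I"
  shows "biclosed n (value_pairs n - I)"
  unfolding biclosed_def trans_def
proof (intro conjI allI impI)
  fix a b c
  assume h: "(a, b) \<in> value_pairs n - I" "(b, c) \<in> value_pairs n - I"
  then have "a < b" "b < c" "(a, c) \<in> value_pairs n" by (auto simp: value_pairs_def)
  then show "(a, c) \<in> value_pairs n - I" using h assms unfolding biclosed_def by blast
next
  fix a b c
  assume h: "(a, c) \<in> value_pairs n - I" "a < b" "b < c"
  then have "(a, b) \<in> value_pairs n" "(b, c) \<in> value_pairs n" by (auto simp: value_pairs_def)
  then show "(a, b) \<in> value_pairs n - I \<or> (b, c) \<in> value_pairs n - I"
    using h assms unfolding biclosed_def trans_def by blast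
qed auto

lemma inv_permutes_inj: "w permutes S \<Longrightarrow> inv' w p = inv' w q \<longleftrightarrow> p = q"
  by (metis permutes_inverses(1))

lemma inv_permutes_in: "(w :: nat \<Rightarrow> nat) permutes {1..n+1} \<Longrightarrow> inv' w p \<in> {1..n+1} \<longleftrightarrow> p \<in> {1..n+1}"
  by (metis permutes_inv permutes_in_image)

lemma permutes_in: "(w :: nat \<Rightarrow> nat) permutes {1..n+1} \<Longrightarrow> w p \<in> {1..n+1} \<longleftrightarrow> p \<in> {1..n+1}"
  by (metis permutes_in_image)

text \<open>The map \<open>r\<close> sends a point to its rank, and \<open>w\<close> is the inverse
  of \<open>r\<close>, listing the points in the order \<open>P\<close>.\<close>

lemma linear_order_permutation:
  fixes P :: "nat \<Rightarrow> nat \<Rightarrow> bool"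
  assumes irr: "\<And>x. \<not> P x x" and tr: "\<And>x y z. P x y \<Longrightarrow> P y z \<Longrightarrow> P x z"
    and tot: "\<And>x y. x \<in> {1..n+1} \<Longrightarrow> y \<in> {1..n+1} \<Longrightarrow> x \<noteq> y \<Longrightarrow> P x y \<or> P y x"
  obtains w where "w permutes {1..n+1}"
    "\<And>p q. p \<in> {1..n+1} \<Longrightarrow> q \<in> {1..n+1} \<Longrightarrow> inv' w p < inv' w q \<longleftrightarrow> P p q"
proof -
  let ?A = "{1..n+1}"
  define r where "r = (\<lambda>x. if x \<in> ?A then card {y \<in> ?A. P y x} + 1 else x)"
  have less: "r x < r y" if "x \<in> ?A" "y \<in> ?A" "P x y" for x y
  proof -
    have "{z \<in> ?A. P z x} \<subset> {z \<in> ?A. P z y}" using that irr tr by blast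
    then have "card {z \<in> ?A. P z x} < card {z \<in> ?A. P z y}" by (intro psubset_card_mono) auto
    then show ?thesis using that by (simp add: r_def)
  qed
  have in_A: "r x \<in> ?A" if "x \<in> ?A" for x
  proof -
    have "{y \<in> ?A. P y x} \<subset> ?A" using that irr by blast
    then have "card {y \<in> ?A. P y x} < card ?A" by (intro psubset_card_mono) auto
    then show ?thesis using that by (simp add: r_def)
  qed
  have inj: "inj_on r ?A" using less tot by (intro inj_onI) (metis less_irrefl)
  have "bij_betw r ?A ?A"
    unfolding bij_betw_def using inj endo_inj_surj[OF finite_atLeastAtMost _ inj] in_A by blast
  then have r: "r permutes ?A" by (intro bij_imp_permutes) (auto simp: r_def)
  have "r p < r q \<longleftrightarrow> P p q" if "p \<in> ?A" "q \<in> ?A" for p q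
    using less[of p q] less[of q p] tot[of p q] that by (cases "p = q") (auto simp: irr)
  then show ?thesis using that[of "inv' r"] permutes_inv[OF r] permutes_inv_inv[OF r] by simp
qed

text \<open>\<open>P p q\<close> says that \<open>p\<close> stands before \<open>q\<close>: the
  natural order of the values, reversed on the pairs of \<open>I\<close>. Any failure of
  transitivity is excluded by transitivity of \<open>I\<close> or of its complement.\<close>

lemma biclosed_obtains:
  assumes "biclosed n I"
  obtains w where "w permutes {1..n+1}" "inversions n w = I"
proof -
  define P where "P p q \<longleftrightarrow> (p < q \<and> (p, q) \<notin> I) \<or> (q < p \<and> (q, p) \<in> I)" for p q
  have T: "(a, c) \<in> I" if "(a, b) \<in> I" "(b, c) \<in> I" for a b c
    using assms that unfolding biclosed_def trans_def by blast
  have C: "(a, b) \<in> I \<or> (b, c) \<in> I" if "(a, c) \<in> I" "a < b" "b < c" for a b c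
    using assms that unfolding biclosed_def by blast
  have tr: "P x z" if xyz: "P x y" "P y z" for x y z
  proof -
    have ne: "x \<noteq> z" using xyz unfolding P_def by auto
    consider "x < y" "y < z" "(x, y) \<notin> I" "(y, z) \<notin> I"
      | "x < y" "z < y" "(x, y) \<notin> I" "(z, y) \<in> I"
      | "y < x" "y < z" "(y, x) \<in> I" "(y, z) \<notin> I"
      | "y < x" "z < y" "(y, x) \<in> I" "(z, y) \<in> I"
      using xyz unfolding P_def by blast
    then show ?thesis
    proof cases
      case 1
      then show ?thesis using C[of x z y] by (auto simp: P_def)
    next
      case 2
      then show ?thesis using T[of x z y] C[of z y x] ne unfolding P_def by linarith
    next
      case 3
      then show ?thesis using T[of y x z] C[of y x z] ne unfolding P_def by linarith
    next
      case 4
      then show ?thesis using T[of z y x] by (auto simp: P_def)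
    qed
  qed
  have tot: "P x y \<or> P y x" if "x \<noteq> y" for x y
    using that unfolding P_def by (meson linorder_neqE_nat)
  have irr: "\<not> P x x" for x by (simp add: P_def)
  obtain w where w: "w permutes {1..n+1}"
    and less: "\<And>p q. p \<in> {1..n+1} \<Longrightarrow> q \<in> {1..n+1} \<Longrightarrow> inv' w p < inv' w q \<longleftrightarrow> P p q"
    using linear_order_permutation[of P n] irr tr tot by blast
  have "(a, c) \<in> inversions n w \<longleftrightarrow> (a, c) \<in> I" for a c
  proof -
    have "(a, c) \<in> inversions n w \<longleftrightarrow> (a, c) \<in> value_pairs n \<and> P c a"
      using less[of c a] by (auto simp: inversions_def value_pairs_def)
    moreover have "(a, c) \<in> I \<Longrightarrow> (a, c) \<in> value_pairs n" using assms biclosed_def by blast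
    ultimately show ?thesis by (auto simp: P_def value_pairs_def)
  qed
  then have "inversions n w = I" by auto
  then show ?thesis using that w by blast
qed

section \<open>Coxeter length as the number of inversions\<close>

lemma inversions_id: "inversions n id = {}"
  by (auto simp: inversions_def)

lemma simple_refl_permutes: "i \<in> {1..n} \<Longrightarrow> simple_refl i permutes {1..n+1}"
  unfolding simple_refl_def by (rule permutes_swap_id) auto

lemma simple_refl_comp: "simple_refl i \<circ> simple_refl i = id"
  by (simp add: simple_refl_def)

text \<open>The letters in positions \<open>i\<close> and \<open>i + 1\<close> are adjacent, so
  exchanging them alters the relative order of no other pair.\<close>

lemma inversions_ascent:
  assumes w: "w permutes {1..n+1}" and i: "i \<in> {1..n}" and asc: "w i < w (i + 1)"
  shows "inversions n (w \<circ> simple_refl i) = insert (w i, w (i + 1)) (inversions n w)"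
    and "(w i, w (i + 1)) \<notin> inversions n w"
proof -
  have inv: "inv' (w \<circ> simple_refl i) = simple_refl i \<circ> inv' w"
    using o_inv_distrib[OF permutes_bij[OF w] permutes_bij[OF simple_refl_permutes[OF i]]]
      inv_unique_comp[OF simple_refl_comp simple_refl_comp] by simp
  have pos: "inv' w (w k) = k" for k using w permutes_inverses(2) by fastforce
  have posI: "w k = p" if "inv' w p = k" for k p using that w permutes_inverses(1) by fastforce
  show "(w i, w (i + 1)) \<notin> inversions n w" by (auto simp: inversions_def pos)
  have in1: "w i \<in> {1..n+1}" "w (i + 1) \<in> {1..n+1}"
    using i w permutes_in_image by fastforce+
  show "inversions n (w \<circ> simple_refl i) = insert (w i, w (i + 1)) (inversions n w)"
  proof (rule Set.set_eqI)
    fix p :: "nat \<times> nat"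
    obtain a c where p: "p = (a, c)" by force
    have mem: "(a, c) \<in> inversions n (w \<circ> simple_refl i) \<longleftrightarrow>
        1 \<le> a \<and> a < c \<and> c \<le> n + 1 \<and> simple_refl i (inv' w c) < simple_refl i (inv' w a)" for a c
      by (simp add: inversions_def inv)
    consider "inv' w a = i" "inv' w c = i + 1" | "inv' w a = i + 1" "inv' w c = i"
      | "\<not> (inv' w a = i \<and> inv' w c = i + 1)" "\<not> (inv' w a = i + 1 \<and> inv' w c = i)" by blast
    then have "(a, c) \<in> inversions n (w \<circ> simple_refl i) \<longleftrightarrow>
        (a, c) \<in> insert (w i, w (i + 1)) (inversions n w)"
    proof cases
      case 1
      then have "w i = a" "w (i + 1) = c" using posI by blast+
      then show ?thesis using 1 in1 asc
        unfolding mem by (auto simp: inversions_def simple_refl_def Transposition.transpose_def)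
    next
      case 2
      then have "w (i + 1) = a" "w i = c" using posI by blast+
      then show ?thesis using 2 in1 asc
        unfolding mem by (auto simp: inversions_def simple_refl_def Transposition.transpose_def)
    next
      case 3
      then have "simple_refl i (inv' w c) < simple_refl i (inv' w a) \<longleftrightarrow> inv' w c < inv' w a"
        by (auto simp: simple_refl_def Transposition.transpose_def)
      moreover have "(a, c) \<noteq> (w i, w (i + 1))" using 3 pos by auto
      ultimately show ?thesis unfolding mem by (auto simp: inversions_def)
    qed
    then show "p \<in> inversions n (w \<circ> simple_refl i) \<longleftrightarrow>
        p \<in> insert (w i, w (i + 1)) (inversions n w)" unfolding p .
  qed
qed

lemma inversions_descent:
  assumes w: "w permutes {1..n+1}" and i: "i \<in> {1..n}" and desc: "w (i + 1) < w i"
  shows "inversions n w = insert (w (i + 1), w i) (inversions n (w \<circ> simple_refl i))"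
    and "(w (i + 1), w i) \<notin> inversions n (w \<circ> simple_refl i)"
proof -
  let ?v = "w \<circ> simple_refl i"
  have v: "?v permutes {1..n+1}" using permutes_compose[OF simple_refl_permutes[OF i] w] .
  have e: "?v i = w (i + 1)" "?v (i + 1) = w i" "?v \<circ> simple_refl i = w"
    using simple_refl_comp by (auto simp: simple_refl_def comp_assoc)
  show "inversions n w = insert (w (i + 1), w i) (inversions n ?v)"
    "(w (i + 1), w i) \<notin> inversions n ?v"
    using inversions_ascent[OF v i] e desc by auto
qed

lemma permutes_eq_id_or_descent:
  fixes w :: "nat \<Rightarrow> nat"
  assumes w: "w permutes {1..n+1}"
  shows "w = id \<or> (\<exists>i\<in>{1..n}. w (i + 1) < w i)"
proof (rule disjCI)
  assume "\<not> (\<exists>i\<in>{1..n}. w (i + 1) < w i)"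
  then have step: "w i < w (Suc i)" if "i \<in> {1..n}" for i
    using that permutes_inj[OF w] by (metis Suc_eq_plus1 antisym_conv3 injD n_not_Suc_n)
  have ge: "i \<le> w i" if "1 \<le> i" "i \<le> n + 1" for i
    using that
  proof (induction i rule: dec_induct)
    case base show ?case using permutes_in[OF w, of 1] by simp
  next
    case (step k) then show ?case using \<open>\<And>i. i \<in> {1..n} \<Longrightarrow> w i < w (Suc i)\<close>[of k] by simp
  qed
  have le: "w i \<le> i" if "i \<le> n + 1" "1 \<le> i" for i
    using that
  proof (induction i rule: inc_induct)
    case base show ?case using permutes_in[OF w, of "n + 1"] by simp
  next
    case (step k) then show ?case using \<open>\<And>i. i \<in> {1..n} \<Longrightarrow> w i < w (Suc i)\<close>[of k] by simp
  qed
  have "w i = i" for i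
    using ge[of i] le[of i] permutes_not_in[OF w, of i] by (cases "i \<in> {1..n+1}") auto
  then show "w = id" by auto
qed

lemma word_prod_permutes: "set is \<subseteq> {1..n} \<Longrightarrow> word_prod n is permutes {1..n+1}"
proof (induction "is")
  case (Cons i "is")
  then show ?case
    unfolding word_prod_Cons by (intro permutes_compose simple_refl_permutes) auto
qed (simp add: word_prod_Nil permutes_id)

lemma card_inversions_word_prod: "set is \<subseteq> {1..n} \<Longrightarrow> card (inversions n (word_prod n is)) \<le> length is"
proof (induction "is" rule: rev_induct)
  case (snoc i "is")
  let ?w = "word_prod n is"
  have i: "i \<in> {1..n}" and w: "?w permutes {1..n+1}" using snoc.prems word_prod_permutes by auto
  have "word_prod n (is @ [i]) = ?w \<circ> simple_refl i"
    by (simp add: word_prod_append word_prod_Cons word_prod_Nil)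
  moreover have "card (inversions n (?w \<circ> simple_refl i)) \<le> Suc (card (inversions n ?w))"
  proof (cases "?w i < ?w (i + 1)")
    case True
    then show ?thesis using inversions_ascent[OF w i] finite_inversions by (metis card_insert_le_m1 card_insert_disjoint order_refl)
  next
    case False
    then have "?w (i + 1) < ?w i" using permutes_inj[OF w] by (metis add.right_neutral add_left_cancel injD linorder_cases zero_neq_one)
    then show ?thesis using inversions_descent[OF w i] finite_inversions
      by (metis card_insert_disjoint le_Suc_eq le_refl Suc_leD)
  qed
  ultimately have "card (inversions n (word_prod n (is @ [i]))) \<le> Suc (card (inversions n ?w))"
    by simp
  then show ?case using snoc by fastforce
qed (simp add: word_prod_Nil inversions_id)

lemma ex_reduced_word:
  assumes "w permutes {1..n+1}"
  shows "\<exists>is. set is \<subseteq> {1..n} \<and> length is = card (inversions n w) \<and> word_prod n is = w"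
  using assms
proof (induction "card (inversions n w)" arbitrary: w rule: less_induct)
  case less
  show ?case
  proof (cases "w = id")
    case True
    then show ?thesis by (intro exI[of _ "[]"]) (simp add: word_prod_Nil inversions_id)
  next
    case False
    then obtain i where i: "i \<in> {1..n}" "w (i + 1) < w i"
      using permutes_eq_id_or_descent less.prems by blast
    let ?v = "w \<circ> simple_refl i"
    have c: "card (inversions n w) = Suc (card (inversions n ?v))"
      using inversions_descent[OF less.prems i] finite_inversions by (metis card_insert_disjoint)
    have "?v permutes {1..n+1}"
      using permutes_compose[OF simple_refl_permutes[OF i(1)] less.prems] .
    then obtain "is" where "set is \<subseteq> {1..n}" "length is = card (inversions n ?v)" "word_prod n is = ?v"
      using less.hyps[of ?v] c by auto
    then show ?thesis using c i(1) simple_refl_comp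
      by (intro exI[of _ "is @ [i]"])
        (auto simp: word_prod_append word_prod_Cons word_prod_Nil comp_assoc)
  qed
qed

lemma cox_length_eq:
  assumes "w permutes {1..n+1}"
  shows "cox_length n w = card (inversions n w)"
  unfolding cox_length_def
proof (rule Least_equality)
  show "\<exists>is. set is \<subseteq> {1..n} \<and> length is = card (inversions n w) \<and> word_prod n is = w"
    using ex_reduced_word[OF assms] .
  show "card (inversions n w) \<le> k"
    if "\<exists>is. set is \<subseteq> {1..n} \<and> length is = k \<and> word_prod n is = w" for k
    using that card_inversions_word_prod by blast
qed

text \<open>A pair of positions \<open>i < j\<close> is an inversion of
  \<open>inv' x \<circ> y\<close> when \<open>y\<close> has the letters \<open>x i\<close> and
  \<open>x j\<close> in the order opposite to that in \<open>x\<close>. So \<open>x\<close> turns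
  these pairs into the pairs of values on which \<open>x\<close> and \<open>y\<close>
  disagree.\<close>

lemma card_inversions_quotient:
  assumes x: "x permutes {1..n+1}" and y: "y permutes {1..n+1}"
  shows "card (inversions n (inv' x \<circ> y)) =
    card ((inversions n x - inversions n y) \<union> (inversions n y - inversions n x))" (is "card ?A = card ?B")
proof -
  have inv: "inv' (inv' x \<circ> y) = inv' y \<circ> x"
    using o_inv_distrib[of "inv' x" y] permutes_bij[OF permutes_inv[OF x]] permutes_bij[OF y] permutes_inv_inv[OF x]
    by simp
  have xi: "x (inv' x p) = p" "inv' x (x p) = p" for p using permutes_inverses[OF x] by auto
  have xin: "x p \<in> {1..n+1} \<longleftrightarrow> p \<in> {1..n+1}" for p using permutes_in[OF x] .
  have iin: "inv' x p \<in> {1..n+1} \<longleftrightarrow> p \<in> {1..n+1}" for p using inv_permutes_in[OF x] .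
  let ?f = "\<lambda>(i, j). (min (x i) (x j), max (x i) (x j))"
  let ?g = "\<lambda>(i, j). (min (inv' x i) (inv' x j), max (inv' x i) (inv' x j))"
  have "bij_betw ?f ?A ?B"
  proof (rule bij_betw_byWitness[where f' = ?g])
    have "?f p \<in> ?B \<and> ?g (?f p) = p" if "p \<in> ?A" for p
    proof -
      obtain i j where p: "p = (i, j)" by force
      have ij: "1 \<le> i" "i < j" "j \<le> n + 1" "inv' y (x j) < inv' y (x i)"
        using that by (auto simp: p inversions_def inv)
      have b: "1 \<le> x i" "x i \<le> n + 1" "1 \<le> x j" "x j \<le> n + 1" 
        using xin[of i] xin[of j] ij by auto
      have "x i \<noteq> x j" using ij xi by (metis less_irrefl)
      then show ?thesis using ij b by (auto simp: p inversions_def xi min_def max_def)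
    qed
    then show "\<forall>a\<in>?A. ?g (?f a) = a" "?f ` ?A \<subseteq> ?B" by blast+
    have "?g p \<in> ?A \<and> ?f (?g p) = p" if "p \<in> ?B" for p
    proof -
      obtain a c where p: "p = (a, c)" by force
      have ac: "1 \<le> a" "a < c" "c \<le> n + 1" using that by (auto simp: p inversions_def)
      have b: "1 \<le> inv' x a" "inv' x a \<le> n + 1" "1 \<le> inv' x c" "inv' x c \<le> n + 1"
        using iin[of a] iin[of c] ac by auto
      have ne: "inv' x a \<noteq> inv' x c" "inv' y a \<noteq> inv' y c"
        using ac inv_permutes_inj[OF x] inv_permutes_inj[OF y] by auto
      show ?thesis using ac b ne that by (auto simp: p inversions_def inv xi min_def max_def)
    qed
    then show "\<forall>a\<in>?B. ?f (?g a) = a" "?g ` ?B \<subseteq> ?A" by blast+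
  qed
  then show ?thesis using bij_betw_same_card by blast
qed

section \<open>The weak order as a lattice of inversion sets\<close>

lemma inv_comp_eq_id: "y permutes S \<Longrightarrow> inv' y \<circ> x = id \<Longrightarrow> x = y"
  by (metis comp_assoc comp_id id_comp permutes_inv_o(1))

lemma inversions_inject:
  assumes w: "w permutes {1..n+1}" and v: "v permutes {1..n+1}"
    and eq: "inversions n w = inversions n v"
  shows "w = v"
proof -
  let ?u = "inv' w \<circ> v"
  have u: "?u permutes {1..n+1}" using permutes_compose[OF v permutes_inv[OF w]] .
  have "inversions n ?u = {}" using card_inversions_quotient[OF w v] eq finite_inversions by simp
  then have "?u = id" using permutes_eq_id_or_descent[OF u] inversions_descent(1)[OF u] by blast
  then show ?thesis using inv_comp_eq_id[OF w] by blast
qed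

lemma weak_order_carrier: "x \<in> carrier (weak_order n) \<longleftrightarrow> x permutes {1..n+1}"
  by (simp add: weak_order_def sym_group_carrier)

text \<open>Additivity of lengths reads
  \<open>card X + card (X - Y) + card (Y - X) = card Y\<close>; cancelling what is common leaves
  \<open>X - Y = {}\<close>. Inversions are pairs of values because right multiplication exchanges
  positions.\<close>

lemma weak_order_le:
  assumes x: "x permutes {1..n+1}" and y: "y permutes {1..n+1}"
  shows "x \<sqsubseteq>\<^bsub>weak_order n\<^esub> y \<longleftrightarrow> inversions n x \<subseteq> inversions n y"
proof -
  let ?X = "inversions n x" and ?Y = "inversions n y"
  have "inv' x \<circ> y permutes {1..n+1}" using permutes_compose[OF y permutes_inv[OF x]] .
  then have "x \<sqsubseteq>\<^bsub>weak_order n\<^esub> y \<longleftrightarrow> card ?X + card ((?X - ?Y) \<union> (?Y - ?X)) = card ?Y"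
    using x y by (simp add: weak_order_def sym_group_mult sym_group_carrier cox_length_eq
        card_inversions_quotient)
  also have "card ((?X - ?Y) \<union> (?Y - ?X)) = card (?X - ?Y) + card (?Y - ?X)"
    by (intro card_Un_disjoint) (auto simp: finite_inversions)
  also have "card ?X = card (?X \<inter> ?Y) + card (?X - ?Y)"
    using card_Int_Diff[OF finite_inversions] .
  also have "card ?Y = card (?X \<inter> ?Y) + card (?Y - ?X)"
    using card_Int_Diff[OF finite_inversions, of n y ?X] by (simp add: Int_commute)
  finally show ?thesis using finite_inversions by auto
qed

text \<open>A value \<open>b\<close> between the ends of a chain is a member of it or lies strictly
  inside a link. A link belongs to \<open>I\<close> or \<open>J\<close>, whose biclosedness splits
  it at \<open>b\<close>, so \<open>b\<close> is reached from the lower end or reaches the upper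
  one.\<close>

lemma biclosed_trancl_Un:
  assumes I: "biclosed n I" and J: "biclosed n J"
  shows "biclosed n ((I \<union> J)\<^sup>+)"
proof -
  have lt: "(a, c) \<in> value_pairs n" if "(a, c) \<in> (I \<union> J)\<^sup>+" for a c
    using that
  proof (induction rule: trancl_induct)
    case (base y) then show ?case using I J unfolding biclosed_def by blast
  next
    case (step y z)
    then have "(y, z) \<in> value_pairs n" using I J unfolding biclosed_def by blast
    then show ?case using step.IH by (auto simp: value_pairs_def)
  qed
  have "(a, b) \<in> (I \<union> J)\<^sup>+ \<or> (b, c) \<in> (I \<union> J)\<^sup>+" if "(a, c) \<in> (I \<union> J)\<^sup>+" "a < b" "b < c" for a b c
    using that
  proof (induction rule: trancl_induct)
    case (base y)
    then have "(a, b) \<in> I \<union> J \<or> (b, y) \<in> I \<union> J" using I J unfolding biclosed_def by blast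
    then show ?case by blast
  next
    case (step y z)
    consider "b < y" | "b = y" | "y < b" by linarith
    then show ?case
    proof cases
      case 1
      then show ?thesis using step by (meson trancl.trancl_into_trancl)
    next
      case 2
      then show ?thesis using step by blast
    next
      case 3
      then have "(y, b) \<in> I \<union> J \<or> (b, z) \<in> I \<union> J"
        using step I J unfolding biclosed_def by blast
      then show ?thesis using step.hyps(1) by (meson r_into_trancl trancl.trancl_into_trancl)
    qed
  qed
  then show ?thesis using lt unfolding biclosed_def by (auto simp: trans_trancl)
qed

lemma weak_order_partial_order: "partial_order (weak_order n)"
proof (unfold_locales, goal_cases)
  case (5 x y) 
  then show ?case using inversions_inject by (auto simp: weak_order_carrier weak_order_le weak_order_def[of n, THEN arg_cong[of _ _ eq]])
next
  case (6 x y z)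
  then show ?case unfolding weak_order_carrier by (simp add: weak_order_le)
qed (auto simp: weak_order_carrier weak_order_le weak_order_def[of n, THEN arg_cong[of _ _ eq]])

text \<open>The join is given by the transitive closure of the union of the inversion sets; meets
  arise in the same way from the non-inversions.\<close>

lemma weak_order_lattice: "lattice (weak_order n)"
proof -
  let ?L = "weak_order n"
  interpret partial_order ?L by (rule weak_order_partial_order)
  have 1: "\<exists>s. least ?L s (Upper ?L {x, y})" if "x \<in> carrier ?L" "y \<in> carrier ?L" for x y
  proof -
    have xy: "x permutes {1..n+1}" "y permutes {1..n+1}" using that weak_order_carrier by auto
    obtain s where s: "s permutes {1..n+1}" "inversions n s = (inversions n x \<union> inversions n y)\<^sup>+"
      using biclosed_obtains biclosed_trancl_Un biclosed_inversions by metis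
    have "least ?L s (Upper ?L {x, y})"
    proof (rule least_UpperI)
      fix z assume "z \<in> {x, y}"
      then show "z \<sqsubseteq>\<^bsub>?L\<^esub> s" using s xy by (auto simp: weak_order_le)
    next
      fix z assume z: "z \<in> Upper ?L {x, y}"
      then have zp: "z permutes {1..n+1}" using weak_order_carrier by (auto simp: Upper_def)
      have "inversions n x \<union> inversions n y \<subseteq> inversions n z"
        using z that zp xy by (auto simp: Upper_def weak_order_le)
      moreover have "trans (inversions n z)" using biclosed_inversions biclosed_def by blast
      ultimately have "(inversions n x \<union> inversions n y)\<^sup>+ \<subseteq> inversions n z"
        by (metis trancl_id trancl_mono subsetI subrelI)
      then show "s \<sqsubseteq>\<^bsub>?L\<^esub> z" using s zp by (simp add: weak_order_le)
    qed (use s that weak_order_carrier in auto)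
    then show ?thesis by blast
  qed
  have 2: "\<exists>s. greatest ?L s (Lower ?L {x, y})" if "x \<in> carrier ?L" "y \<in> carrier ?L" for x y
  proof -
    let ?c = "\<lambda>w. value_pairs n - inversions n w"
    have xy: "x permutes {1..n+1}" "y permutes {1..n+1}" using that weak_order_carrier by auto
    have b: "biclosed n ((?c x \<union> ?c y)\<^sup>+)"
      by (intro biclosed_trancl_Un biclosed_complement biclosed_inversions)
    obtain s where s: "s permutes {1..n+1}" "inversions n s = value_pairs n - (?c x \<union> ?c y)\<^sup>+"
      using biclosed_obtains[OF biclosed_complement[OF b]] by metis
    have "greatest ?L s (Lower ?L {x, y})"
    proof (rule greatest_LowerI)
      fix z assume "z \<in> {x, y}"
      then show "s \<sqsubseteq>\<^bsub>?L\<^esub> z" using s xy by (auto simp: weak_order_le)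
    next
      fix z assume z: "z \<in> Lower ?L {x, y}"
      then have zp: "z permutes {1..n+1}" using weak_order_carrier by (auto simp: Lower_def)
      have "?c x \<union> ?c y \<subseteq> ?c z"
        using z that zp xy by (auto simp: Lower_def weak_order_le)
      moreover have "trans (?c z)" using biclosed_complement[OF biclosed_inversions] biclosed_def by blast
      ultimately have "(?c x \<union> ?c y)\<^sup>+ \<subseteq> ?c z"
        by (metis trancl_id trancl_mono subsetI subrelI)
      then have "inversions n z \<subseteq> inversions n s" using s inversions_subset by blast
      then show "z \<sqsubseteq>\<^bsub>?L\<^esub> s" using s zp by (simp add: weak_order_le)
    qed (use s that weak_order_carrier in auto)
    then show ?thesis by blast
  qed
  show ?thesis by unfold_locales (use 1 2 in auto)
qed

lemma weak_order_join:
  assumes x: "x permutes {1..n+1}" and y: "y permutes {1..n+1}"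
  shows "x \<squnion>\<^bsub>weak_order n\<^esub> y permutes {1..n+1}"
    and "inversions n x \<subseteq> inversions n (x \<squnion>\<^bsub>weak_order n\<^esub> y)"
    and "inversions n y \<subseteq> inversions n (x \<squnion>\<^bsub>weak_order n\<^esub> y)"
    and "\<And>z. z permutes {1..n+1} \<Longrightarrow> inversions n x \<subseteq> inversions n z \<Longrightarrow>
      inversions n y \<subseteq> inversions n z \<Longrightarrow> inversions n (x \<squnion>\<^bsub>weak_order n\<^esub> y) \<subseteq> inversions n z"
proof -
  interpret lattice "weak_order n" by (rule weak_order_lattice)
  have xy: "x \<in> carrier (weak_order n)" "y \<in> carrier (weak_order n)"
    using x y weak_order_carrier by auto
  show p: "x \<squnion>\<^bsub>weak_order n\<^esub> y permutes {1..n+1}"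
    using join_closed[OF xy] weak_order_carrier by blast
  show "inversions n x \<subseteq> inversions n (x \<squnion>\<^bsub>weak_order n\<^esub> y)"
    using join_left[OF xy] weak_order_le[OF x p] by blast
  show "inversions n y \<subseteq> inversions n (x \<squnion>\<^bsub>weak_order n\<^esub> y)"
    using join_right[OF xy] weak_order_le[OF y p] by blast
  fix z assume z: "z permutes {1..n+1}"
    and "inversions n x \<subseteq> inversions n z" "inversions n y \<subseteq> inversions n z"
  then show "inversions n (x \<squnion>\<^bsub>weak_order n\<^esub> y) \<subseteq> inversions n z"
    using join_le[OF _ _ xy] weak_order_carrier weak_order_le x y p by metis
qed

lemma weak_order_meet:
  assumes x: "x permutes {1..n+1}" and y: "y permutes {1..n+1}"
  shows "x \<sqinter>\<^bsub>weak_order n\<^esub> y permutes {1..n+1}"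
    and "inversions n (x \<sqinter>\<^bsub>weak_order n\<^esub> y) \<subseteq> inversions n x"
    and "inversions n (x \<sqinter>\<^bsub>weak_order n\<^esub> y) \<subseteq> inversions n y"
    and "\<And>z. z permutes {1..n+1} \<Longrightarrow> inversions n z \<subseteq> inversions n x \<Longrightarrow>
      inversions n z \<subseteq> inversions n y \<Longrightarrow> inversions n z \<subseteq> inversions n (x \<sqinter>\<^bsub>weak_order n\<^esub> y)"
proof -
  interpret lattice "weak_order n" by (rule weak_order_lattice)
  have xy: "x \<in> carrier (weak_order n)" "y \<in> carrier (weak_order n)"
    using x y weak_order_carrier by auto
  show p: "x \<sqinter>\<^bsub>weak_order n\<^esub> y permutes {1..n+1}"
    using meet_closed[OF xy] weak_order_carrier by blast
  show "inversions n (x \<sqinter>\<^bsub>weak_order n\<^esub> y) \<subseteq> inversions n x"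
    using meet_left[OF xy] weak_order_le[OF p x] by blast
  show "inversions n (x \<sqinter>\<^bsub>weak_order n\<^esub> y) \<subseteq> inversions n y"
    using meet_right[OF xy] weak_order_le[OF p y] by blast
  fix z assume z: "z permutes {1..n+1}"
    and "inversions n z \<subseteq> inversions n x" "inversions n z \<subseteq> inversions n y"
  then show "inversions n z \<subseteq> inversions n (x \<sqinter>\<^bsub>weak_order n\<^esub> y)"
    using meet_le[OF _ _ xy] weak_order_carrier weak_order_le x y p by metis
qed

section \<open>Cambrian congruences via arcs\<close>

text \<open>
  The inversions of the join-irreducible whose only descent is \<open>c a\<close>, with the intermediate values
  in \<open>U\<close> to the left of \<open>c\<close> and the others to the right of \<open>a\<close>. The complement of
  \<open>arc_inversions (- U) a c\<close> belongs to a meet-irreducible.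
\<close>

definition arc_inversions :: "nat set \<Rightarrow> nat \<Rightarrow> nat \<Rightarrow> (nat \<times> nat) set" where
  "arc_inversions U a c =
    {(q, p). a \<le> q \<and> q < p \<and> p \<le> c \<and> (q = a \<or> q \<notin> U) \<and> (p = c \<or> p \<in> U)}"

definition lower_arcs :: "nat \<Rightarrow> nat set \<Rightarrow> (nat \<Rightarrow> nat) \<Rightarrow> (nat \<times> nat) set" where
  "lower_arcs n U w = {(a, c) \<in> value_pairs n. arc_inversions U a c \<subseteq> inversions n w}"

text \<open>Disjointness says that \<open>w\<close> lies below the meet-irreducible with
  non-inversions \<open>arc_inversions (- U) a c\<close>.\<close>

definition upper_arcs :: "nat \<Rightarrow> nat set \<Rightarrow> (nat \<Rightarrow> nat) \<Rightarrow> (nat \<times> nat) set" where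
  "upper_arcs n U w = {(a, c) \<in> value_pairs n. arc_inversions (- U) a c \<inter> inversions n w = {}}"

definition arc_congruence :: "nat \<Rightarrow> nat set \<Rightarrow> ((nat \<Rightarrow> nat) \<times> (nat \<Rightarrow> nat)) set" where
  "arc_congruence n U = {(x, y). x permutes {1..n+1} \<and> y permutes {1..n+1} \<and>
    lower_arcs n U x = lower_arcs n U y}"

section \<open>Lower arcs, upper arcs and the congruence they define\<close>

lemma arc_inversions_subset: "(a, c) \<in> value_pairs n \<Longrightarrow> arc_inversions U a c \<subseteq> value_pairs n"
  by (auto simp: arc_inversions_def value_pairs_def)

lemma arc_inversions_self: "a < c \<Longrightarrow> (a, c) \<in> arc_inversions U a c"
  by (auto simp: arc_inversions_def)

lemma biclosed_arc_inversions:
  assumes "(a, c) \<in> value_pairs n"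
  shows "biclosed n (arc_inversions U a c)"
  unfolding biclosed_def trans_def
  using arc_inversions_subset[OF assms] by (auto simp: arc_inversions_def)

lemma arc_inversions_cong:
  assumes "(a, c) \<in> value_pairs n" and "\<And>b. b \<in> {2..n} \<Longrightarrow> b \<in> U \<longleftrightarrow> b \<in> V"
  shows "arc_inversions U a c = arc_inversions V a c"
proof -
  have "b \<in> U \<longleftrightarrow> b \<in> V" if "a < b" "b < c" for b
    using assms that by (auto simp: value_pairs_def)
  then show ?thesis unfolding arc_inversions_def by (auto simp: le_less)
qed

text \<open>Choose a common pair \<open>(q, p)\<close> with \<open>p - q\<close> minimal. For
  \<open>b\<close> in \<open>U\<close> between them, \<open>(b, p)\<close> is again in
  \<open>arc_inversions (- U) a c\<close>, so minimality keeps it out of \<open>I\<close>, and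
  biclosedness puts \<open>(q, b)\<close> into \<open>I\<close>. For the other \<open>b\<close> the
  two halves exchange roles.\<close>

lemma arc_inversions_minimal:
  assumes I: "biclosed n I" and ne: "arc_inversions (- U) a c \<inter> I \<noteq> {}"
  obtains q p where "(q, p) \<in> arc_inversions (- U) a c" "(q, p) \<in> I"
    "\<And>b. q < b \<Longrightarrow> b < p \<Longrightarrow> b \<in> U \<Longrightarrow> (q, b) \<in> I \<and> (b, p) \<notin> I"
    "\<And>b. q < b \<Longrightarrow> b < p \<Longrightarrow> b \<notin> U \<Longrightarrow> (b, p) \<in> I \<and> (q, b) \<notin> I"
proof -
  let ?A = "arc_inversions (- U) a c"
  have "\<exists>z. z \<in> ?A \<inter> I" using ne by blast
  then obtain z where z: "z \<in> ?A \<inter> I"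
    and zmin: "\<And>y. y \<in> ?A \<inter> I \<Longrightarrow> snd z - fst z \<le> snd y - fst y"
    using ex_has_least_nat[of "\<lambda>z. z \<in> ?A \<inter> I" _ "\<lambda>z. snd z - fst z"] by metis
  obtain q p where qp: "z = (q, p)" by force
  have m: "(q, p) \<in> ?A" "(q, p) \<in> I"
    and min: "\<And>q' p'. (q', p') \<in> ?A \<Longrightarrow> (q', p') \<in> I \<Longrightarrow> p - q \<le> p' - q'"
    using z zmin qp by fastforce+
  have ctr: "(x, y) \<in> I \<or> (y, w) \<in> I" if "(x, w) \<in> I" "x < y" "y < w" for x y w
    using I that unfolding biclosed_def by blast
  have up: "(q, b) \<in> I \<and> (b, p) \<notin> I" if "q < b" "b < p" "b \<in> U" for b
  proof -
    have "(b, p) \<in> ?A" using m that by (auto simp: arc_inversions_def)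
    then have "(b, p) \<notin> I" using min[of b p] that by linarith
    then show ?thesis using ctr m that by blast
  qed
  have down: "(b, p) \<in> I \<and> (q, b) \<notin> I" if "q < b" "b < p" "b \<notin> U" for b
  proof -
    have "(q, b) \<in> ?A" using m that by (auto simp: arc_inversions_def)
    then have "(q, b) \<notin> I" using min[of q b] that by linarith
    then show ?thesis using ctr m that by blast
  qed
  show ?thesis by (rule that[OF m up down])
qed

text \<open>The minimal pair has every intermediate value on the side that \<open>U\<close>
  prescribes, so the whole inversion set of the join-irreducible for \<open>(q, p)\<close> lies in
  \<open>I\<close>.\<close>

lemma arc_inversions_meets_biclosed:
  assumes I: "biclosed n I" and ne: "arc_inversions (- U) a c \<inter> I \<noteq> {}"
  obtains q p where "(q, p) \<in> arc_inversions (- U) a c" "arc_inversions U q p \<subseteq> I"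
proof -
  obtain q p where m: "(q, p) \<in> arc_inversions (- U) a c" "(q, p) \<in> I"
    and up: "\<And>b. q < b \<Longrightarrow> b < p \<Longrightarrow> b \<in> U \<Longrightarrow> (q, b) \<in> I \<and> (b, p) \<notin> I"
    and down: "\<And>b. q < b \<Longrightarrow> b < p \<Longrightarrow> b \<notin> U \<Longrightarrow> (b, p) \<in> I \<and> (q, b) \<notin> I"
    using arc_inversions_minimal[OF I ne] by blast
  have ctr: "(x, y) \<in> I \<or> (y, w) \<in> I" if "(x, w) \<in> I" "x < y" "y < w" for x y w
    using I that unfolding biclosed_def by blast
  have sub: "(x, y) \<in> I" if "(x, y) \<in> arc_inversions U q p" for x y
  proof -
    have h: "q \<le> x" "x < y" "y \<le> p" "x = q \<or> x \<notin> U" "y = p \<or> y \<in> U"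
      using that by (auto simp: arc_inversions_def)
    consider "x = q" "y = p" | "x = q" "y < p" "y \<in> U" | "q < x" "x \<notin> U" "y = p"
      | "q < x" "x \<notin> U" "y < p" "y \<in> U" using h by fastforce
    then show ?thesis
    proof cases
      case 4
      then have "(q, y) \<in> I" "(q, x) \<notin> I" using h up down by auto
      then show ?thesis using ctr h 4 by blast
    qed (use h up down m in auto)
  qed
  show ?thesis by (rule that[OF m(1)]) (use sub in auto)
qed

text \<open>The right-hand side sees \<open>w\<close> only through its lower arcs: wherever
  \<open>inversions n w\<close> meets the arc set, the arc set already contains a lower arc.\<close>

lemma upper_arcs_eq:
  "upper_arcs n U w =
    {(a, c) \<in> value_pairs n. arc_inversions (- U) a c \<inter> lower_arcs n U w = {}}"
proof -
  have "arc_inversions (- U) a c \<inter> inversions n w = {} \<longleftrightarrow>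
      arc_inversions (- U) a c \<inter> lower_arcs n U w = {}" if ac: "(a, c) \<in> value_pairs n" for a c
  proof
    assume "arc_inversions (- U) a c \<inter> inversions n w = {}"
    moreover have "lower_arcs n U w \<subseteq> inversions n w"
      using arc_inversions_self by (fastforce simp: lower_arcs_def value_pairs_def)
    ultimately show "arc_inversions (- U) a c \<inter> lower_arcs n U w = {}" by blast
  next
    assume e: "arc_inversions (- U) a c \<inter> lower_arcs n U w = {}"
    show "arc_inversions (- U) a c \<inter> inversions n w = {}"
    proof (rule ccontr)
      assume "arc_inversions (- U) a c \<inter> inversions n w \<noteq> {}"
      then obtain q p where "(q, p) \<in> arc_inversions (- U) a c" "arc_inversions U q p \<subseteq> inversions n w"
        using arc_inversions_meets_biclosed[OF biclosed_inversions] by blast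
      then show False using e arc_inversions_subset[OF ac] by (auto simp: lower_arcs_def)
    qed
  qed
  then show ?thesis unfolding upper_arcs_def by blast
qed

text \<open>The mirror image: the same exchange, applied to the non-inversions of \<open>w\<close>
  with \<open>- U\<close> in place of \<open>U\<close>.\<close>

lemma lower_arcs_eq:
  "lower_arcs n U w =
    {(a, c) \<in> value_pairs n. arc_inversions U a c \<inter> upper_arcs n U w = {}}"
proof -
  have "arc_inversions U a c \<subseteq> inversions n w \<longleftrightarrow>
      arc_inversions U a c \<inter> upper_arcs n U w = {}" if ac: "(a, c) \<in> value_pairs n" for a c
  proof
    assume "arc_inversions U a c \<subseteq> inversions n w"
    moreover have "upper_arcs n U w \<inter> inversions n w = {}"
      using arc_inversions_self by (fastforce simp: upper_arcs_def value_pairs_def)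
    ultimately show "arc_inversions U a c \<inter> upper_arcs n U w = {}" by blast
  next
    assume e: "arc_inversions U a c \<inter> upper_arcs n U w = {}"
    show "arc_inversions U a c \<subseteq> inversions n w"
    proof (rule ccontr)
      assume "\<not> arc_inversions U a c \<subseteq> inversions n w"
      then have "arc_inversions (- (- U)) a c \<inter> (value_pairs n - inversions n w) \<noteq> {}"
        using arc_inversions_subset[OF ac] by auto
      then obtain q p where "(q, p) \<in> arc_inversions (- (- U)) a c"
        "arc_inversions (- U) q p \<subseteq> value_pairs n - inversions n w"
        using arc_inversions_meets_biclosed[OF biclosed_complement[OF biclosed_inversions]] by blast
      then have "(q, p) \<in> arc_inversions U a c" "(q, p) \<in> upper_arcs n U w"
        using arc_inversions_subset[OF ac, of U] by (auto simp: upper_arcs_def)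
      then show False using e by blast
    qed
  qed
  then show ?thesis unfolding lower_arcs_def by blast
qed

lemma lower_arcs_eq_iff_upper_arcs_eq:
  "lower_arcs n U x = lower_arcs n U y \<longleftrightarrow> upper_arcs n U x = upper_arcs n U y"
proof
  assume e: "lower_arcs n U x = lower_arcs n U y"
  show "upper_arcs n U x = upper_arcs n U y"
    unfolding upper_arcs_eq[of n U x] upper_arcs_eq[of n U y] e ..
next
  assume e: "upper_arcs n U x = upper_arcs n U y"
  show "lower_arcs n U x = lower_arcs n U y"
    unfolding lower_arcs_eq[of n U x] lower_arcs_eq[of n U y] e ..
qed

lemma lower_arcs_meet:
  assumes x: "x permutes {1..n+1}" and y: "y permutes {1..n+1}"
  shows "lower_arcs n U (x \<sqinter>\<^bsub>weak_order n\<^esub> y) = lower_arcs n U x \<inter> lower_arcs n U y"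
proof -
  have "arc_inversions U a c \<subseteq> inversions n (x \<sqinter>\<^bsub>weak_order n\<^esub> y) \<longleftrightarrow>
      arc_inversions U a c \<subseteq> inversions n x \<and> arc_inversions U a c \<subseteq> inversions n y"
    if ac: "(a, c) \<in> value_pairs n" for a c
  proof -
    obtain j where "j permutes {1..n+1}" "inversions n j = arc_inversions U a c"
      using biclosed_obtains biclosed_arc_inversions[OF ac] by metis
    then show ?thesis using weak_order_meet[OF x y] by blast
  qed
  then show ?thesis unfolding lower_arcs_def by blast
qed

lemma upper_arcs_join:
  assumes x: "x permutes {1..n+1}" and y: "y permutes {1..n+1}"
  shows "upper_arcs n U (x \<squnion>\<^bsub>weak_order n\<^esub> y) = upper_arcs n U x \<inter> upper_arcs n U y"
proof -
  have "arc_inversions (- U) a c \<inter> inversions n (x \<squnion>\<^bsub>weak_order n\<^esub> y) = {} \<longleftrightarrow>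
      arc_inversions (- U) a c \<inter> inversions n x = {} \<and> arc_inversions (- U) a c \<inter> inversions n y = {}"
    if ac: "(a, c) \<in> value_pairs n" for a c
  proof -
    obtain m where m: "m permutes {1..n+1}" "inversions n m = value_pairs n - arc_inversions (- U) a c"
      using biclosed_obtains biclosed_complement[OF biclosed_arc_inversions[OF ac]] by metis
    then have "arc_inversions (- U) a c \<inter> inversions n z = {} \<longleftrightarrow> inversions n z \<subseteq> inversions n m" for z
      using inversions_subset by blast
    then show ?thesis using weak_order_join[OF x y] m(1) by (metis dual_order.trans)
  qed
  then show ?thesis unfolding upper_arcs_def by blast
qed

text \<open>Being above a join-irreducible is compatible with meets, being below a meet-irreducible
  with joins; as lower and upper arcs determine each other, one relation serves for both.\<close>

lemma lattice_congruence_arc_congruence: "lattice_congruence (weak_order n) (arc_congruence n U)"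
  unfolding lattice_congruence_def
proof (intro conjI allI impI)
  show "equiv (carrier (weak_order n)) (arc_congruence n U)"
    by (rule equivI)
      (auto simp: arc_congruence_def weak_order_carrier refl_on_def sym_on_def trans_on_def)
next
  fix x1 y1 x2 y2 assume "(x1, y1) \<in> arc_congruence n U" "(x2, y2) \<in> arc_congruence n U"
  then have p: "x1 permutes {1..n+1}" "y1 permutes {1..n+1}" "x2 permutes {1..n+1}" "y2 permutes {1..n+1}"
    and e: "lower_arcs n U x1 = lower_arcs n U y1" "lower_arcs n U x2 = lower_arcs n U y2"
    by (auto simp: arc_congruence_def)
  show "(x1 \<sqinter>\<^bsub>weak_order n\<^esub> x2, y1 \<sqinter>\<^bsub>weak_order n\<^esub> y2) \<in> arc_congruence n U"
    unfolding arc_congruence_def using e weak_order_meet(1)[OF p(1,3)] weak_order_meet(1)[OF p(2,4)]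
      lower_arcs_meet[OF p(1,3)] lower_arcs_meet[OF p(2,4)] by simp
  show "(x1 \<squnion>\<^bsub>weak_order n\<^esub> x2, y1 \<squnion>\<^bsub>weak_order n\<^esub> y2) \<in> arc_congruence n U"
    using e weak_order_join(1)[OF p(1,3)] weak_order_join(1)[OF p(2,4)]
      upper_arcs_join[OF p(1,3)] upper_arcs_join[OF p(2,4)]
    unfolding arc_congruence_def lower_arcs_eq_iff_upper_arcs_eq by simp
qed

text \<open>A descent of \<open>inv' y \<circ> x\<close> marks two adjacent letters of
  \<open>x\<close> that stand in the opposite order in \<open>y\<close>. They are not yet inverted
  in \<open>x\<close>, whose inversions are shared by \<open>y\<close>, so exchanging them moves up
  and stays below \<open>y\<close>.\<close>

lemma weak_order_cover_between:
  assumes x: "x permutes {1..n+1}" and y: "y permutes {1..n+1}"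
    and sub: "inversions n x \<subset> inversions n y"
  obtains z a c where "z permutes {1..n+1}" "inversions n z = insert (a, c) (inversions n x)"
    "(a, c) \<notin> inversions n x" "inversions n z \<subseteq> inversions n y"
proof -
  let ?v = "inv' y \<circ> x"
  have v: "?v permutes {1..n+1}" using permutes_compose[OF x permutes_inv[OF y]] .
  have "?v \<noteq> id" using inv_comp_eq_id[OF y] sub by blast
  then obtain i where i: "i \<in> {1..n}" "?v (i + 1) < ?v i"
    using permutes_eq_id_or_descent[OF v] by blast
  have in1: "x i \<in> {1..n+1}" "x (i + 1) \<in> {1..n+1}"
    using i permutes_in[OF x, of i] permutes_in[OF x, of "i+1"] by auto
  have asc: "x i < x (i + 1)"
  proof (rule ccontr)
    assume "\<not> x i < x (i + 1)"
    moreover have "x i \<noteq> x (i + 1)" using i(2) by auto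
    ultimately have "(x (i + 1), x i) \<in> inversions n x"
      using inversions_descent(1)[OF x i(1)] by auto
    then have "(x (i + 1), x i) \<in> inversions n y" using sub by auto
    then show False using i(2) by (auto simp: inversions_def)
  qed
  have "(x i, x (i + 1)) \<in> inversions n y" using in1 asc i(2) by (auto simp: inversions_def)
  then show ?thesis
    using that[OF permutes_compose[OF simple_refl_permutes[OF i(1)] x] inversions_ascent[OF x i(1) asc]]
      inversions_ascent(1)[OF x i(1) asc] sub by auto
qed

lemma weak_order_congruence:
  assumes "lattice_congruence (weak_order n) \<Theta>"
  shows "\<And>z. z permutes {1..n+1} \<Longrightarrow> (z, z) \<in> \<Theta>"
    and "\<And>u v. (u, v) \<in> \<Theta> \<Longrightarrow> (v, u) \<in> \<Theta>"
    and "\<And>u v w. (u, v) \<in> \<Theta> \<Longrightarrow> (v, w) \<in> \<Theta> \<Longrightarrow> (u, w) \<in> \<Theta>"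
    and "\<And>u v z. (u, v) \<in> \<Theta> \<Longrightarrow> z permutes {1..n+1} \<Longrightarrow>
      (z \<sqinter>\<^bsub>weak_order n\<^esub> u, z \<sqinter>\<^bsub>weak_order n\<^esub> v) \<in> \<Theta>"
    and "\<And>u v z. (u, v) \<in> \<Theta> \<Longrightarrow> z permutes {1..n+1} \<Longrightarrow>
      (z \<squnion>\<^bsub>weak_order n\<^esub> u, z \<squnion>\<^bsub>weak_order n\<^esub> v) \<in> \<Theta>"
    and "\<And>u v z. (u, v) \<in> \<Theta> \<Longrightarrow> z permutes {1..n+1} \<Longrightarrow>
      (u \<squnion>\<^bsub>weak_order n\<^esub> z, v \<squnion>\<^bsub>weak_order n\<^esub> z) \<in> \<Theta>"
proof -
  have ops: "(x1 \<sqinter>\<^bsub>weak_order n\<^esub> x2, y1 \<sqinter>\<^bsub>weak_order n\<^esub> y2) \<in> \<Theta>"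
      "(x1 \<squnion>\<^bsub>weak_order n\<^esub> x2, y1 \<squnion>\<^bsub>weak_order n\<^esub> y2) \<in> \<Theta>"
    if "(x1, y1) \<in> \<Theta>" "(x2, y2) \<in> \<Theta>" for x1 y1 x2 y2
    using assms that unfolding lattice_congruence_def by simp_all
  have eqv: "equiv (carrier (weak_order n)) \<Theta>"
    using assms unfolding lattice_congruence_def by simp
  show refl: "(z, z) \<in> \<Theta>" if "z permutes {1..n+1}" for z
    using eqv that by (meson equivE refl_onD weak_order_carrier)
  show "(v, u) \<in> \<Theta>" if "(u, v) \<in> \<Theta>" for u v using eqv that by (meson equivE symE)
  show "(u, w) \<in> \<Theta>" if "(u, v) \<in> \<Theta>" "(v, w) \<in> \<Theta>" for u v w using eqv that by (meson equivE transE)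
  show "(z \<sqinter>\<^bsub>weak_order n\<^esub> u, z \<sqinter>\<^bsub>weak_order n\<^esub> v) \<in> \<Theta>"
    "(z \<squnion>\<^bsub>weak_order n\<^esub> u, z \<squnion>\<^bsub>weak_order n\<^esub> v) \<in> \<Theta>"
    "(u \<squnion>\<^bsub>weak_order n\<^esub> z, v \<squnion>\<^bsub>weak_order n\<^esub> z) \<in> \<Theta>"
    if "(u, v) \<in> \<Theta>" "z permutes {1..n+1}" for u v z
    using ops(1)[OF refl[OF that(2)] that(1)] ops(2)[OF refl[OF that(2)] that(1)]
      ops(2)[OF that(1) refl[OF that(2)]] by simp_all
qed

text \<open>The lattice polynomial sending \<open>m\<close> to the join of \<open>x\<close> with the
  meet of \<open>y\<close> and \<open>m\<close> carries \<open>m1\<close> to \<open>x\<close>, as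
  \<open>(a, c)\<close> is missing from \<open>m1\<close>, and \<open>m2\<close> to
  \<open>y\<close>. The set \<open>K\<close> certifies that the meet of \<open>y\<close> and
  \<open>m2\<close> has the inversion \<open>(a, c)\<close>.\<close>

lemma congruence_contracts_cover:
  assumes cong: "lattice_congruence (weak_order n) \<Theta>"
    and x: "x permutes {1..n+1}" and y: "y permutes {1..n+1}"
    and m1: "m1 permutes {1..n+1}" and m2: "m2 permutes {1..n+1}" and m12: "(m1, m2) \<in> \<Theta>"
    and cover: "inversions n y = insert (a, c) (inversions n x)"
    and ac: "(a, c) \<notin> inversions n m1"
    and K: "biclosed n K" "(a, c) \<in> K" "K \<subseteq> inversions n y" "K \<subseteq> inversions n m2"
  shows "(x, y) \<in> \<Theta>"
proof -
  let ?L = "weak_order n"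
  obtain k where k: "k permutes {1..n+1}" "inversions n k = K" using biclosed_obtains K(1) by metis
  let ?p = "y \<sqinter>\<^bsub>?L\<^esub> m1" and ?q = "y \<sqinter>\<^bsub>?L\<^esub> m2"
  note P = weak_order_meet[OF y m1] and Q = weak_order_meet[OF y m2]
  note XP = weak_order_join[OF x P(1)] and XQ = weak_order_join[OF x Q(1)]
  have "(?p, ?q) \<in> \<Theta>" using weak_order_congruence(4)[OF cong m12 y] .
  then have "(x \<squnion>\<^bsub>?L\<^esub> ?p, x \<squnion>\<^bsub>?L\<^esub> ?q) \<in> \<Theta>"
    by (rule weak_order_congruence(5)[OF cong _ x])
  moreover have "x \<squnion>\<^bsub>?L\<^esub> ?p = x"
  proof (rule inversions_inject[OF XP(1) x])
    have "inversions n ?p \<subseteq> inversions n x" using P(2)[unfolded cover] P(3) ac by blast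
    then show "inversions n (x \<squnion>\<^bsub>?L\<^esub> ?p) = inversions n x" using XP(2) XP(4)[OF x] by blast
  qed
  moreover have "x \<squnion>\<^bsub>?L\<^esub> ?q = y"
  proof (rule inversions_inject[OF XQ(1) y])
    have "(a, c) \<in> inversions n ?q" using Q(4)[OF k(1)] k(2) K by blast
    then show "inversions n (x \<squnion>\<^bsub>?L\<^esub> ?q) = inversions n y"
      using XQ(2,3) XQ(4)[OF y _ Q(2)] unfolding cover by blast
  qed
  ultimately show ?thesis by simp
qed

section \<open>Generators and minimality of the arc congruence\<close>

lemma inversions_simple_refl: "i \<in> {1..n} \<Longrightarrow> inversions n (simple_refl i) = {(i, i + 1)}"
  using inversions_ascent(1)[OF permutes_id, of i n] inversions_id by simp

lemma inversions_simple_refl_down: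
  assumes "i \<in> {1..n}" "i + 1 \<in> {1..n}"
  shows "inversions n (simple_refl (i + 1) \<circ> simple_refl i) = {(i, i + 2), (i + 1, i + 2)}"
  using inversions_ascent(1)[OF simple_refl_permutes[OF assms(2)] assms(1)]
    inversions_simple_refl[OF assms(2)] by (simp add: simple_refl_def)

lemma inversions_simple_refl_up:
  assumes "i \<in> {1..n}" "i + 1 \<in> {1..n}"
  shows "inversions n (simple_refl i \<circ> simple_refl (i + 1)) = {(i, i + 2), (i, i + 1)}"
  using inversions_ascent(1)[OF simple_refl_permutes[OF assms(1)] assms(2)]
    inversions_simple_refl[OF assms(1)] by (simp add: simple_refl_def)

text \<open>The set \<open>U\<close> encodes an orientation of the diagram:
  \<open>i + 1 \<in> U\<close> stands for an arrow from \<open>i + 1\<close> to \<open>i\<close>,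
  and \<open>i + 1 \<notin> U\<close> for the opposite one.\<close>

definition contracts_generators :: "nat \<Rightarrow> nat set \<Rightarrow> ((nat \<Rightarrow> nat) \<times> (nat \<Rightarrow> nat)) set \<Rightarrow> bool" where
  "contracts_generators n U \<Theta> \<longleftrightarrow>
    (\<forall>i. 1 \<le> i \<and> i + 1 \<le> n \<longrightarrow>
      (if i + 1 \<in> U then (simple_refl (i + 1) \<circ> simple_refl i, simple_refl (i + 1)) \<in> \<Theta>
       else (simple_refl i \<circ> simple_refl (i + 1), simple_refl i) \<in> \<Theta>))"

text \<open>The ends of a generator differ by the inversion \<open>(i, i + 2)\<close>. An arc set
  containing it also contains \<open>(a, i + 1)\<close> or \<open>(i + 1, c)\<close>, according to
  the side of \<open>i + 1\<close>, and that pair is not an inversion of the longer end; so no lower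
  arc is gained.\<close>

lemma contracts_generators_arc_congruence: "contracts_generators n U (arc_congruence n U)"
  unfolding contracts_generators_def
proof (intro allI impI)
  fix i assume i: "1 \<le> i \<and> i + 1 \<le> n"
  then have i1: "i \<in> {1..n}" and i2: "i + 1 \<in> {1..n}" by auto
  note perms = simple_refl_permutes[OF i1] simple_refl_permutes[OF i2]
    permutes_compose[OF simple_refl_permutes[OF i1] simple_refl_permutes[OF i2]]
    permutes_compose[OF simple_refl_permutes[OF i2] simple_refl_permutes[OF i1]]
  have sub1: "arc_inversions U a c \<subseteq> {(i + 1, i + 2)}"
    if "arc_inversions U a c \<subseteq> {(i, i + 2), (i + 1, i + 2)}" "i + 1 \<in> U" for a c
  proof -
    have "(i, i + 2) \<notin> arc_inversions U a c"
    proof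
      assume "(i, i + 2) \<in> arc_inversions U a c"
      then have "(a, i + 1) \<in> arc_inversions U a c" using that by (auto simp: arc_inversions_def)
      then show False using that by auto
    qed
    then show ?thesis using that by blast
  qed
  have sub2: "arc_inversions U a c \<subseteq> {(i, i + 1)}"
    if "arc_inversions U a c \<subseteq> {(i, i + 2), (i, i + 1)}" "i + 1 \<notin> U" for a c
  proof -
    have "(i, i + 2) \<notin> arc_inversions U a c"
    proof
      assume "(i, i + 2) \<in> arc_inversions U a c"
      then have "(i + 1, c) \<in> arc_inversions U a c" using that by (auto simp: arc_inversions_def)
      then show False using that by auto
    qed
    then show ?thesis using that by blast
  qed
  show "if i + 1 \<in> U then (simple_refl (i + 1) \<circ> simple_refl i, simple_refl (i + 1)) \<in> arc_congruence n U
       else (simple_refl i \<circ> simple_refl (i + 1), simple_refl i) \<in> arc_congruence n U"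
  proof (cases "i + 1 \<in> U")
    case True
    have "arc_inversions U a c \<subseteq> {(i, i + 2), (i + 1, i + 2)} \<longleftrightarrow> arc_inversions U a c \<subseteq> {(i + 1, i + 2)}" for a c
      using sub1[of a c] True by blast
    then have "lower_arcs n U (simple_refl (i + 1) \<circ> simple_refl i) = lower_arcs n U (simple_refl (i + 1))"
      unfolding lower_arcs_def inversions_simple_refl_down[OF i1 i2] inversions_simple_refl[OF i2]
      by simp
    then show ?thesis using True perms by (simp add: arc_congruence_def del: One_nat_def)
  next
    case False
    have "arc_inversions U a c \<subseteq> {(i, i + 2), (i, i + 1)} \<longleftrightarrow> arc_inversions U a c \<subseteq> {(i, i + 1)}" for a c
      using sub2[of a c] False by blast
    then have "lower_arcs n U (simple_refl i \<circ> simple_refl (i + 1)) = lower_arcs n U (simple_refl i)"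
      unfolding lower_arcs_def inversions_simple_refl_up[OF i1 i2] inversions_simple_refl[OF i1]
      by simp
    then show ?thesis using False perms by (auto simp: arc_congruence_def)
  qed
qed

text \<open>This is the inversion set of the permutation reversing the values from \<open>a\<close>
  to \<open>b\<close> and those from \<open>b' + 1\<close> to \<open>c\<close>, each within its
  block. Below it serves as \<open>Z\<close> and as an upper bound that keeps \<open>a\<close> and
  \<open>c\<close> apart.\<close>

lemma biclosed_two_blocks:
  assumes "1 \<le> a" "b \<le> b'" "b \<le> n + 1" "c \<le> n + 1"
  shows "biclosed n {(q, p). q < p \<and> (a \<le> q \<and> p \<le> b \<or> b' < q \<and> p \<le> c)}"
  using assms unfolding biclosed_def value_pairs_def trans_def by auto

text \<open>
  Some \<open>b\<close> between \<open>a\<close> and \<open>c\<close> is on the wrong side. Joining the generator at \<open>b\<close> with \<open>z\<close>, which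
  reverses the values below and above \<open>b\<close>, spreads it to the pair \<open>(a, c)\<close>; meeting with \<open>y\<close> and
  joining with \<open>x\<close> then carries it to the cover.
\<close>

lemma arc_congruence_cover_in:
  assumes cong: "lattice_congruence (weak_order n) \<Theta>" and gen: "contracts_generators n U \<Theta>"
    and x: "x permutes {1..n+1}" and y: "y permutes {1..n+1}"
    and cover: "inversions n y = insert (a, c) (inversions n x)" "(a, c) \<notin> inversions n x"
    and eq: "lower_arcs n U x = lower_arcs n U y"
  shows "(x, y) \<in> \<Theta>"
proof -
  let ?L = "weak_order n" and ?I = "inversions n y"
  have ac: "(a, c) \<in> value_pairs n" using cover(1) inversions_subset[of n y] by blast
  then have ac': "1 \<le> a" "a < c" "c \<le> n + 1" by (auto simp: value_pairs_def)
  have tr: "(p, r) \<in> ?I" if "(p, q) \<in> ?I" "(q, r) \<in> ?I" for p q r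
    using biclosed_inversions[of n y] that unfolding biclosed_def trans_def by blast
  have ctr: "(p, q) \<in> ?I \<or> (q, r) \<in> ?I" if "(p, r) \<in> ?I" "p < q" "q < r" for p q r
    using biclosed_inversions[of n y] that unfolding biclosed_def by blast
  \<comment> \<open>The letters \<open>a\<close> and \<open>c\<close> are adjacent in
    \<open>x\<close> and in \<open>y\<close>, so \<open>b\<close> stands on one side of
    both.\<close>
  have one: "(a, b) \<in> ?I \<longleftrightarrow> (b, c) \<notin> ?I" if "a < b" "b < c" for b
  proof
    assume "(a, b) \<in> ?I"
    then have "(a, b) \<in> inversions n x" using cover that by auto
    moreover have "(b, c) \<in> inversions n x" if "(b, c) \<in> ?I" using cover that \<open>a < b\<close> by auto
    moreover have "trans (inversions n x)" using biclosed_inversions biclosed_def by blast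
    ultimately show "(b, c) \<notin> ?I" using cover(2) unfolding trans_def by blast
  next
    assume "(b, c) \<notin> ?I"
    then show "(a, b) \<in> ?I" using ctr[of a c b] cover(1) that by blast
  qed
  have "(a, c) \<notin> lower_arcs n U x"
    using cover(2) arc_inversions_self[OF ac'(2)] by (auto simp: lower_arcs_def)
  then have "(a, c) \<notin> lower_arcs n U y" using eq by simp
  then have "\<not> arc_inversions U a c \<subseteq> ?I" using ac by (simp add: lower_arcs_def)
  then obtain q p where qp: "(q, p) \<in> arc_inversions U a c" "(q, p) \<notin> ?I" by auto
  have h: "a \<le> q" "q < p" "p \<le> c" "q = a \<or> q \<notin> U" "p = c \<or> p \<in> U"
    using qp(1) by (auto simp: arc_inversions_def)
  \<comment> \<open>\<open>U\<close> prescribes \<open>(a, b) \<in> ?I\<close> exactly for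
    \<open>b \<in> U\<close>. If \<open>y\<close> obeyed this for all \<open>b\<close> in between,
    the whole arc set would lie in \<open>?I\<close>; the missing pair exposes an exception.\<close>
  have "\<exists>b. a < b \<and> b < c \<and> (b \<in> U \<longleftrightarrow> (a, b) \<notin> ?I)"
  proof -
    have "(q, p) \<noteq> (a, c)" using qp(2) cover by auto
    then consider "q = a" "p < c" "p \<in> U" | "a < q" "q \<notin> U" "p = c"
      | "a < q" "q \<notin> U" "p < c" "p \<in> U" using h by fastforce
    then show ?thesis
    proof cases
      case 1
      then show ?thesis using h qp(2) by blast
    next
      case 2
      then show ?thesis using h qp(2) one[of q] by blast
    next
      case 3
      then have "(a, p) \<notin> ?I \<or> (a, q) \<in> ?I" using ctr[of a p q] qp(2) h by blast
      then show ?thesis using 3 h by (meson order.strict_trans)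
    qed
  qed
  then obtain b where b: "a < b" "b < c" "b \<in> U \<longleftrightarrow> (a, b) \<notin> ?I" by blast
  define i where "i = b - 1"
  have bi: "b = i + 1" "1 \<le> i" "i + 1 \<le> n" "a \<le> i" "i + 2 \<le> c" using b ac' by (auto simp: i_def)
  then have i1: "i \<in> {1..n}" and i2: "i + 1 \<in> {1..n}" by auto
  \<comment> \<open>\<open>V\<close> records the sides actually taken in \<open>y\<close>. With it
    in place of \<open>U\<close>, \<open>?K\<close> belongs to a join-irreducible below
    \<open>y\<close> that has the inversion \<open>(a, c)\<close>.\<close>
  define V where "V = {m. (a, m) \<in> ?I}"
  let ?K = "arc_inversions V a c"
  have KI: "?K \<subseteq> ?I"
  proof -
    have "(q, p) \<in> ?I" if "(q, p) \<in> ?K" for q p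
    proof -
      have h: "a \<le> q" "q < p" "p \<le> c" "q = a \<or> q \<notin> V" "p = c \<or> p \<in> V"
        using that by (auto simp: arc_inversions_def)
      have acI: "(a, c) \<in> ?I" using cover by auto
      have "(a, p) \<in> ?I" using h acI by (auto simp: V_def)
      moreover have "q = a \<or> a < q \<and> (a, q) \<notin> ?I" using h by (auto simp: V_def)
      ultimately show ?thesis using ctr[of a p q] h by blast
    qed
    then show ?thesis by auto
  qed
  have "(a, c) \<in> ?K" using arc_inversions_self[OF ac'(2)] .
  \<comment> \<open>All of \<open>a..c\<close> except \<open>b = i + 1\<close> is reversed in two
    blocks, so the generator at \<open>b\<close> decides whether \<open>(a, c)\<close> is
    reached.\<close>
  define Z where "Z = {(q, p). q < p \<and> (a \<le> q \<and> p \<le> i \<or> i + 1 < q \<and> p \<le> c)}"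
  have "biclosed n Z" unfolding Z_def by (rule biclosed_two_blocks) (use bi ac' in auto)
  then obtain z where z: "z permutes {1..n+1}" "inversions n z = Z" using biclosed_obtains by metis
  \<comment> \<open>\<open>G\<close> bounds the join of the shorter end \<open>g1\<close> with
    \<open>z\<close> and misses \<open>(a, c)\<close>, whereas the join of the longer end
    \<open>g2\<close> with \<open>z\<close> contains all of \<open>?K\<close>.\<close>
  have finish: "(x, y) \<in> \<Theta>"
    if g: "g1 permutes {1..n+1}" "g2 permutes {1..n+1}" "(g2, g1) \<in> \<Theta>"
      and G: "biclosed n G" "inversions n g1 \<subseteq> G" "Z \<subseteq> G" "(a, c) \<notin> G"
      and K: "\<And>I. trans I \<Longrightarrow> inversions n g2 \<subseteq> I \<Longrightarrow> Z \<subseteq> I \<Longrightarrow> ?K \<subseteq> I" for g1 g2 G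
  proof -
    let ?m1 = "g1 \<squnion>\<^bsub>?L\<^esub> z" and ?m2 = "g2 \<squnion>\<^bsub>?L\<^esub> z"
    note M1 = weak_order_join[OF g(1) z(1)] and M2 = weak_order_join[OF g(2) z(1)]
    obtain m where m: "m permutes {1..n+1}" "inversions n m = G" using biclosed_obtains G(1) by metis
    have "(a, c) \<notin> inversions n ?m1" using M1(4)[OF m(1)] m(2) G z(2) by blast
    moreover have "(?m1, ?m2) \<in> \<Theta>"
      using weak_order_congruence(2,6)[OF cong] g(3) z(1) by blast
    moreover have "trans (inversions n ?m2)" using biclosed_inversions biclosed_def by blast
    then have "?K \<subseteq> inversions n ?m2" using K M2(2,3) z(2) by blast
    ultimately show ?thesis
      using congruence_contracts_cover[OF cong x y M1(1) M2(1) _ cover(1)]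
        biclosed_arc_inversions[OF ac] \<open>(a, c) \<in> ?K\<close> KI by blast
  qed
  have inside: "(q, p) \<in> I" if "Z \<subseteq> I" "q < p" "a \<le> q \<and> p \<le> i \<or> i + 1 < q \<and> p \<le> c" for I q p
    using that by (auto simp: Z_def)
  have across: "(q, p) \<in> I" if I: "trans I" "Z \<subseteq> I" "(i, i + 2) \<in> I"
    and "a \<le> q" "q \<le> i" "i + 2 \<le> p" "p \<le> c" for I q p
  proof -
    have "q = i \<or> q < i" "p = i + 2 \<or> i + 2 < p" using that(5,6) by linarith+
    then have "q = i \<or> (q, i) \<in> I" "p = i + 2 \<or> (i + 2, p) \<in> I"
      using inside[OF I(2), of q i] inside[OF I(2), of "i + 2" p] that(4,7) by auto
    then show ?thesis using I(1,3) by (meson transD)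
  qed
  note perms = simple_refl_permutes[OF i1] simple_refl_permutes[OF i2]
  show ?thesis
  proof (cases "b \<in> U")
    case True
    then have bV: "i + 1 \<notin> V" using b bi by (simp add: V_def)
    show ?thesis
    proof (rule finish)
      show "(simple_refl (i + 1) \<circ> simple_refl i, simple_refl (i + 1)) \<in> \<Theta>"
        using gen True bi unfolding contracts_generators_def by auto
      \<comment> \<open>The inversion \<open>(i + 1, i + 2)\<close> of the shorter end only adds
        \<open>i + 1\<close> to the upper block, so the two blocks remain unlinked.\<close>
      let ?G = "{(q, p). q < p \<and> (a \<le> q \<and> p \<le> i \<or> i < q \<and> p \<le> c)}"
      show "biclosed n ?G" by (rule biclosed_two_blocks) (use bi ac' in auto)
      show "inversions n (simple_refl (i + 1)) \<subseteq> ?G"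
        unfolding inversions_simple_refl[OF i2] using bi by auto
      show "Z \<subseteq> ?G" "(a, c) \<notin> ?G" using bi by (auto simp: Z_def)
      fix I :: "(nat \<times> nat) set"
      assume I: "trans I" "inversions n (simple_refl (i + 1) \<circ> simple_refl i) \<subseteq> I" "Z \<subseteq> I"
      have g: "(i, i + 2) \<in> I" "(i + 1, i + 2) \<in> I"
        using I(2) unfolding inversions_simple_refl_down[OF i1 i2] by auto
      show "?K \<subseteq> I"
      proof (rule subrelI)
        fix q p assume "(q, p) \<in> ?K"
        then have h: "a \<le> q" "q < p" "p \<le> c" "p \<noteq> i + 1" using bV bi by (auto simp: arc_inversions_def)
        then consider "p \<le> i \<or> i + 1 < q" | "q \<le> i" "i + 2 \<le> p" | "q = i + 1" "p = i + 2 \<or> i + 2 < p"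
          by linarith
        then show "(q, p) \<in> I"
        proof cases
          case 3
          then have "p = i + 2 \<or> (i + 2, p) \<in> I" using inside[OF I(3), of "i + 2" p] h(3) by auto
          then show ?thesis using 3(1) g(2) I(1) by (meson transD)
        next
          case 1
          then show ?thesis using inside[OF I(3) h(2)] h(1,3) by blast
        next
          case 2
          then show ?thesis using across[OF I(1,3) g(1)] h(1,3) by blast
        qed
      qed
    qed (use perms permutes_compose[OF perms(1,2)] in auto)
  next
    case False
    then have "(a, i + 1) \<in> ?I" using b bi by simp
    then have bV: "i + 1 \<in> V" by (simp add: V_def)
    show ?thesis
    proof (rule finish)
      show "(simple_refl i \<circ> simple_refl (i + 1), simple_refl i) \<in> \<Theta>"
        using gen False bi unfolding contracts_generators_def by auto
      let ?G = "{(q, p). q < p \<and> (a \<le> q \<and> p \<le> i + 1 \<or> i + 1 < q \<and> p \<le> c)}"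
      show "biclosed n ?G" by (rule biclosed_two_blocks) (use bi ac' in auto)
      show "inversions n (simple_refl i) \<subseteq> ?G"
        unfolding inversions_simple_refl[OF i1] using bi by auto
      show "Z \<subseteq> ?G" "(a, c) \<notin> ?G" using bi by (auto simp: Z_def)
      fix I :: "(nat \<times> nat) set"
      assume I: "trans I" "inversions n (simple_refl i \<circ> simple_refl (i + 1)) \<subseteq> I" "Z \<subseteq> I"
      have g: "(i, i + 2) \<in> I" "(i, i + 1) \<in> I"
        using I(2) unfolding inversions_simple_refl_up[OF i1 i2] by auto
      show "?K \<subseteq> I"
      proof (rule subrelI)
        fix q p assume "(q, p) \<in> ?K"
        then have h: "a \<le> q" "q < p" "p \<le> c" "q \<noteq> i + 1" using bV bi by (auto simp: arc_inversions_def)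
        then consider "p \<le> i \<or> i + 1 < q" | "q \<le> i" "i + 2 \<le> p" | "p = i + 1" "q = i \<or> q < i"
          by linarith
        then show "(q, p) \<in> I"
        proof cases
          case 3
          then have "q = i \<or> (q, i) \<in> I" using inside[OF I(3), of q i] h(1) by auto
          then show ?thesis using 3(1) g(2) I(1) by (meson transD)
        next
          case 1
          then show ?thesis using inside[OF I(3) h(2)] h(1,3) by blast
        next
          case 2
          then show ?thesis using across[OF I(1,3) g(1)] h(1,3) by blast
        qed
      qed
    qed (use perms permutes_compose[OF perms(2,1)] in auto)
  qed
qed

text \<open>Lower arcs grow with \<open>w\<close>, so between comparable congruent elements they
  stay constant along a chain of covers, and each cover lies in \<open>\<Theta>\<close>. Two
  arbitrary congruent elements are linked through their meet, which has the same lower arcs.\<close>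

lemma arc_congruence_least:
  assumes cong: "lattice_congruence (weak_order n) \<Theta>" and gen: "contracts_generators n U \<Theta>"
  shows "arc_congruence n U \<subseteq> \<Theta>"
proof -
  note rules = weak_order_congruence[OF cong]
  have mono: "lower_arcs n U x \<subseteq> lower_arcs n U y" if "inversions n x \<subseteq> inversions n y" for x y
    using that by (auto simp: lower_arcs_def)
  have chain: "(x, y) \<in> \<Theta>" if "x permutes {1..n+1}" "y permutes {1..n+1}"
    "inversions n x \<subseteq> inversions n y" "lower_arcs n U x = lower_arcs n U y" for x y
    using that
  proof (induction "card (inversions n y - inversions n x)" arbitrary: x rule: less_induct)
    case less
    show ?case
    proof (cases "inversions n x = inversions n y")
      case True
      then have "x = y" using inversions_inject less.prems by blast
      then show ?thesis using rules(1) less.prems(1) by blast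
    next
      case False
      then obtain z a c where z: "z permutes {1..n+1}" "inversions n z = insert (a, c) (inversions n x)"
        "(a, c) \<notin> inversions n x" "inversions n z \<subseteq> inversions n y"
        using weak_order_cover_between[OF less.prems(1,2)] less.prems(3) by blast
      have e: "lower_arcs n U x = lower_arcs n U z" "lower_arcs n U z = lower_arcs n U y"
        using mono[of x z] mono[of z y] z less.prems(4) by auto
      have "inversions n y - inversions n z \<subset> inversions n y - inversions n x" using z by blast
      then have "card (inversions n y - inversions n z) < card (inversions n y - inversions n x)"
        by (intro psubset_card_mono) (auto simp: finite_inversions)
      then have "(z, y) \<in> \<Theta>" using less.hyps[OF _ z(1) less.prems(2) z(4) e(2)] by blast
      moreover have "(x, z) \<in> \<Theta>"
        using arc_congruence_cover_in[OF cong gen less.prems(1) z(1,2,3) e(1)] .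
      ultimately show ?thesis using rules(3) by blast
    qed
  qed
  have "(x, y) \<in> \<Theta>" if "(x, y) \<in> arc_congruence n U" for x y
  proof -
    have xy: "x permutes {1..n+1}" "y permutes {1..n+1}" "lower_arcs n U x = lower_arcs n U y"
      using that by (auto simp: arc_congruence_def)
    let ?m = "x \<sqinter>\<^bsub>weak_order n\<^esub> y"
    note M = weak_order_meet[OF xy(1,2)]
    have "lower_arcs n U ?m = lower_arcs n U x" "lower_arcs n U ?m = lower_arcs n U y"
      using lower_arcs_meet[OF xy(1,2)] xy(3) by auto
    then have "(?m, x) \<in> \<Theta>" "(?m, y) \<in> \<Theta>" using chain M xy by blast+
    then show ?thesis using rules(2,3) by blast
  qed
  then show ?thesis by auto
qed

section \<open>The Cambrian congruences of a bipartite quiver\<close>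

lemma arc_congruence_cong:
  assumes "\<And>b. b \<in> {2..n} \<Longrightarrow> b \<in> U \<longleftrightarrow> b \<in> V"
  shows "arc_congruence n U = arc_congruence n V"
proof -
  have "lower_arcs n U w = lower_arcs n V w" for w
    unfolding lower_arcs_def using arc_inversions_cong[of _ _ n U V] assms by auto
  then show ?thesis unfolding arc_congruence_def by simp
qed

lemma type_A_quiver_contracts_iff:
  assumes "type_A_quiver n Q"
  shows "(\<forall>j i. (j, i) \<in> Q \<longrightarrow> (simple_refl j \<otimes>\<^bsub>W n\<^esub> simple_refl i, simple_refl j) \<in> \<Theta>) \<longleftrightarrow>
    contracts_generators n {b. (b, b - 1) \<in> Q} \<Theta>" (is "?L \<longleftrightarrow> ?R")
proof
  assume L: ?L
  show ?R unfolding contracts_generators_def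
  proof (intro allI impI)
    fix i assume i: "1 \<le> i \<and> i + 1 \<le> n"
    then have "((i, i + 1) \<in> Q) \<noteq> ((i + 1, i) \<in> Q)" using assms unfolding type_A_quiver_def by blast
    then show "if i + 1 \<in> {b. (b, b - 1) \<in> Q} then (simple_refl (i + 1) \<circ> simple_refl i, simple_refl (i + 1)) \<in> \<Theta>
       else (simple_refl i \<circ> simple_refl (i + 1), simple_refl i) \<in> \<Theta>"
      using L by (auto simp: sym_group_mult)
  qed
next
  assume R: ?R
  show ?L
  proof (intro allI impI)
    fix j i assume ji: "(j, i) \<in> Q"
    then have s: "j \<in> {1..n}" "i \<in> {1..n}" "j = i + 1 \<or> i = j + 1"
      using assms unfolding type_A_quiver_def by auto
    from s(3) show "(simple_refl j \<otimes>\<^bsub>W n\<^esub> simple_refl i, simple_refl j) \<in> \<Theta>"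
    proof
      assume "j = i + 1"
      then show ?thesis using R s ji unfolding contracts_generators_def by (auto simp: sym_group_mult)
    next
      assume e: "i = j + 1"
      then have "(j + 1, j) \<notin> Q" using assms ji s unfolding type_A_quiver_def by auto
      then show ?thesis using R s e unfolding contracts_generators_def by (auto simp: sym_group_mult)
    qed
  qed
qed

lemma cambrian_congruence_eq:
  assumes "type_A_quiver n Q"
  shows "cambrian_congruence n Q = arc_congruence n {b. (b, b - 1) \<in> Q}"
  unfolding cambrian_congruence_def type_A_quiver_contracts_iff[OF assms]
proof (rule the_equality)
  show 1: "least (congruence_lattice (weak_order n)) (arc_congruence n {b. (b, b - 1) \<in> Q})
     {\<Theta>'. lattice_congruence (weak_order n) \<Theta>' \<and> contracts_generators n {b. (b, b - 1) \<in> Q} \<Theta>'}"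
    using lattice_congruence_arc_congruence contracts_generators_arc_congruence arc_congruence_least
    unfolding least_def congruence_lattice_def by auto
  fix \<Theta> assume "least (congruence_lattice (weak_order n)) \<Theta>
     {\<Theta>'. lattice_congruence (weak_order n) \<Theta>' \<and> contracts_generators n {b. (b, b - 1) \<in> Q} \<Theta>'}"
  then show "\<Theta> = arc_congruence n {b. (b, b - 1) \<in> Q}"
    using 1 unfolding least_def congruence_lattice_def by (intro equalityI) auto
qed

lemma lattice_congruence_Int:
  assumes "lattice_congruence L A" "lattice_congruence L B"
  shows "lattice_congruence L (A \<inter> B)"
proof -
  have e: "equiv (carrier L) A" "equiv (carrier L) B"
    using assms unfolding lattice_congruence_def by fast+
  have "equiv (carrier L) (A \<inter> B)"
  proof (rule equivI)
    show "A \<inter> B \<subseteq> carrier L \<times> carrier L" using e(1) by (elim equivE) blast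
    show "refl_on (carrier L) (A \<inter> B)"
      using e by (meson equivE refl_onD refl_onI IntI)
    show "sym (A \<inter> B)" using e by (meson equivE sym_Int)
    show "trans (A \<inter> B)" using e by (meson equivE trans_Int)
  qed
  then show ?thesis using assms unfolding lattice_congruence_def by fast
qed

lemma congruence_lattice_meet:
  assumes A: "lattice_congruence L A" and B: "lattice_congruence L B"
  shows "A \<sqinter>\<^bsub>congruence_lattice L\<^esub> B = A \<inter> B"
  unfolding meet_def inf_def
proof (rule some_equality)
  show 1: "greatest (congruence_lattice L) (A \<inter> B) (Lower (congruence_lattice L) {A, B})"
    using A B lattice_congruence_Int[OF A B]
    unfolding greatest_def Lower_def congruence_lattice_def by auto
  fix \<Theta> assume "greatest (congruence_lattice L) \<Theta> (Lower (congruence_lattice L) {A, B})"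
  then show "\<Theta> = A \<inter> B"
    using 1 unfolding greatest_def congruence_lattice_def by (intro equalityI) auto
qed

text \<open>At a sink or source the two arrows are both incoming or both outgoing, so the direction
  along the diagram flips at every vertex; \<open>(2, 1) \<in> Q\<close> fixes the phase.\<close>

lemma bipartite_quiver_alternates:
  assumes Q: "type_A_quiver n Q" and bip: "bipartite_quiver n Q" and b: "b \<in> {2..n}"
  shows "(b, b - 1) \<in> Q \<longleftrightarrow> even b = ((2, 1) \<in> Q)"
proof -
  have "2 \<le> b" "b \<le> n" using b by auto
  then show ?thesis
  proof (induction b rule: dec_induct)
    case (step b)
    have IH: "(b, b - 1) \<in> Q \<longleftrightarrow> even b = ((2, 1) \<in> Q)" using step by simp
    have "((b - 1, b) \<in> Q) \<noteq> ((b, b - 1) \<in> Q)"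
      using Q step unfolding type_A_quiver_def by (auto dest!: spec[of _ "b - 1"])
    moreover have "((b, b + 1) \<in> Q) \<noteq> ((b + 1, b) \<in> Q)"
      using Q step unfolding type_A_quiver_def by auto
    moreover have "b \<notin> Domain Q \<or> b \<notin> Range Q"
      using bip step unfolding bipartite_quiver_def by auto
    ultimately have "(b + 1, b) \<in> Q \<longleftrightarrow> (b, b - 1) \<notin> Q" by blast
    then show ?case using IH by auto
  qed simp
qed

text \<open>Reversing the quiver complements the set \<open>U\<close> on \<open>2..n\<close>. By
  alternation the two sets are the even and the odd numbers, in an order that the intersection
  forgets.\<close>

lemma bicambrian_congruence_eq:
  assumes "bipartite_coxeter_element n c"
  shows "bicambrian_congruence n c = arc_congruence n {b. even b} \<inter> arc_congruence n {b. odd b}"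
proof -
  obtain Q where Q: "type_A_quiver n Q" "bipartite_quiver n Q" "coxeter_element_of n Q c"
    using assms unfolding bipartite_coxeter_element_def by blast
  have Q': "type_A_quiver n (Q\<inverse>)" using Q(1) unfolding type_A_quiver_def by auto
  have conv: "(b - 1, b) \<in> Q \<longleftrightarrow> (b, b - 1) \<notin> Q" if "b \<in> {2..n}" for b
    using that Q(1) unfolding type_A_quiver_def by (auto dest!: spec[of _ "b - 1"])
  note alt = bipartite_quiver_alternates[OF Q(1,2)]
  let ?U = "{b. (b, b - 1) \<in> Q}" and ?V = "{b. (b, b - 1) \<in> Q\<inverse>}"
  have "bicambrian_congruence n c = arc_congruence n ?U \<inter> arc_congruence n ?V"
    unfolding bicambrian_congruence_def quiver_of_eq[OF Q(1,3)]
      cambrian_congruence_eq[OF Q(1)] cambrian_congruence_eq[OF Q']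
    by (intro congruence_lattice_meet lattice_congruence_arc_congruence)
  also have "\<dots> = arc_congruence n {b. even b} \<inter> arc_congruence n {b. odd b}"
  proof (cases "(2, 1) \<in> Q")
    case True
    have "arc_congruence n ?U = arc_congruence n {b. even b}"
      "arc_congruence n ?V = arc_congruence n {b. odd b}"
      using alt conv True by (auto intro!: arc_congruence_cong)
    then show ?thesis by simp
  next
    case False
    have "arc_congruence n ?U = arc_congruence n {b. odd b}"
      "arc_congruence n ?V = arc_congruence n {b. even b}"
      using alt conv False by (auto intro!: arc_congruence_cong)
    then show ?thesis by blast
  qed
  finally show ?thesis .
qed

section \<open>Alternating runs\<close>

type_synonym arc = "nat \<times> nat \<times> bool"

definition arcs :: "nat \<Rightarrow> arc set" where
  "arcs N = {(i, j, s). 1 \<le> i \<and> i < j \<and> j \<le> N}"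

text \<open>Here \<open>k\<close> names the step from \<open>k\<close> to \<open>k + 1\<close>,
  hence the strict bound by \<open>j\<close>.\<close>

definition covers :: "arc \<Rightarrow> nat \<Rightarrow> bool" where
  "covers = (\<lambda>(i, j, s) k. i \<le> k \<and> k < j)"

text \<open>
  The run \<open>(i, j, s)\<close> is high at the even points if \<open>s\<close> holds and at the odd ones otherwise. Outside
  \<open>[i, j]\<close> the pattern is continued as a constant: maximality of a run says exactly that its
  neighbours \<open>i - 1\<close> and \<open>j + 1\<close>, when they exist, are on the side of \<open>i\<close> and \<open>j\<close>.
\<close>

definition high :: "arc \<Rightarrow> nat \<Rightarrow> bool" where
  "high = (\<lambda>(i, j, s) m. even (max i (min m j)) = s)"

abbreviation gap :: "arc \<Rightarrow> nat \<Rightarrow> nat \<Rightarrow> real" where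
  "gap \<rho> m m' \<equiv> of_bool (high \<rho> m) - of_bool (high \<rho> m')"

text \<open>The run together with its neighbours \<open>i - 1\<close> and \<open>j + 1\<close>, as
  far as they exist; \<open>i \<le> m + 1\<close> avoids truncated subtraction.\<close>

definition window :: "nat \<Rightarrow> arc \<Rightarrow> nat set" where
  "window N = (\<lambda>(i, j, s). {m \<in> {1..N}. i \<le> m + 1 \<and> m \<le> j + 1})"

definition levels :: "nat \<Rightarrow> (nat \<Rightarrow> real) \<Rightarrow> arc \<Rightarrow> real set" where
  "levels N x \<rho> = {t. \<forall>m \<in> window N \<rho>. if high \<rho> m then t < x m else x m < t}"

definition runs :: "nat \<Rightarrow> (nat \<Rightarrow> real) \<Rightarrow> arc set" where
  "runs N x = {\<rho> \<in> arcs N. levels N x \<rho> \<noteq> {}}"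

text \<open>A measure, because the expansion of \<open>x\<close> comes from level sets that fill an
  interval disjointly; \<open>weight_eq\<close> gives the closed form.\<close>

definition weight :: "nat \<Rightarrow> (nat \<Rightarrow> real) \<Rightarrow> arc \<Rightarrow> real" where
  "weight N x \<rho> = measure lborel (levels N x \<rho>)"

section \<open>Level sets, weights and the expansion of a height function\<close>

lemma finite_arcs: "finite (arcs N)"
  by (rule finite_subset[of _ "{1..N} \<times> {1..N} \<times> UNIV"]) (auto simp: arcs_def)

lemma runs_subset: "runs N x \<subseteq> arcs N"
  by (auto simp: runs_def)

lemma finite_runs: "finite (runs N x)"
  using finite_subset[OF runs_subset finite_arcs] .

lemma finite_window: "finite (window N \<rho>)"
  by (cases \<rho>) (auto simp: window_def)

lemma window_subset: "window N \<rho> \<subseteq> {1..N}"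
  by (cases \<rho>) (auto simp: window_def)

lemma high_Suc: "high (i, j, s) k \<noteq> high (i, j, s) (Suc k) \<longleftrightarrow> covers (i, j, s) k"
proof -
  consider "k < i" "i < j" | "i \<le> k" "k < j" | "j \<le> k" "i < j" | "j \<le> i" by linarith
  then show ?thesis
  proof cases
    case 1
    then have "max i (min k j) = i" "max i (min (Suc k) j) = i" by arith+
    then show ?thesis using 1 by (simp add: high_def covers_def)
  next
    case 2
    then have "max i (min k j) = k" "max i (min (Suc k) j) = Suc k" by arith+
    then show ?thesis using 2 by (simp add: high_def covers_def)
  next
    case 3
    then have "max i (min k j) = j" "max i (min (Suc k) j) = j" by arith+
    then show ?thesis using 3 by (simp add: high_def covers_def)
  next
    case 4
    then have "max i (min k j) = i" "max i (min (Suc k) j) = i" by arith+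
    then show ?thesis using 4 by (simp add: high_def covers_def)
  qed
qed

lemma window_nonempty:
  assumes "\<rho> \<in> arcs N"
  shows "\<exists>h \<in> window N \<rho>. high \<rho> h" "\<exists>l \<in> window N \<rho>. \<not> high \<rho> l"
proof -
  obtain i j s where r: "\<rho> = (i, j, s)" by (cases \<rho>)
  have ij: "1 \<le> i" "i < j" "j \<le> N" using assms by (auto simp: r arcs_def)
  then have w: "i \<in> window N \<rho>" "Suc i \<in> window N \<rho>" by (auto simp: window_def r)
  have "high \<rho> i \<noteq> high \<rho> (Suc i)" using high_Suc[of i j s i] ij by (simp add: r covers_def)
  then show "\<exists>h \<in> window N \<rho>. high \<rho> h" "\<exists>l \<in> window N \<rho>. \<not> high \<rho> l" using w by blast+
qed

lemma levels_eq:
  assumes "\<rho> \<in> arcs N"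
  shows "levels N x \<rho> =
    {Max (x ` {l \<in> window N \<rho>. \<not> high \<rho> l})<..<Min (x ` {h \<in> window N \<rho>. high \<rho> h})}"
proof -
  let ?L = "x ` {l \<in> window N \<rho>. \<not> high \<rho> l}" and ?H = "x ` {h \<in> window N \<rho>. high \<rho> h}"
  have f: "finite ?L" "?L \<noteq> {}" "finite ?H" "?H \<noteq> {}"
    using window_nonempty[OF assms] finite_window by auto
  have "t \<in> levels N x \<rho> \<longleftrightarrow> (\<forall>a\<in>?L. a < t) \<and> (\<forall>b\<in>?H. t < b)" for t
    by (auto simp: levels_def)
  then have "t \<in> levels N x \<rho> \<longleftrightarrow> t \<in> {Max ?L<..<Min ?H}" for t
    using f by (simp add: Max_less_iff Min_gr_iff)
  then show ?thesis by blast
qed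

lemma in_runs_iff: "\<rho> \<in> arcs N \<Longrightarrow> \<rho> \<in> runs N x \<longleftrightarrow> levels N x \<rho> \<noteq> {}"
  by (simp add: runs_def)

text \<open>The open interval of levels is nonempty as soon as each low value is below each high
  one. Hence the run set depends only on the strict order of the values.\<close>

lemma runs_iff:
  assumes "\<rho> \<in> arcs N"
  shows "\<rho> \<in> runs N x \<longleftrightarrow>
    (\<forall>h \<in> window N \<rho>. \<forall>l \<in> window N \<rho>. high \<rho> h \<longrightarrow> \<not> high \<rho> l \<longrightarrow> x l < x h)"
proof -
  let ?L = "x ` {l \<in> window N \<rho>. \<not> high \<rho> l}" and ?H = "x ` {h \<in> window N \<rho>. high \<rho> h}"
  have f: "finite ?L" "?L \<noteq> {}" "finite ?H" "?H \<noteq> {}"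
    using window_nonempty[OF assms] finite_window by auto
  have "\<rho> \<in> runs N x \<longleftrightarrow> Max ?L < Min ?H"
    unfolding in_runs_iff[OF assms] levels_eq[OF assms] by (simp add: not_le)
  also have "\<dots> \<longleftrightarrow> (\<forall>a\<in>?L. \<forall>b\<in>?H. a < b)"
    unfolding Max_less_iff[OF f(1,2)] Min_gr_iff[OF f(3,4)] by blast
  finally show ?thesis by auto
qed

lemma weight_eq:
  assumes "\<rho> \<in> arcs N"
  shows "weight N x \<rho> = max 0
    (Min (x ` {h \<in> window N \<rho>. high \<rho> h}) - Max (x ` {l \<in> window N \<rho>. \<not> high \<rho> l}))"
  unfolding weight_def levels_eq[OF assms] by (simp add: measure_lborel_Ioo max_def)

lemma weight_nonneg: "weight N x \<rho> \<ge> 0"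
  by (simp add: weight_def)

lemma weight_pos_iff:
  assumes "\<rho> \<in> arcs N"
  shows "weight N x \<rho> > 0 \<longleftrightarrow> \<rho> \<in> runs N x"
  unfolding weight_eq[OF assms] in_runs_iff[OF assms] levels_eq[OF assms] by (simp add: less_max_iff_disj not_le)

lemma weight_eq_0: "\<rho> \<in> arcs N \<Longrightarrow> \<rho> \<notin> runs N x \<Longrightarrow> weight N x \<rho> = 0"
  using weight_pos_iff weight_nonneg less_eq_real_def by metis

lemma weight_ge:
  assumes r: "\<rho> \<in> arcs N"
    and d: "\<And>h l. h \<in> window N \<rho> \<Longrightarrow> l \<in> window N \<rho> \<Longrightarrow> high \<rho> h \<Longrightarrow> \<not> high \<rho> l \<Longrightarrow> d \<le> x h - x l"
  shows "d \<le> weight N x \<rho>"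
proof -
  let ?L = "x ` {l \<in> window N \<rho>. \<not> high \<rho> l}" and ?H = "x ` {h \<in> window N \<rho>. high \<rho> h}"
  have f: "finite ?L" "?L \<noteq> {}" "finite ?H" "?H \<noteq> {}"
    using window_nonempty[OF r] finite_window by auto
  have "Max ?L \<in> ?L" "Min ?H \<in> ?H" using f Max_in Min_in by blast+
  then have "d \<le> Min ?H - Max ?L" using d by fastforce
  then show ?thesis unfolding weight_eq[OF r] by simp
qed

lemma levels_window:
  assumes "t \<in> levels N x \<rho>" "m \<in> window N \<rho>"
  shows "t < x m \<longleftrightarrow> high \<rho> m" "x m < t \<longleftrightarrow> \<not> high \<rho> m"
  using assms by (fastforce simp: levels_def split: if_splits)+

lemma covers_window:
  assumes "\<rho> \<in> arcs N" "covers \<rho> k"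
  shows "k \<in> window N \<rho>" "Suc k \<in> window N \<rho>"
  using assms by (cases \<rho>; auto simp: arcs_def covers_def window_def)+

text \<open>Both runs read their sides at \<open>k\<close> off \<open>x\<close>, which forces the
  same \<open>s\<close>. If one began further left, the point just before the later start would have
  to alternate for one run and to repeat a side for the other; similarly on the right.\<close>

lemma run_through_unique:
  assumes r: "\<rho> \<in> arcs N" "covers \<rho> k" "t \<in> levels N x \<rho>"
    and r': "\<rho>' \<in> arcs N" "covers \<rho>' k" "t \<in> levels N x \<rho>'"
  shows "\<rho> = \<rho>'"
proof -
  have le: "i' \<le> i \<and> j \<le> j'" if "(i, j, s) \<in> arcs N" "covers (i, j, s) k" "t \<in> levels N x (i, j, s)"
    "(i', j', s) \<in> arcs N" "covers (i', j', s) k" "t \<in> levels N x (i', j', s)" for i j i' j' s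
  proof (intro conjI)
    have b: "1 \<le> i" "i \<le> k" "k < j" "j \<le> N" "1 \<le> i'" "i' \<le> k" "k < j'" "j' \<le> N"
      using that by (auto simp: arcs_def covers_def)
    show "i' \<le> i"
    proof (rule ccontr)
      assume "\<not> i' \<le> i"
      then have "i' - 1 \<in> window N (i, j, s)" "i' - 1 \<in> window N (i', j', s)"
        "high (i, j, s) (i' - 1) \<longleftrightarrow> even (i' - 1) = s" "high (i', j', s) (i' - 1) \<longleftrightarrow> even i' = s"
        using b by (auto simp: window_def high_def max_def min_def)
      moreover have "even (i' - 1) \<noteq> even i'" using b by simp
      ultimately show False using levels_window that by metis
    qed
    show "j \<le> j'"
    proof (rule ccontr)
      assume "\<not> j \<le> j'"
      then have "j' + 1 \<in> window N (i, j, s)" "j' + 1 \<in> window N (i', j', s)"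
        "high (i, j, s) (j' + 1) \<longleftrightarrow> even (j' + 1) = s" "high (i', j', s) (j' + 1) \<longleftrightarrow> even j' = s"
        using b by (auto simp: window_def high_def max_def min_def)
      moreover have "even (j' + 1) \<noteq> even j'" by simp
      ultimately show False using levels_window that by metis
    qed
  qed
  obtain i j s i' j' s' where e: "\<rho> = (i, j, s)" "\<rho>' = (i', j', s')" by (cases \<rho>, cases \<rho>')
  have "high \<rho> k = high \<rho>' k"
    using levels_window(1) r r' covers_window(1) by metis
  moreover have "high \<rho> k = (even k = s)" "high \<rho>' k = (even k = s')"
    using r(2) r'(2) by (auto simp: e covers_def high_def max_def min_def)
  ultimately have s: "s = s'" by blast
  show ?thesis
    using le[of i j s i' j'] le[of i' j' s i j] r r' unfolding e s by auto
qed

text \<open>Among the alternating stretches around \<open>k\<close> one of greatest length is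
  chosen. That it cannot be prolonged gives the conditions at its neighbours, and the side of
  \<open>i\<close> gives \<open>s\<close>.\<close>

lemma ex_run_through:
  assumes k: "1 \<le> k" "k < N" and t: "t \<notin> x ` {1..N}" and sep: "(t < x k) \<noteq> (t < x (Suc k))"
  shows "\<exists>\<rho> \<in> arcs N. covers \<rho> k \<and> t \<in> levels N x \<rho>"
proof -
  define alt where "alt m \<longleftrightarrow> (t < x m) \<noteq> (t < x (Suc m))" for m
  define P where "P = (\<lambda>(i, j). 1 \<le> i \<and> i \<le> k \<and> k < j \<and> j \<le> N \<and> (\<forall>m. i \<le> m \<and> m < j \<longrightarrow> alt m))"
  have "P (k, Suc k)" using k sep by (auto simp: P_def alt_def less_Suc_eq dest: le_antisym)
  moreover have "\<forall>p. P p \<longrightarrow> snd p - fst p < N" using k by (auto simp: P_def)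
  ultimately obtain p where p: "P p" "\<And>q. P q \<Longrightarrow> snd q - fst q \<le> snd p - fst p"
    using ex_has_greatest_nat[where P = P and f = "\<lambda>p. snd p - fst p" and b = N] by metis
  obtain i j where ij: "p = (i, j)" by force
  have b: "1 \<le> i" "i \<le> k" "k < j" "j \<le> N" and altm: "\<And>m. i \<le> m \<Longrightarrow> m < j \<Longrightarrow> alt m"
    using p(1) by (auto simp: P_def ij)
  define s where "s \<longleftrightarrow> even i = (t < x i)"
  have hi: "t < x m \<longleftrightarrow> even m = s" if "i \<le> m" "m \<le> j" for m
    using that
  proof (induction m rule: dec_induct)
    case base show ?case by (auto simp: s_def)
  next
    case (step m) then show ?case using altm[of m] by (auto simp: alt_def)
  qed
  have left: "t < x (i - 1) \<longleftrightarrow> even i = s" if "2 \<le> i"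
  proof -
    have "\<not> alt (i - 1)"
    proof
      assume a: "alt (i - 1)"
      have "P (i - 1, j)" unfolding P_def
      proof (clarsimp, intro conjI allI impI)
        fix m assume m: "i - Suc 0 \<le> m \<and> m < j"
        show "alt m" using a altm[of m] m by (cases "m = i - 1") auto
      qed (use b that in auto)
      then show False using p(2)[of "(i - 1, j)"] b that by (auto simp: ij)
    qed
    then show ?thesis using hi[of i] b that by (auto simp: alt_def)
  qed
  have right: "t < x (Suc j) \<longleftrightarrow> even j = s" if "j < N"
  proof -
    have "\<not> alt j"
    proof
      assume a: "alt j"
      have "P (i, Suc j)" unfolding P_def
      proof (clarsimp, intro conjI allI impI)
        fix m assume m: "i \<le> m \<and> m < Suc j"
        show "alt m" using a altm[of m] m by (cases "m = j") auto
      qed (use b that in auto)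
      then show False using p(2)[of "(i, Suc j)"] b that by (auto simp: ij)
    qed
    then show ?thesis using hi[of j] b by (auto simp: alt_def)
  qed
  let ?r = "(i, j, s)"
  have "t \<in> levels N x ?r"
    unfolding levels_def
  proof (clarify)
    fix m assume m: "m \<in> window N ?r"
    then have mN: "m \<in> {1..N}" and c: "i \<le> m + 1" "m \<le> j + 1" by (auto simp: window_def)
    have "t < x m \<longleftrightarrow> high ?r m"
    proof -
      consider "m + 1 = i" | "i \<le> m" "m \<le> j" | "m = Suc j" using c by linarith
      then show ?thesis
      proof cases
        case 1
        then have "m = i - 1" "2 \<le> i" using mN by auto
        then show ?thesis using left b by (auto simp: high_def max_def min_def)
      next
        case 2
        then show ?thesis using hi b by (auto simp: high_def max_def min_def)
      next
        case 3
        then show ?thesis using right mN b by (auto simp: high_def max_def min_def)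
      qed
    qed
    moreover have "t \<noteq> x m" using t mN by blast
    ultimately show "if high ?r m then t < x m else x m < t" by auto
  qed
  then show ?thesis using b by (intro bexI[of _ ?r]) (auto simp: covers_def arcs_def)
qed

lemma levels_covers:
  assumes "\<rho> \<in> arcs N" "covers \<rho> k" "t \<in> levels N x \<rho>"
  shows "high \<rho> k \<and> x (Suc k) < t \<and> t < x k \<or> \<not> high \<rho> k \<and> x k < t \<and> t < x (Suc k)"
proof -
  obtain i j s where r: "\<rho> = (i, j, s)" by (cases \<rho>)
  have "high \<rho> k \<noteq> high \<rho> (Suc k)" using high_Suc assms(2) r by blast
  then show ?thesis using levels_window[OF assms(3)] covers_window[OF assms(1,2)] by metis
qed

text \<open>Away from the finitely many values of \<open>x\<close>, a level separates
  \<open>x k\<close> from \<open>x (Suc k)\<close> precisely when a run passes through that step,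
  and then only one does. So these level sets fill the interval between the two values up to a null
  set.\<close>

lemma sum_weight_covers:
  assumes k: "1 \<le> k" "k < N"
  shows "(\<Sum>\<rho> \<in> {\<rho> \<in> arcs N. covers \<rho> k}. weight N x \<rho>) = \<bar>x k - x (Suc k)\<bar>"
proof -
  let ?C = "{\<rho> \<in> arcs N. covers \<rho> k}" and ?X = "x ` {1..N}"
  let ?I = "{min (x k) (x (Suc k))<..<max (x k) (x (Suc k))}"
  let ?S = "\<lambda>\<rho>. levels N x \<rho> - ?X"
  have null: "?X \<in> null_sets lborel" by (intro finite_imp_null_set_lborel) auto
  have meas: "levels N x \<rho> \<in> sets lborel" if "\<rho> \<in> ?C" for \<rho> using that levels_eq[of \<rho>] by auto
  have w: "measure lborel (?S \<rho>) = weight N x \<rho>" if "\<rho> \<in> ?C" for \<rho>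
    unfolding weight_def by (rule measure_Diff_null_set[OF meas[OF that] null])
  have "(\<Union>\<rho>\<in>?C. ?S \<rho>) = ?I - ?X"
  proof (intro equalityI subsetI)
    fix t assume "t \<in> (\<Union>\<rho>\<in>?C. ?S \<rho>)"
    then show "t \<in> ?I - ?X" using levels_covers by fastforce
  next
    fix t assume t: "t \<in> ?I - ?X"
    then have "(t < x k) \<noteq> (t < x (Suc k))" by (auto simp: min_def max_def split: if_splits)
    then show "t \<in> (\<Union>\<rho>\<in>?C. ?S \<rho>)" using ex_run_through[OF k, of t x] t by blast
  qed
  then have "measure lborel (\<Union>\<rho>\<in>?C. ?S \<rho>) = measure lborel ?I"
    using measure_Diff_null_set[OF _ null, of ?I] by simp
  also have "\<dots> = \<bar>x k - x (Suc k)\<bar>" by (simp add: min_def max_def)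
  finally have "measure lborel (\<Union>\<rho>\<in>?C. ?S \<rho>) = \<bar>x k - x (Suc k)\<bar>" .
  moreover have "measure lborel (\<Union>\<rho>\<in>?C. ?S \<rho>) = (\<Sum>\<rho>\<in>?C. measure lborel (?S \<rho>))"
  proof (rule measure_finite_Union)
    show "finite ?C" using finite_arcs by auto
    show "?S ` ?C \<subseteq> sets lborel" using meas null by auto
    show "disjoint_family_on ?S ?C"
      unfolding disjoint_family_on_def using run_through_unique by blast
    show "emeasure lborel (?S \<rho>) \<noteq> \<infinity>" if "\<rho> \<in> ?C" for \<rho>
    proof -
      have "emeasure lborel (?S \<rho>) \<le> emeasure lborel (levels N x \<rho>)"
        by (rule emeasure_mono) (use meas that in auto)
      also have "\<dots> < \<infinity>"
        using that levels_eq[of \<rho> N x] emeasure_bounded_finite[OF bounded_Ioo] by simp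
      finally show ?thesis by simp
    qed
  qed
  ultimately show ?thesis using w by (metis (mono_tags, lifting) sum.cong)
qed

text \<open>All occurring runs through the step cross it in the same direction as \<open>x\<close>,
  so the signed sum is \<open>sgn (x k - x (Suc k))\<close> times the unsigned one.\<close>

lemma weight_expansion_step:
  assumes k: "1 \<le> k" "k < N"
  shows "(\<Sum>\<rho> \<in> arcs N. weight N x \<rho> * gap \<rho> k (Suc k)) = x k - x (Suc k)"
proof -
  let ?C = "{\<rho> \<in> arcs N. covers \<rho> k}"
  have "(\<Sum>\<rho> \<in> arcs N. weight N x \<rho> * gap \<rho> k (Suc k)) =
      (\<Sum>\<rho> \<in> arcs N. if covers \<rho> k then sgn (x k - x (Suc k)) * weight N x \<rho> else 0)"
  proof (rule sum.cong[OF refl])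
    fix \<rho> assume r: "\<rho> \<in> arcs N"
    obtain i j s where e: "\<rho> = (i, j, s)" by (cases \<rho>)
    show "weight N x \<rho> * gap \<rho> k (Suc k) =
      (if covers \<rho> k then sgn (x k - x (Suc k)) * weight N x \<rho> else 0)"
    proof (cases "covers \<rho> k")
      case False
      then have "high \<rho> k = high \<rho> (Suc k)" using high_Suc e by blast
      then show ?thesis using False by simp
    next
      case True
      then have ne: "high \<rho> k \<noteq> high \<rho> (Suc k)" using high_Suc e by blast
      show ?thesis
      proof (cases "\<rho> \<in> runs N x")
        case False
        then show ?thesis using weight_eq_0[OF r] by simp
      next
        case in_runs: True
        then obtain t where "t \<in> levels N x \<rho>" by (auto simp: runs_def)
        then show ?thesis using levels_covers[OF r True] True ne by (fastforce simp: sgn_if)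
      qed
    qed
  qed
  also have "\<dots> = sgn (x k - x (Suc k)) * (\<Sum>\<rho> \<in> ?C. weight N x \<rho>)"
    by (simp add: sum.If_cases finite_arcs sum_distrib_left Int_def)
  also have "\<dots> = x k - x (Suc k)" unfolding sum_weight_covers[OF k] by (simp add: sgn_mult_abs)
  finally show ?thesis .
qed

lemma gap_telescope:
  assumes step: "\<And>k. 1 \<le> k \<Longrightarrow> k < N \<Longrightarrow> x k - x (Suc k) = (\<Sum>\<rho>\<in>F. \<mu> \<rho> * gap \<rho> k (Suc k))"
    and m: "m \<in> {1..N}" "m' \<in> {1..N}"
  shows "x m - x m' = (\<Sum>\<rho>\<in>F. \<mu> \<rho> * gap \<rho> m m')"
proof -
  define g where "g m = x m - (\<Sum>\<rho>\<in>F. \<mu> \<rho> * of_bool (high \<rho> m))" for m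
  have "g m = g 1" if "1 \<le> m" "m \<le> N" for m
    using that
  proof (induction m rule: dec_induct)
    case (step k)
    then show ?case using assms(1)[of k] by (simp add: g_def algebra_simps sum_subtractf)
  qed simp
  then have "g m = g m'" using m by (metis atLeastAtMost_iff)
  then show ?thesis by (simp add: g_def algebra_simps sum_subtractf)
qed

lemma weight_expansion:
  assumes "m \<in> {1..N}" "m' \<in> {1..N}"
  shows "x m - x m' = (\<Sum>\<rho> \<in> runs N x. weight N x \<rho> * gap \<rho> m m')"
proof -
  have "x m - x m' = (\<Sum>\<rho> \<in> arcs N. weight N x \<rho> * gap \<rho> m m')"
    by (rule gap_telescope[OF _ assms]) (simp add: weight_expansion_step)
  also have "\<dots> = (\<Sum>\<rho> \<in> runs N x. weight N x \<rho> * gap \<rho> m m')"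
    using weight_eq_0 by (intro sum.mono_neutral_right finite_arcs runs_subset) auto
  finally show ?thesis .
qed

text \<open>Beyond its window \<open>\<sigma>\<close> is constant, so if \<open>p\<close> lies
  beyond, the end of \<open>\<sigma>\<close> and its outer neighbour share the side of
  \<open>p\<close> in \<open>\<sigma>\<close>. The point \<open>q\<close>, on the other side in
  \<open>\<sigma>\<close>, forces \<open>\<rho>\<close> to run through both; as
  \<open>\<rho>\<close> alternates, one of them has the side of \<open>p\<close> in
  \<open>\<rho>\<close> as well.\<close>

lemma window_move:
  assumes r: "\<rho> \<in> arcs N" and s: "\<sigma> \<in> arcs N" and p: "p \<in> window N \<rho>" and q: "q \<in> window N \<rho>"
    and ne: "high \<sigma> p \<noteq> high \<sigma> q"
  shows "\<exists>p' \<in> window N \<rho> \<inter> window N \<sigma>. high \<rho> p' = high \<rho> p \<and> high \<sigma> p' = high \<sigma> p"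
proof -
  obtain i j u where e: "\<rho> = (i, j, u)" by (cases \<rho>)
  obtain i' j' u' where e': "\<sigma> = (i', j', u')" by (cases \<sigma>)
  have b: "1 \<le> i" "i < j" "j \<le> N" "1 \<le> i'" "i' < j'" "j' \<le> N" using r s by (auto simp: e e' arcs_def)
  have w: "1 \<le> p" "p \<le> N" "i \<le> p + 1" "p \<le> j + 1" "1 \<le> q" "q \<le> N" "i \<le> q + 1" "q \<le> j + 1"
    using p q by (auto simp: e window_def)
  consider "p + 1 < i'" | "j' + 1 < p" | "p \<in> window N \<sigma>"
    using w by (cases "p + 1 < i'"; cases "j' + 1 < p") (auto simp: e' window_def)
  then show ?thesis
  proof cases
    case 3
    then show ?thesis using p by blast
  next
    case 1
    have "i' < q"
    proof (rule ccontr)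
      assume "\<not> i' < q"
      then have "max i' (min q j') = i'" "max i' (min p j') = i'" using 1 b by arith+
      then show False using ne by (simp add: e' high_def)
    qed
    then have f: "i \<le> i' - 1" "i' \<le> j" using 1 w by auto
    have sm: "high \<sigma> (i' - 1) = high \<sigma> p" "high \<sigma> i' = high \<sigma> p"
      using 1 b by (auto simp: e' high_def max_def min_def)
    have "high \<rho> (i' - 1) \<noteq> high \<rho> (Suc (i' - 1))"
      using high_Suc[of i j u "i' - 1"] f 1 by (auto simp: e covers_def)
    then have "high \<rho> (i' - 1) = high \<rho> p \<or> high \<rho> i' = high \<rho> p" using 1 by auto
    moreover have "i' - 1 \<in> window N \<rho> \<inter> window N \<sigma>" "i' \<in> window N \<rho> \<inter> window N \<sigma>"
      using f b 1 by (auto simp: e e' window_def)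
    ultimately show ?thesis using sm by blast
  next
    case 2
    have "q < j'"
    proof (rule ccontr)
      assume "\<not> q < j'"
      then have "max i' (min q j') = j'" "max i' (min p j') = j'" using 2 b by arith+
      then show False using ne by (simp add: e' high_def)
    qed
    then have f: "i \<le> j'" "j' < j" using 2 w by auto
    have sm: "high \<sigma> (Suc j') = high \<sigma> p" "high \<sigma> j' = high \<sigma> p"
      using 2 b by (auto simp: e' high_def max_def min_def)
    have "high \<rho> j' \<noteq> high \<rho> (Suc j')"
      using high_Suc[of i j u j'] f by (auto simp: e covers_def)
    then have "high \<rho> (Suc j') = high \<rho> p \<or> high \<rho> j' = high \<rho> p" by auto
    moreover have "Suc j' \<in> window N \<rho> \<inter> window N \<sigma>" "j' \<in> window N \<rho> \<inter> window N \<sigma>"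
      using f b by (auto simp: e e' window_def)
    ultimately show ?thesis using sm by blast
  qed
qed

text \<open>If \<open>\<sigma>\<close> reversed the sides of \<open>h\<close> and \<open>l\<close>,
  both could be moved into the common window, where the two runs demand opposite strict inequalities
  of \<open>x\<close>.\<close>

lemma runs_compatible:
  assumes r: "\<rho> \<in> runs N x" and s: "\<sigma> \<in> runs N x"
    and h: "h \<in> window N \<rho>" "high \<rho> h" and l: "l \<in> window N \<rho>" "\<not> high \<rho> l" and sl: "high \<sigma> l"
  shows "high \<sigma> h"
proof (rule ccontr)
  assume n: "\<not> high \<sigma> h"
  have a: "\<rho> \<in> arcs N" "\<sigma> \<in> arcs N" using r s runs_subset by auto
  obtain h' where h': "h' \<in> window N \<rho> \<inter> window N \<sigma>" "high \<rho> h'" "\<not> high \<sigma> h'"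
    using window_move[OF a h(1) l(1)] n sl h(2) by blast
  obtain l' where l': "l' \<in> window N \<rho> \<inter> window N \<sigma>" "\<not> high \<rho> l'" "high \<sigma> l'"
    using window_move[OF a l(1) h(1)] n sl l(2) by blast
  have "x l' < x h'" using r h' l' runs_iff[OF a(1)] by blast
  moreover have "x h' < x l'" using s h' l' runs_iff[OF a(2)] by blast
  ultimately show False by simp
qed

text \<open>
  Compatibility bounds the weights of \<open>x\<close> below by \<open>\<mu>\<close>; the sum over the runs covering a given
  step is \<open>\<bar>x k - x (k + 1)\<bar>\<close>, which bounds it above.
\<close>

theorem runs_combination:
  assumes F: "F \<subseteq> runs N x0" and pos: "\<And>\<rho>. \<rho> \<in> F \<Longrightarrow> \<mu> \<rho> > 0"
    and x: "\<And>m m'. m \<in> {1..N} \<Longrightarrow> m' \<in> {1..N} \<Longrightarrow>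
      x m - x m' = (\<Sum>\<rho>\<in>F. \<mu> \<rho> * gap \<rho> m m')"
  shows "runs N x = F" and "\<And>\<rho>. \<rho> \<in> F \<Longrightarrow> weight N x \<rho> = \<mu> \<rho>"
proof -
  have finF: "finite F" using F finite_runs finite_subset by blast
  have Fa: "F \<subseteq> arcs N" using F runs_subset by blast
  define \<nu> where "\<nu> \<rho> = (if \<rho> \<in> F then \<mu> \<rho> else 0)" for \<rho>
  have ge: "\<nu> \<rho> \<le> weight N x \<rho>" if "\<rho> \<in> arcs N" for \<rho>
  proof (cases "\<rho> \<in> F")
    case True
    have "\<mu> \<rho> \<le> weight N x \<rho>"
    proof (rule weight_ge[OF that])
      fix h l assume hl: "h \<in> window N \<rho>" "l \<in> window N \<rho>" "high \<rho> h" "\<not> high \<rho> l"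
      have nn: "\<mu> \<sigma> * (gap \<sigma> h l) \<ge> 0" if "\<sigma> \<in> F" for \<sigma>
        using runs_compatible[of \<rho> N x0 \<sigma> h l] hl F True that pos[OF that] by auto
      have "\<mu> \<rho> = \<mu> \<rho> * gap \<rho> h l" using hl by simp
      also have "\<dots> \<le> (\<Sum>\<sigma>\<in>F. \<mu> \<sigma> * (gap \<sigma> h l))"
        using nn True finF by (intro member_le_sum) auto
      also have "\<dots> = x h - x l" using x[of h l] hl window_subset by (metis subsetD)
      finally show "\<mu> \<rho> \<le> x h - x l" .
    qed
    then show ?thesis using True by (simp add: \<nu>_def)
  qed (simp add: \<nu>_def weight_nonneg)
  have eq: "weight N x \<rho> = \<nu> \<rho>" if r: "\<rho> \<in> arcs N" for \<rho>
  proof -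
    obtain i j s where e: "\<rho> = (i, j, s)" by (cases \<rho>)
    have ij: "1 \<le> i" "i < j" "j \<le> N" "i < N" using r by (auto simp: e arcs_def)
    \<comment> \<open>The run covers its own first step \<open>i\<close>, so comparing the totals
      over that step term by term settles its weight.\<close>
    let ?C = "{\<rho> \<in> arcs N. covers \<rho> i}"
    have finC: "finite ?C" using finite_arcs by auto
    have "(\<Sum>\<rho>\<in>?C. weight N x \<rho>) = \<bar>x i - x (Suc i)\<bar>" using sum_weight_covers[of i N x] ij by simp
    also have "x i - x (Suc i) = (\<Sum>\<rho>\<in>F. \<mu> \<rho> * gap \<rho> i (Suc i))"
      using x[of i "Suc i"] ij by auto
    also have "\<bar>\<dots>\<bar> \<le> (\<Sum>\<rho>\<in>F. \<bar>\<mu> \<rho> * gap \<rho> i (Suc i)\<bar>)"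
      by (rule sum_abs)
    also have "\<dots> = (\<Sum>\<rho>\<in>F. if covers \<rho> i then \<mu> \<rho> else 0)"
    proof (rule sum.cong[OF refl])
      fix \<sigma> assume "\<sigma> \<in> F"
      then show "\<bar>\<mu> \<sigma> * (gap \<sigma> i (Suc i))\<bar> = (if covers \<sigma> i then \<mu> \<sigma> else 0)"
        using high_Suc[of "fst \<sigma>" "fst (snd \<sigma>)" "snd (snd \<sigma>)" i] pos[of \<sigma>] by (auto simp: abs_mult)
    qed
    also have "\<dots> = (\<Sum>\<rho>\<in>arcs N. if covers \<rho> i then \<nu> \<rho> else 0)"
      using Fa finite_arcs by (intro sum.mono_neutral_cong_left) (auto simp: \<nu>_def)
    also have "\<dots> = (\<Sum>\<rho>\<in>?C. \<nu> \<rho>)" using finite_arcs by (simp add: sum.If_cases Int_def)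
    finally have "(\<Sum>\<rho>\<in>?C. weight N x \<rho> - \<nu> \<rho>) \<le> 0" by (simp add: sum_subtractf)
    moreover have "(\<Sum>\<rho>\<in>?C. weight N x \<rho> - \<nu> \<rho>) \<ge> 0" using ge by (intro sum_nonneg) auto
    ultimately have "(\<Sum>\<rho>\<in>?C. weight N x \<rho> - \<nu> \<rho>) = 0" by linarith
    then have "\<forall>\<rho>\<in>?C. weight N x \<rho> - \<nu> \<rho> = 0"
      using ge finC by (subst (asm) sum_nonneg_eq_0_iff) auto
    moreover have "\<rho> \<in> ?C" using r ij by (auto simp: e covers_def)
    ultimately have "weight N x \<rho> - \<nu> \<rho> = 0" by blast
    then show ?thesis by simp
  qed
  show "runs N x = F"
  proof (intro equalityI subsetI)
    fix \<rho> assume r: "\<rho> \<in> runs N x"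
    then have "\<nu> \<rho> > 0" using weight_pos_iff eq runs_subset by (metis subsetD)
    then show "\<rho> \<in> F" by (auto simp: \<nu>_def split: if_splits)
  next
    fix \<rho> assume "\<rho> \<in> F"
    then have "\<rho> \<in> arcs N" "weight N x \<rho> > 0" using eq[of \<rho>] Fa pos[of \<rho>] by (auto simp: \<nu>_def)
    then show "\<rho> \<in> runs N x" using weight_pos_iff by blast
  qed
  show "weight N x \<rho> = \<mu> \<rho>" if "\<rho> \<in> F" for \<rho> using that eq[of \<rho>] Fa by (auto simp: \<nu>_def)
qed

section \<open>Run sets distinguish the biCambrian classes\<close>

definition height :: "(nat \<Rightarrow> nat) \<Rightarrow> nat \<Rightarrow> real" where
  "height w m = - real (inv' w m)"

lemma inversions_height:
  "(q, p) \<in> inversions n w \<longleftrightarrow> 1 \<le> q \<and> q < p \<and> p \<le> n + 1 \<and> height w q < height w p"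
  by (auto simp: inversions_def height_def)

lemma height_inj: "w permutes S \<Longrightarrow> height w p = height w q \<longleftrightarrow> p = q"
  using inv_permutes_inj[of w S p q] by (simp add: height_def)

lemma high_inner: "i \<le> m \<Longrightarrow> m \<le> j \<Longrightarrow> high (i, j, s) m \<longleftrightarrow> even m = s"
  by (simp add: high_def max_def min_def)

text \<open>Within the run \<open>U\<close> is the set of high points. So the arc set from a low
  \<open>a\<close> to a high \<open>c\<close> consists of pairs of a low point and a later high one,
  and the run condition on them says that \<open>(a, c)\<close> is a lower arc; from high to low one
  gets upper arcs. Hence the class determines the runs.\<close>

lemma runs_height_iff:
  assumes w: "w permutes {1..n+1}" and r: "(i, j, s) \<in> arcs (n + 1)"
  defines "U \<equiv> {b. even b = s}" and "\<rho> \<equiv> (i, j, s)"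
  shows "\<rho> \<in> runs (n + 1) (height w) \<longleftrightarrow>
    (\<forall>a \<in> window (n + 1) \<rho>. \<forall>c \<in> window (n + 1) \<rho>. a < c \<longrightarrow>
      (\<not> high \<rho> a \<and> high \<rho> c \<longrightarrow> (a, c) \<in> lower_arcs n U w) \<and>
      (high \<rho> a \<and> \<not> high \<rho> c \<longrightarrow> (a, c) \<in> upper_arcs n U w))"
proof -
  let ?W = "window (n + 1) \<rho>"
  have vp: "(a, c) \<in> value_pairs n" if "a \<in> ?W" "c \<in> ?W" "a < c" for a c
    using that window_subset[of "n+1" \<rho>] by (auto simp: value_pairs_def)
  have inner: "b \<in> ?W \<and> (high \<rho> b \<longleftrightarrow> b \<in> U)" if "a \<in> ?W" "c \<in> ?W" "a < b" "b < c" for a b c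
    using that by (auto simp: \<rho>_def window_def high_inner U_def)
  \<comment> \<open>The flag \<open>z\<close> treats both kinds at once: \<open>True\<close> gives
    \<open>U\<close> and lower arcs, \<open>False\<close> gives \<open>- U\<close> and upper
    arcs.\<close>
  have sets: "q \<in> ?W \<and> p \<in> ?W \<and> (high \<rho> q \<longleftrightarrow> \<not> z) \<and> (high \<rho> p \<longleftrightarrow> z) \<and> q < p"
    if qp: "(q, p) \<in> arc_inversions {b. b \<in> U \<longleftrightarrow> z} a c"
      and ac: "a \<in> ?W" "c \<in> ?W" "a < c" "high \<rho> a \<longleftrightarrow> \<not> z" "high \<rho> c \<longleftrightarrow> z" for a c q p z
  proof -
    have h: "a \<le> q" "q < p" "p \<le> c" "q = a \<or> (q \<in> U \<longleftrightarrow> \<not> z)" "p = c \<or> (p \<in> U \<longleftrightarrow> z)"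
      using qp by (auto simp: arc_inversions_def)
    have "q = a \<or> a < q \<and> q < c" "p = c \<or> a < p \<and> p < c" using h by auto
    then show ?thesis using ac h(2,4,5) inner[OF ac(1,2)] by blast
  qed
  have UU: "{b. b \<in> U \<longleftrightarrow> True} = U" "{b. b \<in> U \<longleftrightarrow> False} = - U" by auto
  have iff: "\<rho> \<in> runs (n + 1) (height w) \<longleftrightarrow>
    (\<forall>h \<in> ?W. \<forall>l \<in> ?W. high \<rho> h \<longrightarrow> \<not> high \<rho> l \<longrightarrow> height w l < height w h)"
    using runs_iff r unfolding \<rho>_def .
  have pairs: "(q, p) \<in> inversions n w \<longleftrightarrow> height w q < height w p"
    "(q, p) \<notin> inversions n w \<longleftrightarrow> height w p < height w q" if "q \<in> ?W" "p \<in> ?W" "q < p" for q p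
    using that window_subset[of "n+1" \<rho>] height_inj[OF w, of p q] by (auto simp: inversions_height)
  show ?thesis
  proof (intro iffI ballI impI conjI)
    fix a c assume R: "\<rho> \<in> runs (n + 1) (height w)" and ac: "a \<in> ?W" "c \<in> ?W" "a < c"
    {
      assume "\<not> high \<rho> a \<and> high \<rho> c"
      note sets[of _ _ True a c, unfolded UU] and this
      then have "q \<in> ?W \<and> p \<in> ?W \<and> \<not> high \<rho> q \<and> high \<rho> p \<and> q < p"
        if "(q, p) \<in> arc_inversions U a c" for q p using ac that by blast
      then have "arc_inversions U a c \<subseteq> inversions n w" using R[unfolded iff] pairs(1) by (intro subrelI) blast
      then show "(a, c) \<in> lower_arcs n U w" using vp[OF ac] by (simp add: lower_arcs_def)
    next
      assume "high \<rho> a \<and> \<not> high \<rho> c"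
      note sets[of _ _ False a c, unfolded UU] and this
      then have "q \<in> ?W \<and> p \<in> ?W \<and> high \<rho> q \<and> \<not> high \<rho> p \<and> q < p"
        if "(q, p) \<in> arc_inversions (- U) a c" for q p using ac that by blast
      then have "(q, p) \<notin> inversions n w" if "(q, p) \<in> arc_inversions (- U) a c" for q p
        using R[unfolded iff] pairs(2) that by blast
      then have "arc_inversions (- U) a c \<inter> inversions n w = {}" by auto
      then show "(a, c) \<in> upper_arcs n U w" using vp[OF ac] by (simp add: upper_arcs_def)
    }
  next
    assume A: "\<forall>a \<in> ?W. \<forall>c \<in> ?W. a < c \<longrightarrow>
      (\<not> high \<rho> a \<and> high \<rho> c \<longrightarrow> (a, c) \<in> lower_arcs n U w) \<and>
      (high \<rho> a \<and> \<not> high \<rho> c \<longrightarrow> (a, c) \<in> upper_arcs n U w)"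
    show "\<rho> \<in> runs (n + 1) (height w)" unfolding iff
    proof (intro ballI impI)
      fix h l assume hl: "h \<in> ?W" "l \<in> ?W" "high \<rho> h" "\<not> high \<rho> l"
      then consider "l < h" | "h < l" by (metis linorder_neqE_nat)
      then show "height w l < height w h"
      proof cases
        case 1
        then have "(l, h) \<in> lower_arcs n U w" using A hl by blast
        then show ?thesis using arc_inversions_self[OF 1] pairs(1) 1 hl by (auto simp: lower_arcs_def)
      next
        case 2
        then have "(h, l) \<in> upper_arcs n U w" using A hl by blast
        then show ?thesis using arc_inversions_self[OF 2] pairs(2) 2 hl by (auto simp: upper_arcs_def)
      qed
    qed
  qed
qed

lemma ex_descent_between:
  fixes P :: "nat \<Rightarrow> bool"
  assumes "q < p" "P q" "\<not> P p"
  shows "\<exists>k. q \<le> k \<and> k < p \<and> P k \<and> \<not> P (Suc k)"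
proof (rule ccontr)
  assume "\<not> ?thesis"
  then have step: "P (Suc k)" if "q \<le> k" "k < p" "P k" for k using that by blast
  have "P m" if "q \<le> m" "m \<le> p" for m
    using that by (induction m rule: dec_induct) (use assms step in auto)
  then show False using assms by simp
qed

text \<open>Inside an arc below \<open>w\<close> but not below \<open>v\<close>, take a shortest
  non-inversion \<open>(q, p)\<close> of \<open>v\<close>. In \<open>v\<close> the points of
  \<open>U\<close> between \<open>q\<close> and \<open>p\<close> are above \<open>q\<close> and the
  others below \<open>p\<close>, so just below \<open>q\<close> the pattern strictly between
  alternates. A run of \<open>v\<close> at that level has both \<open>q\<close> and \<open>p\<close>
  in its window; occurring in \<open>w\<close>, it puts \<open>q\<close> above \<open>p\<close>,
  although \<open>(q, p)\<close> is an inversion of \<open>w\<close>.\<close>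

lemma lower_arcs_mono_runs:
  fixes s :: bool
  assumes w: "w permutes {1..n+1}" and v: "v permutes {1..n+1}"
    and eq: "runs (n + 1) (height v) \<subseteq> runs (n + 1) (height w)"
  defines "U \<equiv> {b. even b = s}"
  shows "lower_arcs n U w \<subseteq> lower_arcs n U v"
proof (rule ccontr)
  let ?x = "height v" and ?N = "n + 1"
  assume "\<not> lower_arcs n U w \<subseteq> lower_arcs n U v"
  then obtain a c where ac: "(a, c) \<in> lower_arcs n U w" "(a, c) \<notin> lower_arcs n U v" by auto
  then have vp: "(a, c) \<in> value_pairs n" and sub: "arc_inversions U a c \<subseteq> inversions n w"
    and "\<not> arc_inversions U a c \<subseteq> inversions n v"
    by (auto simp: lower_arcs_def)
  let ?I = "value_pairs n - inversions n v"
  have "arc_inversions (- (- U)) a c \<inter> ?I \<noteq> {}"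
    using \<open>\<not> arc_inversions U a c \<subseteq> inversions n v\<close> arc_inversions_subset[OF vp] by auto
  then obtain q p where qp: "(q, p) \<in> arc_inversions (- (- U)) a c" "(q, p) \<in> ?I"
    and down: "\<And>b. q < b \<Longrightarrow> b < p \<Longrightarrow> b \<in> - U \<Longrightarrow> (q, b) \<in> ?I \<and> (b, p) \<notin> ?I"
    and up: "\<And>b. q < b \<Longrightarrow> b < p \<Longrightarrow> b \<notin> - U \<Longrightarrow> (b, p) \<in> ?I \<and> (q, b) \<notin> ?I"
    using arc_inversions_minimal[OF biclosed_complement[OF biclosed_inversions]] by blast
  have b: "1 \<le> q" "q < p" "p \<le> ?N" using qp(2) by (auto simp: value_pairs_def)
  have vp': "(q, b) \<in> value_pairs n" "(b, p) \<in> value_pairs n" if "q < b" "b < p" for b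
    using b that by (auto simp: value_pairs_def)
  have xqp: "?x p < ?x q"
    using qp(2) height_inj[OF v, of p q] b by (auto simp: inversions_height)
  have low: "?x m < ?x p" if "q < m" "m < p" "m \<notin> U" for m
    using down[of m] that vp' by (auto simp: inversions_height)
  have hig: "?x q < ?x m" if "q < m" "m < p" "m \<in> U" for m
    using up[of m] that vp' by (auto simp: inversions_height)
  \<comment> \<open>Heights are integers, so \<open>t\<close> separates \<open>q\<close> from
    everything lower, \<open>p\<close> included, and is not itself a height.\<close>
  define t where "t = ?x q - 1 / 2"
  have t_nat: "t \<notin> ?x ` {1..?N}"
  proof
    assume "t \<in> ?x ` {1..?N}"
    then obtain m where "?x q - 1 / 2 = ?x m" unfolding t_def by blast
    then have "real (inv' v q) + 1 / 2 = real (inv' v m)" by (simp add: height_def)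
    then have "2 * inv' v q + 1 = 2 * inv' v m" by linarith
    then show False by presburger
  qed
  have xp: "?x p < t" using xqp by (simp add: t_def height_def)
  have xq: "t < ?x q" by (simp add: t_def)
  have inner: "t < ?x m \<longleftrightarrow> even m = s" if "q < m" "m < p" for m
    using low[OF that] hig[OF that] xp xq by (fastforce simp: U_def)
  obtain k where k: "q \<le> k" "k < p" "t < ?x k" "\<not> t < ?x (Suc k)"
    using ex_descent_between[of q p "\<lambda>m. t < ?x m"] b xp xq by fastforce
  then obtain \<rho> where r: "\<rho> \<in> arcs ?N" "covers \<rho> k" "t \<in> levels ?N ?x \<rho>"
    using ex_run_through[of k ?N t ?x] t_nat b by auto
  obtain i j u where e: "\<rho> = (i, j, u)" by (cases \<rho>)
  have ij: "1 \<le> i" "i \<le> k" "k < j" "j \<le> ?N" using r by (auto simp: e covers_def arcs_def)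
  have wl: "t < ?x m \<longleftrightarrow> high \<rho> m" if "m \<in> window ?N \<rho>" for m
    using levels_window(1)[OF r(3) that] .
  \<comment> \<open>A run starting later would have \<open>i - 1\<close> and \<open>i\<close> on the
    same side, while both lie strictly between \<open>q\<close> and \<open>p\<close>, where sides
    alternate.\<close>
  have iq: "i \<le> q + 1"
  proof (rule ccontr)
    assume n: "\<not> i \<le> q + 1"
    then have "i - 1 \<in> window ?N \<rho>" "i \<in> window ?N \<rho>" using ij by (auto simp: e window_def)
    moreover have "max i (min (i - 1) j) = i" "max i (min i j) = i" using ij by arith+
    then have "high \<rho> (i - 1) = high \<rho> i" by (simp add: e high_def)
    moreover from calculation have "(t < ?x (i - 1)) = (t < ?x i)" using wl by blast
    moreover have "q < i - 1" "i - 1 < p" "q < i" "i < p" using n ij k by linarith+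
    ultimately have "even (i - 1) = even i" using inner[of "i - 1"] inner[of i] by blast
    then show False using ij by simp
  qed
  have jp: "p \<le> j + 1"
  proof (rule ccontr)
    assume n: "\<not> p \<le> j + 1"
    then have "j + 1 \<in> window ?N \<rho>" "j \<in> window ?N \<rho>" using ij b by (auto simp: e window_def)
    moreover have "high \<rho> (j + 1) = high \<rho> j" using ij by (simp add: e high_def max_def min_def)
    moreover from calculation have "(t < ?x (j + 1)) = (t < ?x j)" using wl by blast
    moreover have "q < j + 1" "j + 1 < p" "q < j" "j < p" using n ij k by linarith+
    ultimately have "even (j + 1) = even j" using inner[of "j + 1"] inner[of j] by blast
    then show False by simp
  qed
  have qw: "q \<in> window ?N \<rho>" and pw: "p \<in> window ?N \<rho>"
    using iq jp ij k b by (auto simp: e window_def)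
  have "\<rho> \<in> runs ?N ?x" using r by (auto simp: runs_def)
  then have "\<rho> \<in> runs ?N (height w)" using eq by blast
  moreover have "high \<rho> q" "\<not> high \<rho> p" using wl[OF qw] wl[OF pw] xp xq by auto
  ultimately have "height w p < height w q" using runs_iff[OF r(1)] qw pw by blast
  moreover have "(q, p) \<in> inversions n w" using qp(1) sub by auto
  ultimately show False by (simp add: inversions_height)
qed

theorem arc_congruence_parity_iff:
  assumes w: "w permutes {1..n+1}" and v: "v permutes {1..n+1}"
  shows "(w, v) \<in> arc_congruence n {b. even b} \<inter> arc_congruence n {b. odd b} \<longleftrightarrow>
    runs (n + 1) (height w) = runs (n + 1) (height v)" (is "?L \<longleftrightarrow> ?R")
proof
  assume ?L
  then have "lower_arcs n {b. even b = s} w = lower_arcs n {b. even b = s} v" for s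
    by (cases s) (auto simp: arc_congruence_def)
  then have l: "lower_arcs n {b. even b = s} w = lower_arcs n {b. even b = s} v"
    "upper_arcs n {b. even b = s} w = upper_arcs n {b. even b = s} v" for s
    using lower_arcs_eq_iff_upper_arcs_eq by blast+
  have "\<rho> \<in> runs (n + 1) (height w) \<longleftrightarrow> \<rho> \<in> runs (n + 1) (height v)" if "\<rho> \<in> arcs (n + 1)" for \<rho>
  proof -
    obtain i j s where e: "\<rho> = (i, j, s)" by (cases \<rho>)
    show ?thesis
      using runs_height_iff[OF w that[unfolded e]] runs_height_iff[OF v that[unfolded e]]
      unfolding e l by simp
  qed
  then show ?R using runs_subset by blast
next
  assume ?R
  then have "lower_arcs n {b. even b = s} w = lower_arcs n {b. even b = s} v" for s
    using lower_arcs_mono_runs[OF w v] lower_arcs_mono_runs[OF v w] by blast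
  from this[of True] this[of False] show ?L using w v by (simp add: arc_congruence_def)
qed

section \<open>Counting faces\<close>

text \<open>Parts may be 0; the value 0 off \<open>A\<close> makes each function determined by its
  parts.\<close>

definition compositions :: "'b set \<Rightarrow> nat \<Rightarrow> ('b \<Rightarrow> nat) set" where
  "compositions A k = {f. (\<forall>a. a \<notin> A \<longrightarrow> f a = 0) \<and> sum f A = k}"

lemma bij_betw_compositions:
  assumes "finite A"
  shows "\<exists>g. bij_betw g (compositions A k) {l :: nat list. size l = card A \<and> sum_list l = k}"
proof -
  obtain xs where xs: "set xs = A" "distinct xs" using finite_distinct_list[OF assms] by blast
  then have len: "length xs = card A" using distinct_card by fastforce
  have inj: "inj_on (\<lambda>f. map f xs) (compositions A k)"
  proof (rule inj_onI)
    fix f g assume fg: "f \<in> compositions A k" "g \<in> compositions A k" "map f xs = map g xs"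
    show "f = g"
    proof
      fix a show "f a = g a" using fg xs by (cases "a \<in> A") (auto simp: compositions_def)
    qed
  qed
  have "(\<lambda>f. map f xs) ` compositions A k = {l. size l = card A \<and> sum_list l = k}"
  proof (intro equalityI subsetI)
    fix l assume "l \<in> (\<lambda>f. map f xs) ` compositions A k"
    then show "l \<in> {l. size l = card A \<and> sum_list l = k}"
      using xs len by (auto simp: compositions_def sum.distinct_set_conv_list)
  next
    fix l :: "nat list" assume l: "l \<in> {l. size l = card A \<and> sum_list l = k}"
    define f where "f a = (case map_of (zip xs l) a of None \<Rightarrow> 0 | Some v \<Rightarrow> v)" for a
    have "map f xs = l"
    proof (rule nth_equalityI)
      fix i assume "i < length (map f xs)"
      then show "map f xs ! i = l ! i"
        using l len xs by (simp add: f_def map_of_zip_nth)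
    qed (use l len in simp)
    moreover have "f a = 0" if "a \<notin> A" for a
      using that xs by (auto simp: f_def split: option.split dest!: map_of_SomeD set_zip_leftD)
    ultimately show "l \<in> (\<lambda>f. map f xs) ` compositions A k"
      using l xs by (intro image_eqI[of _ _ f]) (auto simp: compositions_def sum.distinct_set_conv_list)
  qed
  then show ?thesis using inj by (auto simp: bij_betw_def)
qed

lemma card_compositions:
  assumes "finite A"
  shows "card (compositions A k) = (k + card A - 1) choose k"
  using bij_betw_compositions[OF assms, of k] bij_betw_same_card card_length_sum_list by metis

lemma finite_lists_sum: "finite {l :: nat list. size l = m \<and> sum_list l = k}"
proof (rule finite_subset)
  show "{l :: nat list. size l = m \<and> sum_list l = k} \<subseteq> {l. set l \<subseteq> {..k} \<and> length l = m}"
    using member_le_sum_list by fastforce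
  show "finite {l. set l \<subseteq> {..k} \<and> length l = m}" by (rule finite_lists_length_eq) simp
qed

lemma finite_compositions: "finite A \<Longrightarrow> finite (compositions A k)"
  using bij_betw_compositions[of A k] bij_betw_finite finite_lists_sum by blast

text \<open>In the coordinates \<open>u\<close> the zigzag vector of a run becomes the root with 1
  at \<open>plus_end\<close> and -1 at \<open>minus_end\<close>; \<open>s\<close> gives the sign
  because it tells whether the even or the odd points are high.\<close>

definition plus_end :: "arc \<Rightarrow> nat" where
  "plus_end = (\<lambda>(i, j, s). if s then i else j)"

definition minus_end :: "arc \<Rightarrow> nat" where
  "minus_end = (\<lambda>(i, j, s). if s then j else i)"

abbreviation ends_at :: "arc \<Rightarrow> nat \<Rightarrow> real" where
  "ends_at \<rho> m \<equiv> of_bool (plus_end \<rho> = m) - of_bool (minus_end \<rho> = m)"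

abbreviation ends_upto :: "arc \<Rightarrow> nat \<Rightarrow> real" where
  "ends_upto \<rho> k \<equiv> of_bool (plus_end \<rho> \<le> k) - of_bool (minus_end \<rho> \<le> k)"

text \<open>Degenerate \<open>x\<close> are included: their run sets are the smaller faces, down to
  \<open>{}\<close> for a constant.\<close>

definition faces :: "nat \<Rightarrow> arc set set" where
  "faces N = range (runs N)"

lemma finite_faces: "finite (faces N)"
  by (rule finite_subset[of _ "Pow (arcs N)"]) (use runs_subset finite_arcs in \<open>auto simp: faces_def\<close>)

lemma face_finite: "F \<in> faces N \<Longrightarrow> finite F"
  using finite_runs by (auto simp: faces_def)

lemma face_subset_arcs: "F \<in> faces N \<Longrightarrow> F \<subseteq> arcs N"
  using runs_subset by (auto simp: faces_def)

lemma ends_in: "\<rho> \<in> arcs N \<Longrightarrow> plus_end \<rho> \<in> {1..N} \<and> minus_end \<rho> \<in> {1..N}"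
  by (auto simp: arcs_def plus_end_def minus_end_def)

text \<open>Were a point a positive end of one run and a negative end of another, the two runs would
  separate two points among it and its neighbours in opposite ways. So the roots of a face do not
  cancel in any coordinate.\<close>

lemma runs_ends_disjoint:
  assumes r: "\<rho> \<in> runs N x" and s: "\<sigma> \<in> runs N x"
  shows "plus_end \<rho> \<noteq> minus_end \<sigma>"
proof
  assume e: "plus_end \<rho> = minus_end \<sigma>"
  obtain i j u where er: "\<rho> = (i, j, u)" by (cases \<rho>)
  obtain i' j' v where es: "\<sigma> = (i', j', v)" by (cases \<sigma>)
  have b: "1 \<le> i" "i < j" "j \<le> N" "1 \<le> i'" "i' < j'" "j' \<le> N"
    using subsetD[OF runs_subset r] subsetD[OF runs_subset s] by (auto simp: er es arcs_def)
  have compat: False if "p \<in> window N \<rho>" "q \<in> window N \<rho>" "high \<rho> p \<noteq> high \<rho> q"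
    "high \<sigma> p \<noteq> high \<rho> p" "high \<sigma> q \<noteq> high \<rho> q" for p q
    using that runs_compatible[OF r s, of p q] runs_compatible[OF r s, of q p] by metis
  consider "i = j'" u v | "i = i'" u "\<not> v" | "j = j'" "\<not> u" v | "j = i'" "\<not> u" "\<not> v"
    using e by (auto simp: er es plus_end_def minus_end_def split: if_splits)
  then show False
  proof cases
    case 1
    then show False using b by (intro compat[of "i - 1" "i + 1"]) (auto simp: er es window_def high_def max_def min_def split: if_splits)
  next
    case 2
    then show False using b by (intro compat[of i "i + 1"]) (auto simp: er es window_def high_def max_def min_def split: if_splits)
  next
    case 3
    then show False using b by (intro compat[of j "j - 1"]) (auto simp: er es window_def high_def max_def min_def split: if_splits)
  next
    case 4
    then show False using b by (intro compat[of "j - 1" "j + 1"]) (auto simp: er es window_def high_def max_def min_def split: if_splits)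
  qed
qed

definition partial_sum :: "(nat \<Rightarrow> real) \<Rightarrow> nat \<Rightarrow> real" where
  "partial_sum u k = (\<Sum>i\<in>{1..k}. u i)"

text \<open>Recovers \<open>x\<close> from \<open>u\<close>, normalised to be 0 at 1: partial sums
  give \<open>y\<close>, and \<open>(-1) ^ k\<close> undoes the sign in \<open>y\<close>.\<close>

definition zigzag :: "(nat \<Rightarrow> real) \<Rightarrow> nat \<Rightarrow> real" where
  "zigzag u m = - (\<Sum>k\<in>{1..<m}. (-1) ^ k * partial_sum u k)"

lemma zigzag_step: "1 \<le> k \<Longrightarrow> zigzag u k - zigzag u (Suc k) = (-1) ^ k * partial_sum u k"
  by (simp add: zigzag_def)

lemma partial_sum_ends:
  assumes r: "\<rho> \<in> arcs N"
  shows "partial_sum (\<lambda>i. ends_at \<rho> i) k =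
    ends_upto \<rho> k"
proof -
  have "(\<Sum>i\<in>{1..k}. of_bool (p = i) :: real) = of_bool (p \<le> k)" if "1 \<le> p" for p
    using that by (simp add: of_bool_def sum.delta)
  then show ?thesis using ends_in[OF r] by (simp add: partial_sum_def sum_subtractf)
qed

text \<open>The run jumps by alternately 1 and -1 on its steps. The factor \<open>(-1) ^ k\<close>
  makes the jumps constant, and a constant on an interval is the partial sum of a vector supported
  at its two ends.\<close>

lemma high_step_ends:
  assumes r: "\<rho> \<in> arcs N"
  shows "gap \<rho> k (Suc k) =
    (-1) ^ k * (ends_upto \<rho> k :: real)"
proof -
  obtain i j s where e: "\<rho> = (i, j, s)" by (cases \<rho>)
  have ij: "1 \<le> i" "i < j" using r by (auto simp: e arcs_def)
  show ?thesis
  proof (cases "i \<le> k \<and> k < j")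
    case True
    then have "high \<rho> k \<longleftrightarrow> even k = s" "high \<rho> (Suc k) \<longleftrightarrow> odd k = s"
      by (simp_all add: e high_def max_def min_def)
    then show ?thesis using True by (cases s; cases "even k") (auto simp: e plus_end_def minus_end_def)
  next
    case False
    then have "high \<rho> k = high \<rho> (Suc k)" using high_Suc by (auto simp: e covers_def)
    then show ?thesis using False ij by (auto simp: e plus_end_def minus_end_def)
  qed
qed

lemma partial_sum_combination:
  assumes F: "finite F" "F \<subseteq> arcs N" and k: "k \<le> N"
    and u: "\<And>m. m \<in> {1..N} \<Longrightarrow> u m = (\<Sum>\<rho>\<in>F. \<mu> \<rho> * ends_at \<rho> m)"
  shows "partial_sum u k = (\<Sum>\<rho>\<in>F. \<mu> \<rho> * ends_upto \<rho> k)"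
proof -
  have "partial_sum u k = (\<Sum>m\<in>{1..k}. \<Sum>\<rho>\<in>F. \<mu> \<rho> * ends_at \<rho> m)"
    unfolding partial_sum_def using k u by (intro sum.cong) auto
  also have "\<dots> = (\<Sum>\<rho>\<in>F. \<mu> \<rho> * partial_sum (\<lambda>i. ends_at \<rho> i) k)"
    by (subst sum.swap) (simp add: partial_sum_def sum_distrib_left)
  also have "\<dots> = (\<Sum>\<rho>\<in>F. \<mu> \<rho> * ends_upto \<rho> k)"
    by (intro sum.cong refl) (simp only: partial_sum_ends[OF subsetD[OF F(2)]])
  finally show ?thesis .
qed

lemma sum_high_step:
  assumes F: "F \<subseteq> arcs N"
  shows "(\<Sum>\<rho>\<in>F. \<mu> \<rho> * gap \<rho> k (Suc k)) =
    (-1) ^ k * (\<Sum>\<rho>\<in>F. \<mu> \<rho> * ends_upto \<rho> k :: real)"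
  unfolding sum_distrib_left
proof (rule sum.cong[OF refl])
  fix \<rho> assume "\<rho> \<in> F"
  then have "\<rho> \<in> arcs N" using F by blast
  note e = high_step_ends[OF this, of k]
  show "\<mu> \<rho> * gap \<rho> k (Suc k) =
    (-1) ^ k * (\<mu> \<rho> * ends_upto \<rho> k)"
    unfolding e by (rule mult.left_commute)
qed

lemma zigzag_combination:
  assumes F: "finite F" "F \<subseteq> arcs N"
    and u: "\<And>m. m \<in> {1..N} \<Longrightarrow> u m = (\<Sum>\<rho>\<in>F. \<mu> \<rho> * ends_at \<rho> m)"
    and m: "m \<in> {1..N}" "m' \<in> {1..N}"
  shows "zigzag u m - zigzag u m' = (\<Sum>\<rho>\<in>F. \<mu> \<rho> * gap \<rho> m m')"
proof (rule gap_telescope[OF _ m])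
  fix k assume k: "1 \<le> k" "k < N"
  show "zigzag u k - zigzag u (Suc k) = (\<Sum>\<rho>\<in>F. \<mu> \<rho> * gap \<rho> k (Suc k))"
    unfolding zigzag_step[OF k(1)] sum_high_step[OF F(2)]
    using k partial_sum_combination[OF F _ u, of k] by simp
qed

text \<open>The points up to \<open>N\<close> see only the partial sums up to \<open>N - 1\<close>;
  the hypothesis on the total supplies the last one, where every \<open>ends_upto\<close> vanishes
  too.\<close>

lemma zigzag_combination_converse:
  assumes F: "finite F" "F \<subseteq> arcs N" and zero: "partial_sum u N = 0"
    and z: "\<And>m m'. m \<in> {1..N} \<Longrightarrow> m' \<in> {1..N} \<Longrightarrow>
      zigzag u m - zigzag u m' = (\<Sum>\<rho>\<in>F. \<mu> \<rho> * gap \<rho> m m')"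
    and m: "m \<in> {1..N}"
  shows "u m = (\<Sum>\<rho>\<in>F. \<mu> \<rho> * ends_at \<rho> m)"
proof -
  have ends: "1 \<le> plus_end \<rho>" "plus_end \<rho> \<le> N" "1 \<le> minus_end \<rho>" "minus_end \<rho> \<le> N" if "\<rho> \<in> F" for \<rho>
    using ends_in F that by fastforce+
  have ps: "partial_sum u k = (\<Sum>\<rho>\<in>F. \<mu> \<rho> * ends_upto \<rho> k)"
    if kN: "k \<le> N" for k
  proof -
    consider "k = 0" | "k = N" | "1 \<le> k" "k < N" using kN by linarith
    then show ?thesis
    proof cases
      case 1
      have "(\<Sum>\<rho>\<in>F. \<mu> \<rho> * ends_upto \<rho> k) = 0"
      proof (rule sum.neutral, rule ballI)
        fix \<rho> assume "\<rho> \<in> F"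
        then show "\<mu> \<rho> * ends_upto \<rho> k = 0"
          using ends[of \<rho>] 1 by simp
      qed
      then show ?thesis using 1 by (simp add: partial_sum_def)
    next
      case 2
      have "(\<Sum>\<rho>\<in>F. \<mu> \<rho> * ends_upto \<rho> k) = 0"
      proof (rule sum.neutral, rule ballI)
        fix \<rho> assume "\<rho> \<in> F"
        then show "\<mu> \<rho> * ends_upto \<rho> k = 0"
          using ends[of \<rho>] 2 by simp
      qed
      then show ?thesis using 2 zero by simp
    next
      case 3
      have "(-1) ^ k * partial_sum u k = (\<Sum>\<rho>\<in>F. \<mu> \<rho> * gap \<rho> k (Suc k))"
        using zigzag_step[OF 3(1), of u] z[of k "Suc k"] 3 by simp
      also have "\<dots> = (-1) ^ k * (\<Sum>\<rho>\<in>F. \<mu> \<rho> * ends_upto \<rho> k)"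
        by (rule sum_high_step[OF F(2)])
      finally show ?thesis by simp
    qed
  qed
  have m1: "1 \<le> m" "m \<le> N" "m - 1 \<le> N" using m by auto
  have "u m = partial_sum u m - partial_sum u (m - 1)"
    using m1 by (cases m) (simp_all add: partial_sum_def)
  also have "\<dots> = (\<Sum>\<rho>\<in>F. \<mu> \<rho> * ends_at \<rho> m)"
    unfolding ps[OF m1(2)] ps[OF m1(3)] sum_subtractf[symmetric]
  proof (rule sum.cong[OF refl])
    fix \<rho> assume "\<rho> \<in> F"
    have d: "of_bool (p \<le> m) - of_bool (p \<le> m - 1) = (of_bool (p = m) :: real)" for p
      using m1 by auto
    show "\<mu> \<rho> * ends_upto \<rho> m -
      \<mu> \<rho> * ends_upto \<rho> (m - 1) =
      \<mu> \<rho> * ends_at \<rho> m"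
      unfolding d[symmetric] by (simp add: algebra_simps)
  qed
  finally show ?thesis .
qed

text \<open>A positive weight is a difference of two values of \<open>x\<close>. This is the
  unimodularity of the triangulation: lattice points have integral coefficients.\<close>

lemma weight_integer:
  assumes "\<rho> \<in> arcs N" and "\<And>m. x m \<in> \<int>"
  shows "weight N x \<rho> \<in> \<int>"
proof -
  let ?L = "x ` {l \<in> window N \<rho>. \<not> high \<rho> l}" and ?H = "x ` {h \<in> window N \<rho>. high \<rho> h}"
  have f: "finite ?L" "?L \<noteq> {}" "finite ?H" "?H \<noteq> {}"
    using window_nonempty[OF assms(1)] finite_window by auto
  have "Max ?L \<in> ?L" "Min ?H \<in> ?H" using f Max_in Min_in by blast+
  then have "Max ?L \<in> \<int>" "Min ?H \<in> \<int>" using assms(2) by auto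
  then show ?thesis unfolding weight_eq[OF assms(1)] max_def by auto
qed

text \<open>
  A pair of functions with equal sums is split into its common part and a difference; the
  latter is an integral point of the fan, hence a unique positive combination over a face.
\<close>

definition face_split :: "nat \<Rightarrow> arc set \<times> (arc + nat \<Rightarrow> nat) \<Rightarrow> (nat \<Rightarrow> nat) \<times> (nat \<Rightarrow> nat)" where
  "face_split N = (\<lambda>(F, f).
    (\<lambda>m. f (Inr m) + (\<Sum>\<rho>\<in>{\<rho>\<in>F. plus_end \<rho> = m}. Suc (f (Inl \<rho>))),
     \<lambda>m. f (Inr m) + (\<Sum>\<rho>\<in>{\<rho>\<in>F. minus_end \<rho> = m}. Suc (f (Inl \<rho>)))))"

text \<open>The value at \<open>Inl \<rho>\<close> is the coefficient of \<open>\<rho>\<close> minus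
  1, the value at \<open>Inr m\<close> the common part at \<open>m\<close>. With the ones taken off,
  every composition of \<open>k - card F\<close> is allowed, so the count depends on
  \<open>card F\<close> alone.\<close>

definition face_data :: "nat \<Rightarrow> nat \<Rightarrow> (arc set \<times> (arc + nat \<Rightarrow> nat)) set" where
  "face_data N k = (SIGMA F : {F \<in> faces N. card F \<le> k}. compositions (F <+> {1..N}) (k - card F))"

lemma sum_fibres:
  assumes "finite F" "\<And>\<rho>. \<rho> \<in> F \<Longrightarrow> g \<rho> \<in> A" "finite A"
  shows "(\<Sum>m\<in>A. \<Sum>\<rho>\<in>{\<rho>\<in>F. g \<rho> = m}. h \<rho>) = sum h F"
  using assms by (intro sum.group) auto

lemma face_split_difference:
  assumes "finite F"
  shows "real (fst (face_split N (F, f)) m) - real (snd (face_split N (F, f)) m) =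
    (\<Sum>\<rho>\<in>F. real (Suc (f (Inl \<rho>))) * ends_at \<rho> m)"
proof -
  have "(\<Sum>\<rho>\<in>{\<rho>\<in>F. g \<rho> = m}. h \<rho>) = (\<Sum>\<rho>\<in>F. h \<rho> * of_bool (g \<rho> = m))"
    for g :: "arc \<Rightarrow> nat" and h :: "arc \<Rightarrow> real"
  proof -
    have "(\<Sum>\<rho>\<in>{\<rho>\<in>F. g \<rho> = m}. h \<rho>) = (\<Sum>\<rho>\<in>F. if g \<rho> = m then h \<rho> else 0)"
      using assms by (simp add: sum.If_cases Int_def)
    also have "\<dots> = (\<Sum>\<rho>\<in>F. h \<rho> * of_bool (g \<rho> = m))" by (intro sum.cong) auto
    finally show ?thesis .
  qed
  then show ?thesis
    by (simp add: face_split_def right_diff_distrib sum_subtractf)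
qed

text \<open>The difference of the two functions is a combination of the roots of \<open>F\<close>;
  its zigzag function has run set \<open>F\<close> and the coefficients as weights, whence
  injectivity. Conversely every difference expands in this way, and what is left over is the common
  part.\<close>

lemma bij_betw_face_split:
  "bij_betw (face_split N) (face_data N k) (compositions {1..N} k \<times> compositions {1..N} k)"
  unfolding bij_betw_def
proof (intro conjI equalityI subsetI)
  show "inj_on (face_split N) (face_data N k)"
  proof (rule inj_onI)
    fix p p' assume p: "p \<in> face_data N k" and p': "p' \<in> face_data N k"
      and eq: "face_split N p = face_split N p'"
    obtain F f F' f' where e: "p = (F, f)" "p' = (F', f')" by (cases p, cases p')
    have F: "F \<in> faces N" "F' \<in> faces N" using p p' by (auto simp: face_data_def e)
    define u where "u m = real (fst (face_split N (F, f)) m) - real (snd (face_split N (F, f)) m)" for m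
    have u: "u m = (\<Sum>\<rho>\<in>F. real (Suc (f (Inl \<rho>))) * ends_at \<rho> m)" for m
      unfolding u_def using face_split_difference face_finite[OF F(1)] by blast
    have u': "u m = (\<Sum>\<rho>\<in>F'. real (Suc (f' (Inl \<rho>))) * ends_at \<rho> m)" for m
      unfolding u_def eq[unfolded e] using face_split_difference face_finite[OF F(2)] by blast
    have runs: "runs N (zigzag u) = G \<and> (\<forall>\<rho>\<in>G. weight N (zigzag u) \<rho> = real (Suc (g (Inl \<rho>))))"
      if G: "G \<in> faces N" and ug: "\<And>m. u m = (\<Sum>\<rho>\<in>G. real (Suc (g (Inl \<rho>))) *
        (ends_at \<rho> m))" for G g
    proof -
      obtain x0 where x0: "G \<subseteq> runs N x0" using G by (auto simp: faces_def)
      note z = zigzag_combination[OF face_finite[OF G] face_subset_arcs[OF G], of u "\<lambda>\<rho>. real (Suc (g (Inl \<rho>)))", OF ug]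
      show ?thesis
        using runs_combination[OF x0, of "\<lambda>\<rho>. real (Suc (g (Inl \<rho>)))" "zigzag u"] z by auto
    qed
    have FF: "F = F'" using runs[OF F(1) u] runs[OF F(2) u'] by simp
    have l: "f (Inl \<rho>) = f' (Inl \<rho>)" if "\<rho> \<in> F" for \<rho>
      using runs[OF F(1) u] runs[OF F(2) u'] that FF by (metis of_nat_eq_iff Suc_inject)
    have "f c = f' c" for c
    proof (cases c)
      case (Inl \<rho>)
      show ?thesis
      proof (cases "\<rho> \<in> F")
        case False
        then have "c \<notin> F <+> {1..N}" "c \<notin> F' <+> {1..N}" using Inl FF by auto
        moreover have "f \<in> compositions (F <+> {1..N}) (k - card F)" "f' \<in> compositions (F' <+> {1..N}) (k - card F')"
          using p p' by (simp_all add: face_data_def e)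
        ultimately show ?thesis unfolding compositions_def by simp
      qed (use l Inl in simp)
    next
      case (Inr m)
      have "fst (face_split N (F, f)) m = fst (face_split N (F', f')) m" using eq e by simp
      moreover have "(\<Sum>\<rho>\<in>{\<rho>\<in>F. plus_end \<rho> = m}. Suc (f (Inl \<rho>))) = (\<Sum>\<rho>\<in>{\<rho>\<in>F. plus_end \<rho> = m}. Suc (f' (Inl \<rho>)))"
        using l by (intro sum.cong) auto
      ultimately show ?thesis using Inr FF by (simp add: face_split_def)
    qed
    then show "p = p'" using FF e by auto
  qed
next
  fix q assume "q \<in> face_split N ` face_data N k"
  then obtain F f where q: "q = face_split N (F, f)" and p: "(F, f) \<in> face_data N k" by auto
  have F: "F \<in> faces N" "card F \<le> k" "f \<in> compositions (F <+> {1..N}) (k - card F)"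
    using p by (auto simp: face_data_def)
  have fin: "finite F" using face_finite F by blast
  have f0: "f (Inr m) = 0" if "m \<notin> {1..N}" for m
    using F(3) that by (auto simp: compositions_def)
  have tot: "(\<Sum>\<rho>\<in>F. f (Inl \<rho>)) + (\<Sum>m\<in>{1..N}. f (Inr m)) = k - card F"
    using F(3) fin by (simp add: compositions_def sum.Plus)
  have comp: "(\<lambda>m. f (Inr m) + (\<Sum>\<rho>\<in>{\<rho>\<in>F. g \<rho> = m}. Suc (f (Inl \<rho>)))) \<in> compositions {1..N} k"
    if g: "\<And>\<rho>. \<rho> \<in> F \<Longrightarrow> g \<rho> \<in> {1..N}" for g
  proof -
    have "(\<Sum>m\<in>{1..N}. f (Inr m) + (\<Sum>\<rho>\<in>{\<rho>\<in>F. g \<rho> = m}. Suc (f (Inl \<rho>)))) =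
        (\<Sum>m\<in>{1..N}. f (Inr m)) + (\<Sum>\<rho>\<in>F. Suc (f (Inl \<rho>)))"
      unfolding sum.distrib using sum_fibres[OF fin, of g "{1..N}"] g by simp
    also have "(\<Sum>\<rho>\<in>F. Suc (f (Inl \<rho>))) = (\<Sum>\<rho>\<in>F. f (Inl \<rho>)) + card F"
      by (simp only: Suc_eq_plus1 sum.distrib card_eq_sum)
    finally have "(\<Sum>m\<in>{1..N}. f (Inr m) + (\<Sum>\<rho>\<in>{\<rho>\<in>F. g \<rho> = m}. Suc (f (Inl \<rho>)))) = k"
      using tot F(2) by linarith
    moreover have "f (Inr m) + (\<Sum>\<rho>\<in>{\<rho>\<in>F. g \<rho> = m}. Suc (f (Inl \<rho>))) = 0" if "m \<notin> {1..N}" for m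
    proof -
      have "{\<rho>\<in>F. g \<rho> = m} = {}" using g that by auto
      then show ?thesis using f0[OF that] by (simp only: sum.empty)
    qed
    ultimately show ?thesis unfolding compositions_def by blast
  qed
  have "plus_end \<rho> \<in> {1..N} \<and> minus_end \<rho> \<in> {1..N}" if "\<rho> \<in> F" for \<rho>
    using ends_in face_subset_arcs[OF F(1)] that by blast
  then show "q \<in> compositions {1..N} k \<times> compositions {1..N} k"
    using comp[of plus_end] comp[of minus_end] unfolding q by (simp add: face_split_def)
next
  fix q assume "q \<in> compositions {1..N} k \<times> compositions {1..N} k"
  then obtain \<alpha> \<beta> where q: "q = (\<alpha>, \<beta>)" and a: "\<alpha> \<in> compositions {1..N} k" and b: "\<beta> \<in> compositions {1..N} k"
    by auto
  define u where "u m = real (\<alpha> m) - real (\<beta> m)" for m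
  let ?z = "zigzag u"
  define F where "F = runs N ?z"
  have F: "F \<in> faces N" "finite F" "F \<subseteq> arcs N"
    using finite_runs runs_subset by (auto simp: F_def faces_def)
  have zero: "partial_sum u N = 0"
  proof -
    have "partial_sum u N = real (sum \<alpha> {1..N}) - real (sum \<beta> {1..N})"
      by (simp add: partial_sum_def u_def sum_subtractf)
    then show ?thesis using a b unfolding compositions_def by (simp del: of_nat_sum)
  qed
  have "partial_sum u j \<in> \<int>" for j unfolding partial_sum_def u_def by (intro Ints_sum Ints_diff Ints_of_nat)
  then have zint: "?z m \<in> \<int>" for m
    unfolding zigzag_def by (intro Ints_minus Ints_sum Ints_mult Ints_power) auto
  define \<mu> where "\<mu> \<rho> = nat \<lfloor>weight N ?z \<rho>\<rfloor>" for \<rho>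
  have mu: "real (\<mu> \<rho>) = weight N ?z \<rho>" "\<mu> \<rho> > 0" if "\<rho> \<in> F" for \<rho>
  proof -
    have r: "\<rho> \<in> arcs N" using that F by blast
    have "weight N ?z \<rho> \<in> \<int>" by (rule weight_integer[OF r]) (rule zint)
    then obtain c where c: "weight N ?z \<rho> = of_int c" by (auto elim: Ints_cases)
    have "weight N ?z \<rho> > 0" using weight_pos_iff[OF r] that by (simp add: F_def)
    then show "real (\<mu> \<rho>) = weight N ?z \<rho>" "\<mu> \<rho> > 0" using c by (auto simp: \<mu>_def)
  qed
  have um: "u m = (\<Sum>\<rho>\<in>F. weight N ?z \<rho> * ends_at \<rho> m)"
    if "m \<in> {1..N}" for m
    by (rule zigzag_combination_converse[OF F(2,3) zero _ that]) (simp add: F_def weight_expansion)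
  let ?S = "\<lambda>g m. \<Sum>\<rho>\<in>{\<rho>\<in>F. g \<rho> = m}. \<mu> \<rho>"
  \<comment> \<open>On \<open>F\<close> the coefficient is lowered by 1 to make up for the
    \<open>Suc\<close> in \<open>face_split\<close>; off \<open>F\<close> the difference is 0, as a
    composition requires.\<close>
  define f where "f = case_sum (\<lambda>\<rho>. \<mu> \<rho> - (if \<rho> \<in> F then 1 else \<mu> \<rho>)) (\<lambda>m. \<alpha> m - ?S plus_end m)"
  have Suc_f: "Suc (f (Inl \<rho>)) = \<mu> \<rho>" if "\<rho> \<in> F" for \<rho> using mu(2)[OF that] that by (simp add: f_def)
  have diff: "int (\<alpha> m) - int (\<beta> m) = int (?S plus_end m) - int (?S minus_end m)" if m: "m \<in> {1..N}" for m
  proof -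
    have "fst (face_split N (F, f)) m = f (Inr m) + ?S plus_end m"
      "snd (face_split N (F, f)) m = f (Inr m) + ?S minus_end m"
      using Suc_f by (simp_all add: face_split_def)
    then have "real (?S plus_end m) - real (?S minus_end m) =
        (\<Sum>\<rho>\<in>F. real (Suc (f (Inl \<rho>))) * ends_at \<rho> m)"
      using face_split_difference[OF F(2), of N f m] by simp
    also have "\<dots> = u m" unfolding um[OF m] using Suc_f mu(1) by (intro sum.cong) auto
    finally have "real_of_int (int (?S plus_end m) - int (?S minus_end m)) = real_of_int (int (\<alpha> m) - int (\<beta> m))"
      by (simp add: u_def)
    then show ?thesis unfolding of_int_eq_iff by simp
  qed
  \<comment> \<open>As no point is both kinds of end, the two sums are the positive and the negative
    part of \<open>\<alpha> m - \<beta> m\<close>; hence the truncated subtraction in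
    \<open>f\<close> is exact.\<close>
  have disj: "?S plus_end m = 0 \<or> ?S minus_end m = 0" for m
  proof (cases "\<exists>\<rho>\<in>F. plus_end \<rho> = m")
    case True
    then have "{\<rho>\<in>F. minus_end \<rho> = m} = {}" using runs_ends_disjoint unfolding F_def by fastforce
    then show ?thesis by (simp only: sum.empty simp_thms)
  next
    case False
    then have "{\<rho>\<in>F. plus_end \<rho> = m} = {}" by auto
    then show ?thesis by (simp only: sum.empty simp_thms)
  qed
  have out: "?S plus_end m = 0" "?S minus_end m = 0" "\<alpha> m = 0" "\<beta> m = 0" if "m \<notin> {1..N}" for m
  proof -
    have "{\<rho>\<in>F. plus_end \<rho> = m} = {}" "{\<rho>\<in>F. minus_end \<rho> = m} = {}" using ends_in F(3) that by fastforce+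
    then show "?S plus_end m = 0" "?S minus_end m = 0" by (simp_all only: sum.empty)
    show "\<alpha> m = 0" "\<beta> m = 0" using a b that by (auto simp: compositions_def)
  qed
  have \<alpha>: "f (Inr m) + ?S plus_end m = \<alpha> m" and \<beta>: "f (Inr m) + ?S minus_end m = \<beta> m" for m
  proof -
    have "int (\<alpha> m) - int (\<beta> m) = int (?S plus_end m) - int (?S minus_end m)"
      using diff[of m] out[of m] by (cases "m \<in> {1..N}") simp_all
    moreover have "a - p + p = a \<and> a - p + q = b" if "int a - int b = int p - int q" "p = 0 \<or> q = 0" for a b p q
      using that by linarith
    ultimately have "\<alpha> m - ?S plus_end m + ?S plus_end m = \<alpha> m \<and> \<alpha> m - ?S plus_end m + ?S minus_end m = \<beta> m"
      using disj[of m] by blast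
    moreover have "f (Inr m) = \<alpha> m - ?S plus_end m" by (simp only: f_def sum.case)
    ultimately show "f (Inr m) + ?S plus_end m = \<alpha> m" "f (Inr m) + ?S minus_end m = \<beta> m"
      by (simp_all only:)
  qed
  have fs: "face_split N (F, f) = q"
    using Suc_f \<alpha> \<beta> unfolding q by (simp add: face_split_def)
  have "k = (\<Sum>m\<in>{1..N}. f (Inr m) + ?S plus_end m)" using a \<alpha> by (simp add: compositions_def)
  also have "\<dots> = (\<Sum>m\<in>{1..N}. f (Inr m)) + sum \<mu> F"
  proof -
    have "plus_end \<rho> \<in> {1..N}" if "\<rho> \<in> F" for \<rho> using ends_in F(3) that by blast
    then show ?thesis unfolding sum.distrib using sum_fibres[OF F(2), of plus_end "{1..N}" \<mu>] by simp
  qed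
  also have "sum \<mu> F = (\<Sum>\<rho>\<in>F. f (Inl \<rho>) + 1)" using Suc_f by (intro sum.cong) auto
  also have "\<dots> = (\<Sum>\<rho>\<in>F. f (Inl \<rho>)) + card F" by (simp only: sum.distrib card_eq_sum)
  finally have k: "k = (\<Sum>m\<in>{1..N}. f (Inr m)) + ((\<Sum>\<rho>\<in>F. f (Inl \<rho>)) + card F)" .
  have "f \<in> compositions (F <+> {1..N}) (k - card F)"
  proof -
    have "f c = 0" if "c \<notin> F <+> {1..N}" for c
    proof (cases c)
      case (Inl \<rho>)
      then show ?thesis using that by (auto simp: f_def)
    next
      case (Inr m)
      then have "m \<notin> {1..N}" using that by blast
      then show ?thesis using Inr out(3)[of m] by (simp add: f_def)
    qed
    then show ?thesis using k F(2) by (simp add: compositions_def sum.Plus)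
  qed
  then have "(F, f) \<in> face_data N k" using F(1) k by (auto simp: face_data_def)
  then show "q \<in> face_split N ` face_data N k" using fs by (metis image_eqI)
qed

text \<open>As \<open>card F\<close> grows, the total \<open>k - card F\<close> falls and the number
  \<open>card F + n + 1\<close> of parts rises equally, so all binomials have top entry
  \<open>n + k\<close>. Faces with more than \<open>k\<close> elements contribute 0.\<close>

lemma sum_faces_binomial:
  "(\<Sum>F\<in>faces (n + 1). (n + k) choose (n + card F)) = ((n + k) choose n)\<^sup>2"
proof -
  let ?N = "n + 1"
  let ?A = "{F \<in> faces ?N. card F \<le> k}"
  have finA: "finite ?A" using finite_faces by auto
  have "card (face_data ?N k) = (\<Sum>F\<in>?A. card (compositions (F <+> {1..?N}) (k - card F)))"
    unfolding face_data_def using finA face_finite by (intro card_SigmaI ballI finite_compositions) auto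
  also have "\<dots> = (\<Sum>F\<in>?A. (n + k) choose (n + card F))"
  proof (rule sum.cong[OF refl])
    fix F assume F: "F \<in> ?A"
    then have fin: "finite F" using face_finite by blast
    have "card (compositions (F <+> {1..?N}) (k - card F)) = (k - card F + (card F + ?N) - 1) choose (k - card F)"
      using fin by (simp add: card_compositions card_Plus)
    also have "k - card F + (card F + ?N) - 1 = n + k" using F by simp
    also have "(n + k) choose (k - card F) = (n + k) choose (n + card F)"
      using F binomial_symmetric[of "n + card F" "n + k"] by simp
    finally show "card (compositions (F <+> {1..?N}) (k - card F)) = (n + k) choose (n + card F)" .
  qed
  also have "\<dots> = (\<Sum>F\<in>faces ?N. (n + k) choose (n + card F))"
    using finite_faces by (intro sum.mono_neutral_left) (auto simp: binomial_eq_0)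
  finally have "card (face_data ?N k) = (\<Sum>F\<in>faces ?N. (n + k) choose (n + card F))" .
  moreover have "card (face_data ?N k) = (card (compositions {1..?N} k))\<^sup>2"
    using bij_betw_same_card[OF bij_betw_face_split] by (simp add: card_cartesian_product power2_eq_square)
  moreover have "card (compositions {1..?N} k) = (n + k) choose n"
    using binomial_symmetric[of k "n + k"] by (simp add: card_compositions add.commute)
  ultimately show ?thesis by simp
qed

text \<open>Vandermonde with the range cut at \<open>n\<close> instead of \<open>k\<close>; the
  condition is there because \<open>k choose (k - j)\<close> would be 1 for
  \<open>j > k\<close>.\<close>

lemma vandermonde_if:
  "(\<Sum>j\<le>n. if j \<le> k then (n choose j) * (k choose (k - j)) else 0) = (n + k) choose k"
proof -
  have "(\<Sum>j\<le>n. if j \<le> k then (n choose j) * (k choose (k - j)) else 0) =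
      (\<Sum>j\<in>{..n} \<inter> {..k}. (n choose j) * (k choose (k - j)))"
    by (simp add: sum.If_cases Int_def)
  also have "\<dots> = (\<Sum>j\<le>k. (n choose j) * (k choose (k - j)))"
    by (intro sum.mono_neutral_left) (auto simp: binomial_eq_0)
  also have "\<dots> = (n + k) choose k" by (rule vandermonde)
  finally show ?thesis .
qed

text \<open>The expected face numbers satisfy the identity of the face count: the product of
  \<open>(n + k) choose (n + j)\<close> and \<open>(n + j) choose n\<close> equals
  \<open>((n + k) choose n) * (k choose j)\<close> for \<open>j \<le> k\<close>, and the rest is
  Vandermonde.\<close>

lemma vandermonde_square:
  "(\<Sum>j\<le>n. ((n + j) choose j) * (n choose j) * ((n + k) choose (n + j))) = ((n + k) choose n)\<^sup>2"
proof -
  have "((n + j) choose j) * (n choose j) * ((n + k) choose (n + j)) =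
      ((n + k) choose n) * ((n choose j) * (k choose (k - j)))" if "j \<le> k" for j
  proof -
    have "((n + k) choose (n + j)) * ((n + j) choose n) = ((n + k) choose n) * ((n + k - n) choose (n + j - n))"
      by (rule choose_mult) (use that in auto)
    moreover have "(n + j) choose n = (n + j) choose j" using binomial_symmetric[of n "n + j"] by simp
    moreover have "k choose j = k choose (k - j)" using that by (rule binomial_symmetric)
    ultimately show ?thesis by (simp add: mult_ac)
  qed
  then have e: "((n + j) choose j) * (n choose j) * ((n + k) choose (n + j)) =
      ((n + k) choose n) * (if j \<le> k then (n choose j) * (k choose (k - j)) else 0)" for j
    by (cases "j \<le> k") (auto simp: binomial_eq_0)
  have "(\<Sum>j\<le>n. if j \<le> k then (n choose j) * (k choose (k - j)) else 0) = (n + k) choose n"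
    unfolding vandermonde_if using binomial_symmetric[of k "n + k"] by simp
  then show ?thesis unfolding e sum_distrib_left[symmetric] by (simp add: power2_eq_square)
qed

theorem card_faces:
  assumes "j \<le> n"
  shows "card {F \<in> faces (n + 1). card F = j} = ((n + j) choose j) * (n choose j)"
  using assms
proof (induction j rule: less_induct)
  case (less k)
  let ?f = "\<lambda>j. card {F \<in> faces (n + 1). card F = j}" and ?g = "\<lambda>j. ((n + j) choose j) * (n choose j)"
  have "(\<Sum>F\<in>faces (n + 1). (n + k) choose (n + card F)) =
      (\<Sum>F\<in>{F \<in> faces (n + 1). card F \<le> k}. (n + k) choose (n + card F))"
    using finite_faces by (intro sum.mono_neutral_right) (auto simp: binomial_eq_0)
  also have "\<dots> = (\<Sum>j\<le>k. \<Sum>F\<in>{F \<in> {F \<in> faces (n + 1). card F \<le> k}. card F = j}. (n + k) choose (n + card F))"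
    using finite_faces by (intro sum_fibres[symmetric]) auto
  also have "\<dots> = (\<Sum>j\<le>k. ?f j * ((n + k) choose (n + j)))"
  proof (rule sum.cong[OF refl])
    fix j assume "j \<in> {..k}"
    then have "{F \<in> {F \<in> faces (n + 1). card F \<le> k}. card F = j} = {F \<in> faces (n + 1). card F = j}" by auto
    then show "(\<Sum>F\<in>{F \<in> {F \<in> faces (n + 1). card F \<le> k}. card F = j}. (n + k) choose (n + card F)) =
        ?f j * ((n + k) choose (n + j))" by simp
  qed
  finally have 1: "(\<Sum>j\<le>k. ?f j * ((n + k) choose (n + j))) = ((n + k) choose n)\<^sup>2"
    using sum_faces_binomial by metis
  have 2: "(\<Sum>j\<le>k. ?g j * ((n + k) choose (n + j))) = ((n + k) choose n)\<^sup>2"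
    unfolding vandermonde_square[symmetric] using less.prems
    by (intro sum.mono_neutral_left) (auto simp: binomial_eq_0)
  have split: "(\<Sum>j\<le>k. h j * ((n + k) choose (n + j))) = (\<Sum>j<k. h j * ((n + k) choose (n + j))) + h k" for h
    by (simp flip: lessThan_Suc_atMost)
  have "(\<Sum>j<k. ?f j * ((n + k) choose (n + j))) = (\<Sum>j<k. ?g j * ((n + k) choose (n + j)))"
    using less by (intro sum.cong) auto
  then show ?case using 1 2 unfolding split by linarith
qed

section \<open>The geometry of the fan\<close>

text \<open>Passing to a point with fewer strict inequalities can only lose runs; this compares the
  boundary of a chamber with its interior.\<close>

lemma runs_mono:
  assumes "\<And>l h. l \<in> {1..N} \<Longrightarrow> h \<in> {1..N} \<Longrightarrow> x l < x h \<Longrightarrow> y l < y h"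
  shows "runs N x \<subseteq> runs N y"
proof
  fix \<rho> assume r: "\<rho> \<in> runs N x"
  then have a: "\<rho> \<in> arcs N" using runs_subset by blast
  have "x l < x h" if "h \<in> window N \<rho>" "l \<in> window N \<rho>" "high \<rho> h" "\<not> high \<rho> l" for h l
    using r that unfolding runs_iff[OF a] by blast
  then show "\<rho> \<in> runs N y" unfolding runs_iff[OF a] using assms window_subset[of N \<rho>] by blast
qed

lemma runs_cong:
  assumes "\<And>l h. l \<in> {1..N} \<Longrightarrow> h \<in> {1..N} \<Longrightarrow> x l < x h \<longleftrightarrow> y l < y h"
  shows "runs N x = runs N y"
  using runs_mono[of N x y] runs_mono[of N y x] assms by blast

text \<open>The sum of the indicator functions over \<open>G\<close> is a positive combination over
  part of a run set, hence has exactly \<open>G\<close> as its runs.\<close>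

lemma face_subset:
  assumes "F \<in> faces N" "G \<subseteq> F"
  shows "G \<in> faces N"
proof -
  obtain x0 where x0: "F = runs N x0" using assms by (auto simp: faces_def)
  define x where "x m = (\<Sum>\<rho>\<in>G. of_bool (high \<rho> m) :: real)" for m
  have "runs N x = G"
    by (rule runs_combination(1)[of G N x0 "\<lambda>_. 1"]) (use assms x0 in \<open>auto simp: x_def sum_subtractf\<close>)
  then show ?thesis by (auto simp: faces_def)
qed

lemma ex_perturbation:
  fixes y h :: "nat \<Rightarrow> real"
  shows "\<exists>\<epsilon>>0. \<forall>p \<in> {1..N}. \<forall>q \<in> {1..N}. y p < y q \<longrightarrow> y p + \<epsilon> * h p < y q + \<epsilon> * h q"
proof -
  have ev: "\<forall>\<^sub>F \<epsilon> in at_right 0. y p < y q \<longrightarrow> y p + \<epsilon> * h p < y q + \<epsilon> * h q" for p q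
  proof (cases "y p < y q")
    case True
    have "((\<lambda>\<epsilon>. (y q + \<epsilon> * h q) - (y p + \<epsilon> * h p)) \<longlongrightarrow> (y q + 0 * h q) - (y p + 0 * h p)) (at_right 0)"
      by (intro tendsto_intros)
    then have "\<forall>\<^sub>F \<epsilon> in at_right 0. 0 < (y q + \<epsilon> * h q) - (y p + \<epsilon> * h p)"
      using True by (intro order_tendstoD(1)) auto
    then show ?thesis by (rule eventually_mono) simp
  qed simp
  have "\<forall>\<^sub>F \<epsilon> in at_right (0::real). \<forall>p \<in> {1..N}. \<forall>q \<in> {1..N}. y p < y q \<longrightarrow> y p + \<epsilon> * h p < y q + \<epsilon> * h q"
    by (intro eventually_ball_finite finite_atLeastAtMost ballI ev)
  moreover have "\<forall>\<^sub>F \<epsilon> in at_right (0::real). 0 < \<epsilon>" by (rule eventually_at_right_less)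
  ultimately have "\<forall>\<^sub>F \<epsilon> in at_right (0::real). 0 < \<epsilon> \<and> (\<forall>p \<in> {1..N}. \<forall>q \<in> {1..N}. y p < y q \<longrightarrow> y p + \<epsilon> * h p < y q + \<epsilon> * h q)"
    by (rule eventually_conj[rotated])
  then show ?thesis using eventually_happens trivial_limit_at_right_real by blast
qed

text \<open>Ties of \<open>y\<close> are broken by a small multiple of \<open>h\<close>. Any
  injective \<open>h\<close> leads to some chamber containing \<open>y\<close>; the height of a
  permutation leads to one in the class of that permutation when \<open>y\<close> lies in its
  cone.\<close>

lemma ex_perturbed_permutation:
  fixes y h :: "nat \<Rightarrow> real"
  assumes inj: "inj_on h {1..n+1}"
  shows "\<exists>w \<epsilon>. w permutes {1..n+1} \<and> \<epsilon> > 0 \<and> (\<forall>p \<in> {1..n+1}. \<forall>q \<in> {1..n+1}.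
    (height w p < height w q \<longleftrightarrow> y p + \<epsilon> * h p < y q + \<epsilon> * h q) \<and> (y p < y q \<longrightarrow> height w p < height w q))"
proof -
  obtain \<epsilon> where \<epsilon>: "\<epsilon> > 0" and
    less: "\<forall>p \<in> {1..n+1}. \<forall>q \<in> {1..n+1}. y p < y q \<longrightarrow> y p + \<epsilon> * h p < y q + \<epsilon> * h q"
    using ex_perturbation[of "n+1" y h] by auto
  let ?x = "\<lambda>p. y p + \<epsilon> * h p"
  have tot: "?x q < ?x p \<or> ?x p < ?x q" if pq: "p \<in> {1..n+1}" "q \<in> {1..n+1}" "p \<noteq> q" for p q
  proof (rule ccontr)
    assume n: "\<not> ?thesis"
    then have "\<not> y p < y q" "\<not> y q < y p" using less pq by blast+
    then have "h p = h q" using n \<epsilon> by simp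
    then show False using inj pq by (auto dest: inj_onD)
  qed
  define P where "P p q \<longleftrightarrow> ?x q < ?x p" for p q
  have "\<not> P p p" "P p q \<Longrightarrow> P q r \<Longrightarrow> P p r" for p q r by (simp_all add: P_def)
  then obtain w where "w permutes {1..n+1}"
    "\<And>p q. p \<in> {1..n+1} \<Longrightarrow> q \<in> {1..n+1} \<Longrightarrow> inv' w p < inv' w q \<longleftrightarrow> P p q"
    using linear_order_permutation[of P n] tot[folded P_def] by blast
  then show ?thesis using \<epsilon> less by (intro exI[of _ w] exI[of _ \<epsilon>]) (simp add: height_def P_def)
qed

lemma face_in_chamber:
  assumes "F \<in> faces (n + 1)"
  shows "\<exists>w. w permutes {1..n+1} \<and> F \<subseteq> runs (n + 1) (height w)"
proof -
  obtain x where x: "F = runs (n + 1) x" using assms by (auto simp: faces_def)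
  have "inj_on real {1..n+1}" by (simp add: inj_on_def)
  then obtain w where "w permutes {1..n+1}"
    "\<forall>p \<in> {1..n+1}. \<forall>q \<in> {1..n+1}. x p < x q \<longrightarrow> height w p < height w q"
    using ex_perturbed_permutation[of real n x] by blast
  then show ?thesis unfolding x by (intro exI[of _ w] conjI runs_mono) auto
qed

lemma positive_combination_iff:
  fixes s t p q :: real
  assumes "0 < s" "0 < t" "0 \<le> p" "0 \<le> q"
  shows "0 < s * p + t * q \<longleftrightarrow> 0 < p \<or> 0 < q"
proof
  assume "0 < s * p + t * q"
  then show "0 < p \<or> 0 < q" using assms by (cases "p = 0"; cases "q = 0") auto
next
  assume "0 < p \<or> 0 < q"
  then show "0 < s * p + t * q"
    using assms by (auto intro: add_pos_nonneg add_nonneg_pos)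
qed

section \<open>The cones spanned by run sets\<close>

locale reflection_coordinates =
  fixes n :: nat and e :: "nat \<Rightarrow> 'a::euclidean_space"
  assumes bij_e: "bij_betw e {1..n+1} (Basis :: 'a set)"
begin

abbreviation N :: nat where "N \<equiv> n + 1"

definition coord :: "'a \<Rightarrow> nat \<Rightarrow> real" where
  "coord v m = v \<bullet> e m"

definition from_coords :: "(nat \<Rightarrow> real) \<Rightarrow> 'a" where
  "from_coords f = (\<Sum>m\<in>{1..N}. f m *\<^sub>R e m)"

text \<open>Subtracting the mean projects onto \<open>refl_space\<close> and keeps all differences
  of coordinates.\<close>

definition centred :: "(nat \<Rightarrow> real) \<Rightarrow> 'a" where
  "centred f = from_coords (\<lambda>m. f m - (\<Sum>k\<in>{1..N}. f k) / real N)"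

definition ray :: "arc \<Rightarrow> 'a" where
  "ray \<rho> = centred (\<lambda>m. of_bool (high \<rho> m))"

text \<open>For a face this is the cone spanned by its rays; the description by runs makes
  membership and inclusion of subfaces immediate.\<close>

definition face_cone :: "arc set \<Rightarrow> 'a set" where
  "face_cone F = {v \<in> refl_space n e. runs N (coord v) \<subseteq> F}"

lemma inner_e:
  assumes "i \<in> {1..N}" "j \<in> {1..N}"
  shows "e i \<bullet> e j = of_bool (i = j)"
proof -
  have "e i \<in> Basis" "e j \<in> Basis" using bij_e assms bij_betwE by blast+
  moreover have "e i = e j \<longleftrightarrow> i = j" using bij_e assms by (meson bij_betw_imp_inj_on inj_on_eq_iff)
  ultimately show ?thesis by (simp add: inner_Basis)
qed

lemma coord_from_coords: "m \<in> {1..N} \<Longrightarrow> coord (from_coords f) m = f m"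
proof -
  assume m: "m \<in> {1..N}"
  have "coord (from_coords f) m = (\<Sum>k\<in>{1..N}. f k * (e k \<bullet> e m))"
    by (simp only: coord_def from_coords_def inner_sum_left inner_scaleR_left)
  also have "\<dots> = (\<Sum>k\<in>{1..N}. if k = m then f k else 0)"
    using inner_e[OF _ m] by (intro sum.cong) auto
  also have "\<dots> = f m" using m by (subst sum.delta) auto
  finally show ?thesis .
qed

lemma from_coords_coord: "from_coords (coord v) = v"
  unfolding from_coords_def coord_def using sum.reindex_bij_betw[OF bij_e, of "\<lambda>b. (v \<bullet> b) *\<^sub>R b"]
  by (simp add: euclidean_representation)

lemma from_coords_cong: "(\<And>m. m \<in> {1..N} \<Longrightarrow> f m = g m) \<Longrightarrow> from_coords f = from_coords g"
  unfolding from_coords_def by (intro sum.cong) auto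

lemma refl_space_iff: "v \<in> refl_space n e \<longleftrightarrow> (\<Sum>m\<in>{1..N}. coord v m) = 0"
  by (simp add: refl_space_def coord_def)

lemma subspace_refl_space: "subspace (refl_space n e)"
proof -
  have "refl_space n e = {x. (\<Sum>i\<in>{1..N}. e i) \<bullet> x = 0}"
    unfolding refl_space_def by (simp only: inner_sum_left inner_commute[of "e _"])
  then show ?thesis by (simp only: subspace_hyperplane)
qed

lemma coord_sum: "coord (\<Sum>i\<in>A. c i *\<^sub>R f i) m = (\<Sum>i\<in>A. c i * coord (f i) m)"
  by (simp add: coord_def inner_sum_left)

lemma centred_in: "centred f \<in> refl_space n e"
  unfolding refl_space_iff centred_def by (simp add: coord_from_coords sum_subtractf)

lemma coord_centred_diff:
  "m \<in> {1..N} \<Longrightarrow> m' \<in> {1..N} \<Longrightarrow> coord (centred f) m - coord (centred f) m' = f m - f m'"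
  unfolding centred_def by (simp only: coord_from_coords)

lemma refl_space_eqI:
  assumes "v \<in> refl_space n e" "v' \<in> refl_space n e"
    and d: "\<And>m m'. m \<in> {1..N} \<Longrightarrow> m' \<in> {1..N} \<Longrightarrow> coord v m - coord v m' = coord v' m - coord v' m'"
  shows "v = v'"
proof -
  have "coord v m = coord v' m" if m: "m \<in> {1..N}" for m
  proof -
    have "real N * coord v m = (\<Sum>m'\<in>{1..N}. coord v m - coord v m')"
      using assms(1) by (simp add: sum_subtractf refl_space_iff)
    also have "\<dots> = (\<Sum>m'\<in>{1..N}. coord v' m - coord v' m')"
      using d[OF m] by (intro sum.cong) auto
    also have "\<dots> = real N * coord v' m"
      using assms(2) by (simp add: sum_subtractf refl_space_iff)
    finally show ?thesis by simp
  qed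
  then have "from_coords (coord v) = from_coords (coord v')" by (rule from_coords_cong)
  then show ?thesis by (simp add: from_coords_coord)
qed

lemma ray_combination_in: "(\<Sum>\<rho>\<in>F. \<mu> \<rho> *\<^sub>R ray \<rho>) \<in> refl_space n e"
  using subspace_refl_space by (intro subspace_sum subspace_scale) (auto simp: ray_def centred_in)

lemma coord_ray_combination_diff:
  assumes "m \<in> {1..N}" "m' \<in> {1..N}"
  shows "coord (\<Sum>\<rho>\<in>F. \<mu> \<rho> *\<^sub>R ray \<rho>) m - coord (\<Sum>\<rho>\<in>F. \<mu> \<rho> *\<^sub>R ray \<rho>) m' =
    (\<Sum>\<rho>\<in>F. \<mu> \<rho> * gap \<rho> m m')"
  unfolding coord_sum sum_subtractf[symmetric] right_diff_distrib[symmetric] ray_def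
  using coord_centred_diff[OF assms] by simp

lemma ray_expansion:
  assumes v: "v \<in> refl_space n e" and F: "finite F" "F \<subseteq> arcs N" "runs N (coord v) \<subseteq> F"
  shows "v = (\<Sum>\<rho>\<in>F. weight N (coord v) \<rho> *\<^sub>R ray \<rho>)"
proof -
  have "v = (\<Sum>\<rho>\<in>runs N (coord v). weight N (coord v) \<rho> *\<^sub>R ray \<rho>)"
    by (rule refl_space_eqI[OF v ray_combination_in])
      (simp add: coord_ray_combination_diff weight_expansion)
  also have "\<dots> = (\<Sum>\<rho>\<in>F. weight N (coord v) \<rho> *\<^sub>R ray \<rho>)"
  proof (rule sum.mono_neutral_left[OF F(1,3)], rule ballI)
    fix \<rho> assume "\<rho> \<in> F - runs N (coord v)"
    then have "weight N (coord v) \<rho> = 0" using weight_eq_0 F(2) by blast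
    then show "weight N (coord v) \<rho> *\<^sub>R ray \<rho> = 0" by simp
  qed
  finally show ?thesis .
qed

text \<open>Dropping zero coefficients leaves a positive combination over part of a run set, to
  which \<open>runs_combination\<close> applies. So the weights are the coordinates on a
  cone.\<close>

lemma ray_combination:
  assumes F: "F \<in> faces N" and nn: "\<And>\<rho>. \<rho> \<in> F \<Longrightarrow> \<mu> \<rho> \<ge> 0"
    and v: "v = (\<Sum>\<rho>\<in>F. \<mu> \<rho> *\<^sub>R ray \<rho>)"
  shows "v \<in> refl_space n e" and "runs N (coord v) = {\<rho> \<in> F. \<mu> \<rho> > 0}"
    and "\<And>\<rho>. \<rho> \<in> F \<Longrightarrow> weight N (coord v) \<rho> = \<mu> \<rho>"
proof -
  obtain x0 where x0: "F = runs N x0" using F by (auto simp: faces_def)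
  let ?G = "{\<rho> \<in> F. \<mu> \<rho> > 0}"
  have v': "v = (\<Sum>\<rho>\<in>?G. \<mu> \<rho> *\<^sub>R ray \<rho>)"
    unfolding v using nn face_finite[OF F] by (intro sum.mono_neutral_right) (auto simp: order.order_iff_strict)
  show "v \<in> refl_space n e" unfolding v by (rule ray_combination_in)
  have sub: "?G \<subseteq> runs N x0" using x0 by auto
  note rc = runs_combination[OF sub, of \<mu> "coord v"]
  have d: "coord v m - coord v m' = (\<Sum>\<rho>\<in>?G. \<mu> \<rho> * gap \<rho> m m')"
    if "m \<in> {1..N}" "m' \<in> {1..N}" for m m'
    unfolding v' using coord_ray_combination_diff[OF that] .
  show R: "runs N (coord v) = ?G" by (rule rc(1)) (use d in auto)
  show "weight N (coord v) \<rho> = \<mu> \<rho>" if "\<rho> \<in> F" for \<rho>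
  proof (cases "\<mu> \<rho> > 0")
    case True
    then show ?thesis using that d by (intro rc(2)) auto
  next
    case False
    then have "\<rho> \<notin> runs N (coord v)" using R by simp
    then have "weight N (coord v) \<rho> = 0" using weight_eq_0 face_subset_arcs[OF F] that by blast
    then show ?thesis using False nn[OF that] by simp
  qed
qed

lemma face_cone_expansion:
  assumes "F \<in> faces N" "v \<in> face_cone F"
  shows "v = (\<Sum>\<rho>\<in>F. weight N (coord v) \<rho> *\<^sub>R ray \<rho>)"
  using assms face_finite face_subset_arcs by (intro ray_expansion) (auto simp: face_cone_def)

text \<open>Weights are linear on a cone as long as the resulting coefficients are nonnegative. The
  scalars \<open>s\<close> and \<open>t\<close> may be negative, which is used to prolong
  segments.\<close>

lemma face_cone_lin:
  assumes F: "F \<in> faces N" and a: "a \<in> face_cone F" and b: "b \<in> face_cone F"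
    and nn: "\<And>\<rho>. \<rho> \<in> F \<Longrightarrow> s * weight N (coord a) \<rho> + t * weight N (coord b) \<rho> \<ge> 0"
  defines "v \<equiv> s *\<^sub>R a + t *\<^sub>R b"
  shows "v \<in> face_cone F"
    and "runs N (coord v) = {\<rho> \<in> F. s * weight N (coord a) \<rho> + t * weight N (coord b) \<rho> > 0}"
    and "\<And>\<rho>. \<rho> \<in> F \<Longrightarrow> weight N (coord v) \<rho> = s * weight N (coord a) \<rho> + t * weight N (coord b) \<rho>"
proof -
  have "v = s *\<^sub>R (\<Sum>\<rho>\<in>F. weight N (coord a) \<rho> *\<^sub>R ray \<rho>) + t *\<^sub>R (\<Sum>\<rho>\<in>F. weight N (coord b) \<rho> *\<^sub>R ray \<rho>)"
    unfolding v_def using face_cone_expansion[OF F a] face_cone_expansion[OF F b] by simp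
  also have "\<dots> = (\<Sum>\<rho>\<in>F. (s * weight N (coord a) \<rho> + t * weight N (coord b) \<rho>) *\<^sub>R ray \<rho>)"
    by (simp add: scaleR_sum_right scaleR_add_left sum.distrib)
  finally have e: "v = (\<Sum>\<rho>\<in>F. (s * weight N (coord a) \<rho> + t * weight N (coord b) \<rho>) *\<^sub>R ray \<rho>)" .
  note rc = ray_combination[OF F nn e]
  show "runs N (coord v) = {\<rho> \<in> F. s * weight N (coord a) \<rho> + t * weight N (coord b) \<rho> > 0}" by (rule rc(2))
  then show "v \<in> face_cone F" using rc(1) by (auto simp: face_cone_def)
  show "weight N (coord v) \<rho> = s * weight N (coord a) \<rho> + t * weight N (coord b) \<rho>" if "\<rho> \<in> F" for \<rho>
    using rc(3) that by blast
qed

lemma convex_face_cone: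
  assumes "F \<in> faces N"
  shows "convex (face_cone F)"
  unfolding convex_def
proof (intro ballI allI impI)
  fix a b and s t :: real
  assume "a \<in> face_cone F" "b \<in> face_cone F" "0 \<le> s" "0 \<le> t" "s + t = 1"
  then show "s *\<^sub>R a + t *\<^sub>R b \<in> face_cone F"
    by (intro face_cone_lin(1)[OF assms]) (auto intro!: add_nonneg_nonneg mult_nonneg_nonneg weight_nonneg)
qed

lemma runs_eq_weight_pos:
  assumes "v \<in> face_cone F" "F \<in> faces N"
  shows "runs N (coord v) = {\<rho> \<in> F. weight N (coord v) \<rho> > 0}"
  using assms weight_pos_iff[of _ N "coord v"] face_subset_arcs[of F N] by (auto simp: face_cone_def)

text \<open>Weights are nonnegative and linear along the segment, so a run missing at an inner point
  is missing at both ends.\<close>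

lemma face_cone_face_of:
  assumes F: "F \<in> faces N" and G: "G \<subseteq> F"
  shows "face_cone G face_of face_cone F"
  unfolding face_of_def
proof (intro conjI ballI impI)
  show "face_cone G \<subseteq> face_cone F" using G by (auto simp: face_cone_def)
  show "convex (face_cone G)" by (rule convex_face_cone[OF face_subset[OF F G]])
  fix a b x assume ab: "a \<in> face_cone F" "b \<in> face_cone F" and x: "x \<in> face_cone G" "x \<in> open_segment a b"
  obtain u where u: "0 < u" "u < 1" "x = (1 - u) *\<^sub>R a + u *\<^sub>R b" using x(2) by (auto simp: in_segment)
  have nn: "(1 - u) * weight N (coord a) \<rho> + u * weight N (coord b) \<rho> \<ge> 0" for \<rho>
    using u weight_nonneg by (intro add_nonneg_nonneg mult_nonneg_nonneg) auto
  have r: "runs N (coord x) = {\<rho> \<in> F. (1 - u) * weight N (coord a) \<rho> + u * weight N (coord b) \<rho> > 0}"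
    unfolding u(3) by (rule face_cone_lin(2)[OF F ab nn])
  have "runs N (coord a) \<subseteq> runs N (coord x)" "runs N (coord b) \<subseteq> runs N (coord x)"
    unfolding r runs_eq_weight_pos[OF ab(1) F] runs_eq_weight_pos[OF ab(2) F]
    using positive_combination_iff[of "1 - u" u] u(1,2) weight_nonneg by auto
  then show "a \<in> face_cone G" "b \<in> face_cone G" using ab x(1) by (auto simp: face_cone_def)
qed

text \<open>With \<open>G\<close> the union of the run sets in \<open>T\<close>, some
  \<open>z\<close> in \<open>T\<close> has all of \<open>G\<close> as runs. For any other
  \<open>b\<close> in the cone of \<open>G\<close>, the segment from \<open>b\<close> to
  \<open>z\<close> can be prolonged beyond \<open>z\<close> within the large cone, so the face
  property brings \<open>b\<close> into \<open>T\<close>.\<close>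

lemma face_of_face_cone:
  assumes F: "F \<in> faces N" and T: "T face_of face_cone F" and ne: "T \<noteq> {}"
  shows "\<exists>G \<subseteq> F. T = face_cone G"
proof -
  have TF: "T \<subseteq> face_cone F" and Tc: "convex T"
    and Tf: "\<And>a b x. a \<in> face_cone F \<Longrightarrow> b \<in> face_cone F \<Longrightarrow> x \<in> T \<Longrightarrow> x \<in> open_segment a b \<Longrightarrow> b \<in> T"
    using T unfolding face_of_def by blast+
  define G where "G = (\<Union>v\<in>T. runs N (coord v))"
  have GF: "G \<subseteq> F" using TF by (auto simp: G_def face_cone_def)
  have finG: "finite G" using GF face_finite[OF F] finite_subset by blast
  \<comment> \<open>Midpoints of points in \<open>T\<close> stay in \<open>T\<close> and collect the
    runs of both.\<close>
  have "\<exists>z\<in>T. S \<subseteq> runs N (coord z)" if "S \<subseteq> G" for S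
    using finite_subset[OF that finG] that
  proof (induction S rule: finite_induct)
    case empty
    then show ?case using ne by auto
  next
    case (insert \<rho> S)
    then obtain z v where zv: "z \<in> T" "S \<subseteq> runs N (coord z)" "v \<in> T" "\<rho> \<in> runs N (coord v)"
      by (auto simp: G_def)
    let ?m = "(1 / 2) *\<^sub>R z + (1 / 2) *\<^sub>R v"
    have m: "?m \<in> T" by (rule convexD[OF Tc zv(1,3)]) auto
    have zvF: "z \<in> face_cone F" "v \<in> face_cone F" using zv TF by auto
    have nn: "(1 / 2) * weight N (coord z) \<rho> + (1 / 2) * weight N (coord v) \<rho> \<ge> 0" for \<rho>
      using weight_nonneg by (intro add_nonneg_nonneg mult_nonneg_nonneg) auto
    have pc: "0 < (1 / 2) * weight N (coord z) \<rho> + (1 / 2) * weight N (coord v) \<rho> \<longleftrightarrow>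
        0 < weight N (coord z) \<rho> \<or> 0 < weight N (coord v) \<rho>" for \<rho>
      by (rule positive_combination_iff) (auto simp: weight_nonneg)
    have "runs N (coord ?m) = {\<rho> \<in> F. (1 / 2) * weight N (coord z) \<rho> + (1 / 2) * weight N (coord v) \<rho> > 0}"
      by (rule face_cone_lin(2)[OF F zvF nn])
    also have "\<dots> = runs N (coord z) \<union> runs N (coord v)"
      unfolding runs_eq_weight_pos[OF zvF(1) F] runs_eq_weight_pos[OF zvF(2) F]
      using pc by blast
    finally have "insert \<rho> S \<subseteq> runs N (coord ?m)" using zv by blast
    then show ?case using m by (intro bexI[of _ ?m])
  qed
  then obtain z where z: "z \<in> T" "G \<subseteq> runs N (coord z)" by blast
  then have zG: "runs N (coord z) = G" by (auto simp: G_def)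
  have "face_cone G \<subseteq> T"
  proof
    fix b assume b: "b \<in> face_cone G"
    show "b \<in> T"
    proof (cases "b = z")
      case False
      let ?wz = "weight N (coord z)" and ?wb = "weight N (coord b)"
      have zF: "z \<in> face_cone F" using z TF by auto
      have bF: "b \<in> face_cone F" using b GF by (auto simp: face_cone_def)
      have wz: "?wz \<rho> > 0" if "\<rho> \<in> G" for \<rho>
        using that weight_pos_iff[of \<rho> N "coord z"] zG face_subset_arcs[OF F] GF by auto
      have "\<forall>\<^sub>F \<delta> in at_right 0. \<delta> * ?wb \<rho> < ?wz \<rho>" if "\<rho> \<in> G" for \<rho>
      proof -
        have "((\<lambda>\<delta>. \<delta> * ?wb \<rho>) \<longlongrightarrow> 0 * ?wb \<rho>) (at_right 0)" by (intro tendsto_intros)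
        then show ?thesis using wz[OF that] by (intro order_tendstoD(2)) auto
      qed
      then have "\<forall>\<^sub>F \<delta> in at_right 0. \<forall>\<rho>\<in>G. \<delta> * ?wb \<rho> < ?wz \<rho>"
        using finG by (intro eventually_ball_finite) auto
      then have "\<forall>\<^sub>F \<delta> in at_right (0::real). 0 < \<delta> \<and> (\<forall>\<rho>\<in>G. \<delta> * ?wb \<rho> < ?wz \<rho>)"
        by (intro eventually_conj eventually_at_right_less)
      then obtain \<delta> where \<delta>: "\<delta> > 0" "\<forall>\<rho>\<in>G. \<delta> * ?wb \<rho> < ?wz \<rho>"
        using eventually_happens trivial_limit_at_right_real by blast
      \<comment> \<open>A point slightly beyond \<open>z\<close> on the line from \<open>b\<close>;
        \<open>\<delta>\<close> is small enough to keep all weights nonnegative, and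
        \<open>z\<close> divides the segment at \<open>\<delta> / (1 + \<delta>)\<close>.\<close>
      define a where "a = (1 + \<delta>) *\<^sub>R z + (- \<delta>) *\<^sub>R b"
      have "(1 + \<delta>) * ?wz \<rho> + (- \<delta>) * ?wb \<rho> \<ge> 0" if "\<rho> \<in> F" for \<rho>
      proof (cases "\<rho> \<in> G")
        case True
        then have "\<delta> * ?wb \<rho> < ?wz \<rho>" "\<delta> * ?wz \<rho> \<ge> 0" using \<delta> weight_nonneg by auto
        then show ?thesis by (simp add: algebra_simps)
      next
        case False
        then have "\<rho> \<notin> runs N (coord b)" using b by (auto simp: face_cone_def)
        then have "?wb \<rho> = 0" using weight_eq_0 face_subset_arcs[OF F] that by blast
        then show ?thesis using \<delta> weight_nonneg[of N "coord z" \<rho>] by simp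
      qed
      then have aF: "a \<in> face_cone F" unfolding a_def by (rule face_cone_lin(1)[OF F zF bF])
      have "a - b = (1 + \<delta>) *\<^sub>R (z - b)" by (simp add: a_def algebra_simps)
      then have "a \<noteq> b" using False \<delta> by (metis add_pos_pos eq_iff_diff_eq_0 less_irrefl scaleR_eq_0_iff zero_less_one)
      moreover have "z = (1 - \<delta> / (1 + \<delta>)) *\<^sub>R a + (\<delta> / (1 + \<delta>)) *\<^sub>R b"
      proof -
        have "1 - \<delta> / (1 + \<delta>) = 1 / (1 + \<delta>)" using \<delta> by (simp add: field_simps)
        then have "(1 - \<delta> / (1 + \<delta>)) *\<^sub>R a + (\<delta> / (1 + \<delta>)) *\<^sub>R b = (1 / (1 + \<delta>)) *\<^sub>R (a + \<delta> *\<^sub>R b)"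
          by (simp add: scaleR_add_right)
        also have "a + \<delta> *\<^sub>R b = (1 + \<delta>) *\<^sub>R z" by (simp add: a_def)
        finally show ?thesis using \<delta> by simp
      qed
      ultimately have "z \<in> open_segment a b"
        unfolding in_segment using \<delta> by (intro conjI exI[of _ "\<delta> / (1 + \<delta>)"]) auto
      then show ?thesis using Tf[OF aF bF z(1)] by blast
    qed (use z in simp)
  qed
  moreover have "T \<subseteq> face_cone G" using TF by (auto simp: G_def face_cone_def)
  ultimately show ?thesis using GF by blast
qed

lemma ray_sum:
  assumes F: "F \<in> faces N" and c: "c > 0"
  shows "c *\<^sub>R (\<Sum>\<rho>\<in>F. ray \<rho>) \<in> face_cone F" "runs N (coord (c *\<^sub>R (\<Sum>\<rho>\<in>F. ray \<rho>))) = F"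
  using ray_combination[OF F, of "\<lambda>_. c" "c *\<^sub>R (\<Sum>\<rho>\<in>F. ray \<rho>)"] c
  by (auto simp: scaleR_sum_right face_cone_def)

lemma runs_zero: "runs N (coord 0) = {}"
proof -
  have "runs N (coord (\<Sum>\<rho>\<in>{}. 1 *\<^sub>R ray \<rho>)) = {\<rho> \<in> {}. (1::real) > 0}"
    by (rule ray_combination(2)) (use face_subset[of "runs N (coord 0)" N "{}"] in \<open>auto simp: faces_def\<close>)
  then show ?thesis by simp
qed

text \<open>The normalised sum of the rays of \<open>F\<close> lies on the sphere and has run set
  \<open>F\<close>.\<close>

lemma face_cone_sphere_inj:
  assumes F: "F \<in> faces N" and G: "G \<in> faces N" and eq: "face_cone F \<inter> sphere 0 1 = face_cone G \<inter> sphere 0 1"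
  shows "F \<subseteq> G"
proof (cases "F = {}")
  case False
  let ?v = "\<Sum>\<rho>\<in>F. ray \<rho>"
  have "runs N (coord ?v) = F" using ray_sum(2)[OF F, of 1] by simp
  then have nz: "?v \<noteq> 0" using False runs_zero by metis
  let ?c = "1 / norm ?v"
  have c: "?c > 0" using nz by simp
  have "?c *\<^sub>R ?v \<in> face_cone F \<inter> sphere 0 1" using ray_sum(1)[OF F c] nz by simp
  then have "runs N (coord (?c *\<^sub>R ?v)) \<subseteq> G" unfolding eq by (auto simp: face_cone_def)
  then show ?thesis using ray_sum(2)[OF F c] by simp
qed simp

text \<open>Intersecting with the sphere keeps the span, since rays can be normalised, and the rays
  of a face are independent.\<close>

lemma dim_face_cone_sphere:
  assumes F: "F \<in> faces N"
  shows "dim (face_cone F \<inter> sphere 0 1) = card F"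
proof -
  let ?S = "face_cone F \<inter> sphere 0 1"
  have single: "{\<rho>} \<in> faces N" if "\<rho> \<in> F" for \<rho> using face_subset[OF F, of "{\<rho>}"] that by simp
  have runs1: "runs N (coord (ray \<rho>)) = {\<rho>}" if "\<rho> \<in> F" for \<rho>
    using ray_sum(2)[OF single[OF that], of 1] by simp
  have inj: "inj_on ray F" using runs1 by (metis inj_onI singleton_inject)
  have ind: "independent (ray ` F)"
  proof (rule independent_if_scalars_zero)
    show "finite (ray ` F)" using face_finite[OF F] by simp
    fix f x assume z: "(\<Sum>x\<in>ray ` F. f x *\<^sub>R x) = 0" and x: "x \<in> ray ` F"
    then obtain \<rho> where r: "\<rho> \<in> F" "x = ray \<rho>" by auto
    have z': "(\<Sum>\<rho>\<in>F. f (ray \<rho>) *\<^sub>R ray \<rho>) = 0" using z by (simp add: sum.reindex[OF inj])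
    \<comment> \<open>Adding the linear relation to a positive combination with large coefficients
      gives two nonnegative expansions of one vector; the weights make them equal.\<close>
    let ?l = "\<lambda>\<rho>. 1 + \<bar>f (ray \<rho>)\<bar>" and ?l' = "\<lambda>\<rho>. 1 + \<bar>f (ray \<rho>)\<bar> + f (ray \<rho>)"
    let ?v = "\<Sum>\<rho>\<in>F. ?l \<rho> *\<^sub>R ray \<rho>"
    have v: "?v = (\<Sum>\<rho>\<in>F. ?l' \<rho> *\<^sub>R ray \<rho>)" using z' by (simp add: scaleR_add_left sum.distrib)
    have "weight N (coord ?v) \<rho> = ?l \<rho>" by (rule ray_combination(3)[OF F _ refl r(1)]) simp
    moreover have "weight N (coord ?v) \<rho> = ?l' \<rho>" by (rule ray_combination(3)[OF F _ v r(1)]) linarith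
    ultimately show "f x = 0" using r by simp
  qed
  have "?S \<subseteq> span (ray ` F)"
  proof
    fix v assume "v \<in> ?S"
    then have "v = (\<Sum>\<rho>\<in>F. weight N (coord v) \<rho> *\<^sub>R ray \<rho>)" using face_cone_expansion[OF F] by blast
    also have "\<dots> \<in> span (ray ` F)" by (intro span_sum span_scale span_base) auto
    finally show "v \<in> span (ray ` F)" .
  qed
  moreover have "ray ` F \<subseteq> span ?S"
  proof
    fix x assume "x \<in> ray ` F"
    then obtain \<rho> where r: "\<rho> \<in> F" "x = ray \<rho>" by auto
    have nz: "x \<noteq> 0" using runs1[OF r(1)] r(2) runs_zero by auto
    have "(1 / norm x) *\<^sub>R x \<in> face_cone {\<rho>}"
      using ray_sum(1)[OF single[OF r(1)], of "1 / norm x"] nz r(2) by simp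
    then have "(1 / norm x) *\<^sub>R x \<in> ?S" using r(1) nz by (auto simp: face_cone_def)
    then have "norm x *\<^sub>R ((1 / norm x) *\<^sub>R x) \<in> span ?S" by (intro span_scale span_base)
    then show "x \<in> span ?S" using nz by simp
  qed
  ultimately have "span ?S = span (ray ` F)" by (meson span_eq)
  then have "dim ?S = dim (ray ` F)" by (metis dim_span)
  also have "\<dots> = card F" using dim_eq_card_independent[OF ind] card_image[OF inj] by simp
  finally show ?thesis .
qed

section \<open>Chambers, classes and the faces of the fan\<close>

lemma coord_perm_action:
  assumes w: "w permutes {1..N}" and i: "i \<in> {1..N}"
  shows "coord (perm_action n e w x) i = coord x (inv' w i)"
proof -
  have "perm_action n e w x = (\<Sum>k\<in>{1..N}. coord x (inv' w (w k)) *\<^sub>R e (w k))"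
    unfolding perm_action_def coord_def using permutes_inverses(2)[OF w] by simp
  also have "\<dots> = from_coords (\<lambda>k. coord x (inv' w k))"
    unfolding from_coords_def
    using sum.reindex_bij_betw[OF permutes_imp_bij[OF w], of "\<lambda>k. coord x (inv' w k) *\<^sub>R e k"] by simp
  finally show ?thesis using coord_from_coords[OF i] by simp
qed

lemma chamber_eq:
  assumes w: "w permutes {1..N}"
  shows "perm_action n e w ` fund_chamber n e =
    {v \<in> refl_space n e. \<forall>p \<in> {1..N}. \<forall>q \<in> {1..N}. height w p < height w q \<longrightarrow> coord v p \<le> coord v q}"
    (is "_ = ?R")
proof (intro equalityI subsetI)
  fix v assume "v \<in> perm_action n e w ` fund_chamber n e"
  then obtain x where x: "x \<in> fund_chamber n e" "v = perm_action n e w x" by auto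
  have step: "coord x (Suc i) \<le> coord x i" if "i \<in> {1..n}" for i
    using x(1) that by (auto simp: fund_chamber_def coord_def inner_diff_right)
  have mono: "coord x j \<le> coord x i" if "1 \<le> i" "i \<le> j" "j \<le> N" for i j
    using that(2,3)
  proof (induction j rule: dec_induct)
    case (step k)
    then show ?case using \<open>\<And>i. i \<in> {1..n} \<Longrightarrow> coord x (Suc i) \<le> coord x i\<close>[of k] that(1) by auto
  qed simp
  have cv: "coord v i = coord x (inv' w i)" if "i \<in> {1..N}" for i
    using coord_perm_action[OF w that] x(2) by simp
  have "(\<Sum>m\<in>{1..N}. coord v m) = (\<Sum>m\<in>{1..N}. coord x (inv' w m))" using cv by (intro sum.cong) auto
  also have "\<dots> = (\<Sum>m\<in>{1..N}. coord x m)"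
    using sum.reindex_bij_betw[OF permutes_imp_bij[OF permutes_inv[OF w]]] .
  also have "\<dots> = 0" using x(1) by (simp add: fund_chamber_def refl_space_iff)
  finally have "v \<in> refl_space n e" by (simp add: refl_space_iff)
  moreover have "coord v p \<le> coord v q" if pq: "p \<in> {1..N}" "q \<in> {1..N}" "height w p < height w q" for p q
  proof -
    have "inv' w q \<le> inv' w p" "1 \<le> inv' w q" "inv' w p \<le> N"
      using pq inv_permutes_in[OF w, of p] inv_permutes_in[OF w, of q] by (auto simp: height_def)
    then show ?thesis using mono cv pq by metis
  qed
  ultimately show "v \<in> ?R" by blast
next
  fix v assume v: "v \<in> ?R"
  define x where "x = from_coords (\<lambda>i. coord v (w i))"
  have cx: "coord x i = coord v (w i)" if "i \<in> {1..N}" for i using coord_from_coords[OF that] by (simp add: x_def)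
  have "(\<Sum>m\<in>{1..N}. coord x m) = (\<Sum>m\<in>{1..N}. coord v (w m))" using cx by (intro sum.cong) auto
  also have "\<dots> = (\<Sum>m\<in>{1..N}. coord v m)"
    using sum.reindex_bij_betw[OF permutes_imp_bij[OF w]] .
  also have "\<dots> = 0" using v by (simp add: refl_space_iff)
  finally have "x \<in> refl_space n e" by (simp add: refl_space_iff)
  moreover have "x \<bullet> (e i - e (i + 1)) \<ge> 0" if i: "i \<in> {1..n}" for i
  proof -
    have iN: "i \<in> {1..N}" "i + 1 \<in> {1..N}" using i by auto
    have "height w (w (i + 1)) < height w (w i)" by (simp add: height_def permutes_inverses(2)[OF w])
    moreover have "w i \<in> {1..N}" "w (i + 1) \<in> {1..N}" using permutes_in[OF w] iN by blast+
    ultimately have "coord v (w (i + 1)) \<le> coord v (w i)" using v by blast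
    then show ?thesis using cx[OF iN(1)] cx[OF iN(2)] by (simp add: coord_def inner_diff_right)
  qed
  ultimately have "x \<in> fund_chamber n e" by (simp add: fund_chamber_def)
  moreover have "perm_action n e w x = v"
  proof -
    have "coord (perm_action n e w x) m = coord v m" if m: "m \<in> {1..N}" for m
    proof -
      have "inv' w m \<in> {1..N}" using inv_permutes_in[OF w] m by blast
      then show ?thesis using coord_perm_action[OF w m] cx permutes_inverses(1)[OF w] by simp
    qed
    then have "from_coords (coord (perm_action n e w x)) = from_coords (coord v)" by (rule from_coords_cong)
    then show ?thesis by (simp add: from_coords_coord)
  qed
  ultimately show "v \<in> perm_action n e w ` fund_chamber n e" by blast
qed

text \<open>A chamber of the class lies in the cone because its boundary only loses runs.
  Conversely, moving \<open>v\<close> a little in the direction of \<open>height w\<close> makes the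
  weights of all runs of \<open>w\<close> positive and adds no others; the order of the moved point
  is a permutation of the class whose closed chamber contains \<open>v\<close>.\<close>

lemma class_cone_eq:
  assumes w: "w permutes {1..N}"
  defines "C \<equiv> {w'. w' permutes {1..N} \<and> runs N (height w') = runs N (height w)}"
  shows "(\<Union>w'\<in>C. perm_action n e w' ` fund_chamber n e) = face_cone (runs N (height w))"
proof (intro equalityI subsetI)
  fix v assume "v \<in> (\<Union>w'\<in>C. perm_action n e w' ` fund_chamber n e)"
  then obtain w' where w': "w' permutes {1..N}" "runs N (height w') = runs N (height w)"
    and v: "v \<in> perm_action n e w' ` fund_chamber n e" by (auto simp: C_def)
  have v': "v \<in> refl_space n e"
    "\<And>p q. p \<in> {1..N} \<Longrightarrow> q \<in> {1..N} \<Longrightarrow> height w' p < height w' q \<Longrightarrow> coord v p \<le> coord v q"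
    using v unfolding chamber_eq[OF w'(1)] by auto
  have "runs N (coord v) \<subseteq> runs N (height w')"
  proof (rule runs_mono)
    fix l h assume lh: "l \<in> {1..N}" "h \<in> {1..N}" "coord v l < coord v h"
    then have "height w' l \<noteq> height w' h" using height_inj[OF w'(1)] by auto
    then show "height w' l < height w' h" using v'(2)[of h l] lh by linarith
  qed
  then show "v \<in> face_cone (runs N (height w))" using v'(1) w'(2) by (simp add: face_cone_def)
next
  let ?F = "runs N (height w)" and ?h = "height w"
  fix v assume v: "v \<in> face_cone ?F"
  have F: "?F \<in> faces N" by (auto simp: faces_def)
  have "inj_on ?h {1..N}" using height_inj[OF w] by (simp add: inj_on_def)
  then obtain w' \<epsilon> where w': "w' permutes {1..N}" and \<epsilon>: "\<epsilon> > 0" and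
    less: "\<forall>p \<in> {1..N}. \<forall>q \<in> {1..N}. (height w' p < height w' q \<longleftrightarrow> coord v p + \<epsilon> * ?h p < coord v q + \<epsilon> * ?h q) \<and>
      (coord v p < coord v q \<longrightarrow> height w' p < height w' q)"
    using ex_perturbed_permutation[of ?h n "coord v"] by blast
  let ?y = "\<lambda>p. coord v p + \<epsilon> * ?h p"
  have "runs N (height w') = runs N ?y" using less by (intro runs_cong) blast
  also have "runs N ?y = ?F"
  proof (rule runs_combination(1)[of ?F N ?h "\<lambda>\<rho>. weight N (coord v) \<rho> + \<epsilon> * weight N ?h \<rho>"])
    fix \<rho> assume r: "\<rho> \<in> ?F"
    then have "weight N ?h \<rho> > 0" using weight_pos_iff runs_subset by blast
    then show "0 < weight N (coord v) \<rho> + \<epsilon> * weight N ?h \<rho>"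
      using \<epsilon> weight_nonneg by (intro add_nonneg_pos mult_pos_pos) auto
  next
    fix m m' assume m: "m \<in> {1..N}" "m' \<in> {1..N}"
    have "coord v m - coord v m' = (\<Sum>\<rho>\<in>?F. weight N (coord v) \<rho> * gap \<rho> m m')"
      using coord_ray_combination_diff[OF m, of "weight N (coord v)" ?F]
      unfolding face_cone_expansion[OF F v, symmetric] .
    moreover have "\<epsilon> * ?h m - \<epsilon> * ?h m' = (\<Sum>\<rho>\<in>?F. \<epsilon> * weight N ?h \<rho> * gap \<rho> m m')"
      unfolding right_diff_distrib[symmetric] weight_expansion[OF m, of ?h] sum_distrib_left
      by (simp only: mult.assoc)
    ultimately show "?y m - ?y m' = (\<Sum>\<rho>\<in>?F. (weight N (coord v) \<rho> + \<epsilon> * weight N ?h \<rho>) * gap \<rho> m m')"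
      unfolding distrib_right sum.distrib by linarith
  qed simp
  finally have "w' \<in> C" using w' by (simp add: C_def)
  moreover have "v \<in> perm_action n e w' ` fund_chamber n e"
    unfolding chamber_eq[OF w']
  proof (intro CollectI conjI ballI impI)
    show "v \<in> refl_space n e" using v by (simp add: face_cone_def)
    fix p q assume "p \<in> {1..N}" "q \<in> {1..N}" "height w' p < height w' q"
    then show "coord v p \<le> coord v q" using less by (meson not_le less_asym)
  qed
  ultimately show "v \<in> (\<Union>w'\<in>C. perm_action n e w' ` fund_chamber n e)" by blast
qed

lemma bicambrian_maximal_cones_eq:
  assumes "bipartite_coxeter_element n c"
  shows "bicambrian_maximal_cones n c e = {face_cone (runs N (height w)) |w. w permutes {1..N}}"
proof -
  have cls: "bicambrian_congruence n c `` {w} = {w'. w' permutes {1..N} \<and> runs N (height w') = runs N (height w)}"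
    if w: "w permutes {1..N}" for w
  proof -
    have "(w, w') \<in> bicambrian_congruence n c \<longleftrightarrow> w' permutes {1..N} \<and> runs N (height w') = runs N (height w)" for w'
      unfolding bicambrian_congruence_eq[OF assms] using arc_congruence_parity_iff[OF w, of w']
      by (cases "w' permutes {1..N}") (auto simp: arc_congruence_def)
    then show ?thesis by auto
  qed
  have cone: "(\<Union>w'\<in>bicambrian_congruence n c `` {w}. perm_action n e w' ` fund_chamber n e) =
      face_cone (runs N (height w))" if "w permutes {1..N}" for w
    unfolding cls[OF that] by (rule class_cone_eq[OF that])
  have "bicambrian_maximal_cones n c e =
      (\<lambda>C. \<Union>w'\<in>C. perm_action n e w' ` fund_chamber n e) ` (\<lambda>w. bicambrian_congruence n c `` {w}) ` {w. w permutes {1..N}}"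
    unfolding bicambrian_maximal_cones_def quotient_def sym_group_def by auto
  also have "\<dots> = (\<lambda>w. face_cone (runs N (height w))) ` {w. w permutes {1..N}}"
    unfolding image_image using cone by (intro image_cong) auto
  finally show ?thesis by auto
qed

lemma bicambrian_fan_eq:
  assumes "bipartite_coxeter_element n c"
  shows "bicambrian_fan n c e = face_cone ` faces N"
proof (intro equalityI subsetI)
  fix T assume "T \<in> bicambrian_fan n c e"
  then obtain w where w: "w permutes {1..N}" "T \<noteq> {}" "T face_of face_cone (runs N (height w))"
    unfolding bicambrian_fan_def bicambrian_maximal_cones_eq[OF assms] by blast
  have F: "runs N (height w) \<in> faces N" by (auto simp: faces_def)
  show "T \<in> face_cone ` faces N" using face_of_face_cone[OF F w(3,2)] face_subset[OF F] by blast
next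
  fix T assume "T \<in> face_cone ` faces N"
  then obtain G where G: "G \<in> faces N" "T = face_cone G" by auto
  obtain w where w: "w permutes {1..N}" "G \<subseteq> runs N (height w)" using face_in_chamber[OF G(1)] by blast
  have F: "runs N (height w) \<in> faces N" by (auto simp: faces_def)
  have "T \<noteq> {}" using ray_sum(1)[OF G(1), of 1] G(2) by auto
  then show "T \<in> bicambrian_fan n c e"
    unfolding bicambrian_fan_def bicambrian_maximal_cones_eq[OF assms]
    using face_cone_face_of[OF F w(2)] G(2) w(1) by blast
qed

lemma f_number_bicambrian_sphere:
  assumes "bipartite_coxeter_element n c" and j: "j \<le> n"
  shows "f_number (bicambrian_sphere n c e) (int j - 1) = ((n + j) choose j) * (n choose j)"
proof (cases "j = 0")
  case True
  then show ?thesis by (simp add: f_number_def)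
next
  case False
  let ?S = "\<lambda>F. face_cone F \<inter> sphere 0 1"
  have sph: "bicambrian_sphere n c e = ?S ` faces N"
    unfolding bicambrian_sphere_def bicambrian_fan_eq[OF assms(1)] by (simp add: image_image)
  have "{S \<in> bicambrian_sphere n c e. spherical_dim S = int j - 1} = ?S ` {F \<in> faces N. card F = j}"
    unfolding sph spherical_dim_def using dim_face_cone_sphere by auto
  moreover have "inj_on ?S {F \<in> faces N. card F = j}"
    using face_cone_sphere_inj by (intro inj_onI) blast
  ultimately have "card {S \<in> bicambrian_sphere n c e. spherical_dim S = int j - 1} = card {F \<in> faces N. card F = j}"
    by (simp add: card_image)
  then show ?thesis using False card_faces[OF j] by (simp add: f_number_def)
qed

end

section \<open>Passage to the h-polynomial\<close>

lemma multinomial_eq: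
  assumes "j \<le> n"
  shows "real (((n + j) choose j) * (n choose j)) = fact (n + j) / (fact j * fact j * fact (n - j))"
  using assms by (simp add: binomial_fact)

text \<open>Both sides are the coefficient of \<open>x ^ (n - j)\<close> in the expected
  h-polynomial at \<open>x + 1\<close>. Extracting \<open>n choose j\<close> from each summand
  leaves Vandermonde.\<close>

lemma sum_choose_square_choose:
  assumes "j \<le> n"
  shows "(\<Sum>i\<le>n. (n choose i)\<^sup>2 * ((n - i) choose (n - j))) = ((n + j) choose j) * (n choose j)"
proof -
  have e: "(n choose i)\<^sup>2 * ((n - i) choose (n - j)) =
      (n choose j) * (if i \<le> j then (n choose i) * (j choose (j - i)) else 0)" if i: "i \<le> n" for i
  proof (cases "i \<le> j")
    case True
    have "(n choose j) * (j choose i) = (n choose i) * ((n - i) choose (j - i))"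
      by (rule choose_mult[OF True assms])
    moreover have "(n - i) choose (j - i) = (n - i) choose (n - j)"
      using binomial_symmetric[of "j - i" "n - i"] True assms by simp
    moreover have "j choose i = j choose (j - i)" using True by (rule binomial_symmetric)
    ultimately show ?thesis using True by (simp add: power2_eq_square mult_ac)
  next
    case False
    then show ?thesis using i assms by (simp add: binomial_eq_0)
  qed
  have "(\<Sum>i\<le>n. (n choose i)\<^sup>2 * ((n - i) choose (n - j))) =
      (n choose j) * (\<Sum>i\<le>n. if i \<le> j then (n choose i) * (j choose (j - i)) else 0)"
    unfolding sum_distrib_left using e by (intro sum.cong) auto
  also have "(\<Sum>i\<le>n. if i \<le> j then (n choose i) * (j choose (j - i)) else 0) = (n + j) choose j"
    by (rule vandermonde_if)
  finally show ?thesis by (simp add: mult.commute)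
qed

text \<open>Expanding \<open>h\<close> at \<open>x + 1\<close> has only positive terms, unlike
  \<open>f\<close> at \<open>x - 1\<close>; the shift is then inverted by composition.\<close>

lemma poly_eq_via_shift:
  fixes n :: nat
  defines "f \<equiv> \<Sum>j = 0..n. Polynomial.monom (real (((n + j) choose j) * (n choose j))) (n - j)"
    and "h \<equiv> \<Sum>j = 0..n. Polynomial.monom (real (n choose j) ^ 2) (n - j)"
  shows "pcompose f [:-1, 1:] = h"
proof -
  have "poly (pcompose h [:1, 1:]) x = poly f x" for x
  proof -
    have "poly (pcompose h [:1, 1:]) x = (\<Sum>i\<le>n. real (n choose i) ^ 2 * (x + 1) ^ (n - i))"
      unfolding h_def by (simp add: poly_pcompose poly_sum poly_monom atMost_atLeast0 add.commute)
    also have "\<dots> = (\<Sum>i\<le>n. real (n choose i) ^ 2 * (\<Sum>k\<le>n. real ((n - i) choose k) * x ^ k))"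
    proof (rule sum.cong[OF refl])
      fix i assume "i \<in> {..n}"
      have "(x + 1) ^ (n - i) = (\<Sum>k\<le>n - i. real ((n - i) choose k) * x ^ k)"
        using binomial_ring[of x 1 "n - i"] by simp
      also have "\<dots> = (\<Sum>k\<le>n. real ((n - i) choose k) * x ^ k)"
        by (intro sum.mono_neutral_left) (auto simp: binomial_eq_0)
      finally show "real (n choose i) ^ 2 * (x + 1) ^ (n - i) =
        real (n choose i) ^ 2 * (\<Sum>k\<le>n. real ((n - i) choose k) * x ^ k)" by simp
    qed
    also have "\<dots> = (\<Sum>k\<le>n. (\<Sum>i\<le>n. real ((n choose i)\<^sup>2 * ((n - i) choose k))) * x ^ k)"
      unfolding sum_distrib_left sum_distrib_right by (subst sum.swap) (simp add: mult_ac)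
    also have "\<dots> = (\<Sum>j\<le>n. (\<Sum>i\<le>n. real ((n choose i)\<^sup>2 * ((n - i) choose (n - j)))) * x ^ (n - j))"
      by (rule sum.reindex_bij_witness[of _ "\<lambda>k. n - k" "\<lambda>k. n - k"]) auto
    also have "\<dots> = (\<Sum>j\<le>n. real (((n + j) choose j) * (n choose j)) * x ^ (n - j))"
    proof (rule sum.cong[OF refl])
      fix j assume "j \<in> {..n}"
      then have "(\<Sum>i\<le>n. real ((n choose i)\<^sup>2 * ((n - i) choose (n - j)))) = real (((n + j) choose j) * (n choose j))"
        unfolding of_nat_sum[symmetric] using sum_choose_square_choose[of j n] by simp
      then show "(\<Sum>i\<le>n. real ((n choose i)\<^sup>2 * ((n - i) choose (n - j)))) * x ^ (n - j) =
        real (((n + j) choose j) * (n choose j)) * x ^ (n - j)" by simp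
    qed
    also have "\<dots> = poly f x" unfolding f_def by (simp add: poly_sum poly_monom atMost_atLeast0)
    finally show ?thesis .
  qed
  then have "pcompose h [:1, 1:] = f" by (simp add: poly_eq_poly_eq_iff[symmetric] fun_eq_iff)
  then have "pcompose f [:-1, 1:] = pcompose (pcompose h [:1, 1:]) [:-1, 1:]" by simp
  also have "\<dots> = pcompose h (pcompose [:1, 1:] [:-1, 1:])" by (rule pcompose_assoc[symmetric])
  also have "pcompose [:1, 1:] [:-1, 1:] = ([:0, 1:] :: real poly)" by (simp add: pcompose_pCons)
  also have "pcompose h [:0, 1:] = h" by (rule pcompose_idR)
  finally show ?thesis .
qed

theorem corollary1p2:
  fixes n :: nat and c :: "nat \<Rightarrow> nat" and e :: "nat \<Rightarrow> 'a::euclidean_space"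
  assumes "n \<ge> 1"
    and "bij_betw e {1..n+1} (Basis :: 'a set)"
    and "bipartite_coxeter_element n c"
  shows "f_polynomial n (bicambrian_sphere n c e) =
           (\<Sum>j = 0..n. Polynomial.monom (fact (n + j) / (fact j * fact j * fact (n - j))) (n - j))
       \<and> h_polynomial n (bicambrian_sphere n c e) =
           (\<Sum>j = 0..n. Polynomial.monom (real (n choose j) ^ 2) (n - j))"
proof -
  interpret reflection_coordinates n e by unfold_locales (rule assms(2))
  have f: "f_polynomial n (bicambrian_sphere n c e) =
      (\<Sum>j = 0..n. Polynomial.monom (real (((n + j) choose j) * (n choose j))) (n - j))"
    unfolding f_polynomial_def using f_number_bicambrian_sphere[OF assms(3)] by (intro sum.cong) auto
  moreover have "\<dots> = (\<Sum>j = 0..n. Polynomial.monom (fact (n + j) / (fact j * fact j * fact (n - j))) (n - j))"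
    using multinomial_eq by (intro sum.cong refl arg_cong[where f = "\<lambda>a. Polynomial.monom a _"]) auto
  ultimately show ?thesis
    unfolding h_polynomial_def using poly_eq_via_shift[of n] by simp
qed

end
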